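(* Let $\beta\in(0,1)$ be fixed, and let $f\in W^{\beta,1}(\mathbb{R}^n)$ be a non-negative function such that $\|f\|_1=1$ and $f\log f\in L^1(\mathbb{R}^n)$. Then $$\sigma_0-\omega_n\int_{\mathbb{R}^n}f(x)\log f(x)\,dx\ \ge\ \int_{\mathbb{R}^n}\int_{\mathbb{R}^n}\frac{\min\{f(x),f(y)\}-f(x)e^{-|x-y|}}{|x-y|^n}\,dx\,dy,$$ where the optimal constant is given by $$\sigma_0=\frac{d}{d\alpha}\Big|_{\alpha=0}\bigl(\alpha\,\sigma_{n,\alpha}\bigr)-n\omega_n\Gamma'(1),\qquad \alpha\,\sigma_{n,\alpha}:=\frac{n\,2^{\alpha}\,\pi^{\frac{n-\alpha-1}{2}}\,\Gamma\!\left(\frac{\alpha+1}{2}\right)\Gamma\!\left(\frac n2+1\right)^{\frac{\alpha}{n}}}{\Gamma\!\left(\frac{n+\alpha}{2}+1\right)}.$$ Equality holds if and only if $f$ is a constant multiple of the characteristic function of a ball.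
   Context: $W^{\beta,1}(\mathbb{R}^n)$ is the fractional Sobolev space of all $f\in L^1(\mathbb{R}^n)$ with $\int_{\mathbb{R}^n}\int_{\mathbb{R}^n}\frac{|f(x)-f(y)|}{|x-y|^{n+\beta}}\,dx\,dy<\infty$. $\omega_n=\pi^{n/2}/\Gamma(\frac n2+1)$ is the volume of the unit ball in $\mathbb{R}^n$, $\Gamma$ is the gamma function, and $0\log 0=0$. Functions equal almost everywhere are identified (so the equality characterization is understood up to null sets). The double integral on the right-hand side is understood as a Lebesgue integral over $\mathbb{R}^n\times\mathbb{R}^n$ with values in $(-\infty,+\infty]$. *)

theory Defs
  imports "HOL-Analysis.Analysis"
begin

text \<open>
  Functions on \<open>\<real>\<^sup>n\<close> are functions on a type \<open>'a :: euclidean_space\<close>, with \<open>n = DIM('a)\<close>.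
  Membership is invariant under changes on Lebesgue null sets, so the sets of functions below
  contain all representatives of their almost-everywhere classes. The values of the integrands
  on the diagonal are immaterial, because the diagonal is a null set.
\<close>

definition frac_sobolev_1 :: "real \<Rightarrow> ('a::euclidean_space \<Rightarrow> real) set" where
  "frac_sobolev_1 \<beta> = {f. integrable lebesgue f \<and>
     (\<integral>\<^sup>+ (x, y). ennreal (\<bar>f x - f y\<bar> / norm (x - y) powr (real DIM('a) + \<beta>))
        \<partial>(lebesgue :: ('a \<times> 'a) measure)) < \<infinity>}"

text \<open>
  The convention \<open>0 log 0 = 0\<close> agrees with \<open>0 * ln 0 = 0\<close>.
\<close>

definition admissible :: "real \<Rightarrow> ('a::euclidean_space \<Rightarrow> real) set" where
  "admissible \<beta> = {f \<in> frac_sobolev_1 \<beta>.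
     (AE x in lebesgue. 0 \<le> f x) \<and>
     (LINT x|lebesgue. \<bar>f x\<bar>) = 1 \<and>
     integrable lebesgue (\<lambda>x. f x * ln (f x))}"

definition min_integrand :: "('a::euclidean_space \<Rightarrow> real) \<Rightarrow> 'a \<times> 'a \<Rightarrow> real" where
  "min_integrand f = (\<lambda>(x, y).
     (min (f x) (f y) - f x * exp (- norm (x - y))) / norm (x - y) ^ DIM('a))"

text \<open>
  The Lebesgue integral with values in \<open>(-\<infinity>, \<infinity>]\<close>. Since \<open>ennreal\<close> maps negative reals to \<open>0\<close>,
  the two terms are the integrals of the positive and of the negative part. The value is
  meaningful for measurable functions whose negative part has a finite integral.
\<close>

definition ext_integral :: "'b measure \<Rightarrow> ('b \<Rightarrow> real) \<Rightarrow> ereal" where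
  "ext_integral M g =
     enn2ereal (\<integral>\<^sup>+ z. ennreal (g z) \<partial>M) - enn2ereal (\<integral>\<^sup>+ z. ennreal (- g z) \<partial>M)"

text \<open>
  The product \<open>\<alpha> \<sigma>\<^bsub>n,\<alpha>\<^esub>\<close> as a single function, which makes sense at \<open>\<alpha> = 0\<close> as well.
\<close>

definition alpha_sigma :: "nat \<Rightarrow> real \<Rightarrow> real" where
  "alpha_sigma n \<alpha> =
     real n * 2 powr \<alpha> * pi powr ((real n - \<alpha> - 1) / 2) * Gamma ((\<alpha> + 1) / 2) *
       Gamma (real n / 2 + 1) powr (\<alpha> / real n)
     / Gamma ((real n + \<alpha>) / 2 + 1)"

definition sigma0 :: "nat \<Rightarrow> real" where
  "sigma0 n = deriv (alpha_sigma n) 0 - real n * unit_ball_vol (real n) * deriv Gamma (1::real)"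

end

theory Submission
  imports Defs "HOL-Complex_Analysis.Great_Picard"
begin

text \<open>
  By the layer cake formula the right-hand side is an integral over the levels \<open>t > 0\<close> of
  \<open>P(E) - N(E)\<close> with \<open>E = {f > t}\<close>, where \<open>P(E)\<close> is the self-interaction of \<open>E\<close> with respect to the
  kernel \<open>(1 - e\<^sup>-\<^sup>r) / r\<^sup>n\<close> and \<open>N(E)\<close> the interaction of \<open>E\<close> with its complement with respect to
  \<open>e\<^sup>-\<^sup>r / r\<^sup>n\<close>. Both kernels decrease, so Riesz' rearrangement inequality (obtained from polarization
  and a compactness argument) bounds \<open>P(E) - N(E)\<close> by its value on the ball of the same volume \<open>m\<close>,
  which scaling and a Beta integral show to be \<open>m (\<sigma>\<^sub>0 + \<omega>\<^sub>n ln m)\<close>. Finally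
  \<open>m ln m \<le> - \<integral>\<^sub>E ln f\<close> by Jensen's inequality, and integrating over the levels gives
  \<open>\<sigma>\<^sub>0 - \<omega>\<^sub>n \<integral> f ln f\<close>. Equality forces \<open>f\<close> to be constant on some level set, to vanish outside
  it, and this level set to be extremal for Riesz' inequality with a strictly decreasing kernel;
  such a set is symmetric about hyperplanes of every direction through one centre and hence a ball.
\<close>

section \<open>Reflections\<close>

text \<open>With \<open>r = norm (x - y)\<close> the numerator is \<open>min (f x) (f y) * (1 - exp
  (- r)) - (f x - min (f x) (f y)) * exp (- r)\<close>. The kernel \<open>1 / r ^ n\<close> alone
  diverges at 0 and at infinity; the exponential tames it at 0 in the first term and at infinity in
  the second. It also produces \<open>deriv Gamma 1\<close>: the factors
  \<open>1 - exp (- r)\<close> and \<open>exp (- r)\<close> are the masses of the intervals below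
  and above \<open>r\<close> under the density \<open>exp (- t)\<close>. Radial integration of
  \<open>1 / r\<close> therefore turns gain minus loss into an average of
  \<open>ln r - ln t\<close>, and the mean of \<open>ln t\<close> is the derivative of Gamma at 1.
  The mean of \<open>ln r\<close>, over a density attached to the ball, is the derivative at 0 of
  the moments of \<open>r powr \<alpha>\<close>, which is where \<open>alpha_sigma\<close> enters.
  The obstacle throughout is subtraction of possibly infinite quantities. The Sobolev condition
  bounds the loss, because \<open>r powr \<beta> \<le> exp r\<close>; finiteness of the gain is a
  consequence of the inequality itself. Identities are therefore first proved with all terms moved
  to the side where they are added.\<close>

lemma nn_integral_lborel_translate:
  fixes f :: "'a::euclidean_space \<Rightarrow> ennreal"
  assumes [measurable]: "f \<in> borel_measurable borel"
  shows "(\<integral>\<^sup>+x. f (x + c) \<partial>lborel) = (\<integral>\<^sup>+x. f x \<partial>lborel)"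
proof -
  have "(\<integral>\<^sup>+x. f x \<partial>lborel) = (\<integral>\<^sup>+x. f x \<partial>distr lborel borel ((+) c))"
    by (simp add: lborel_distr_plus)
  also have "\<dots> = (\<integral>\<^sup>+x. f (c + x) \<partial>lborel)"
    by (subst nn_integral_distr) auto
  finally show ?thesis by (simp add: add.commute)
qed

lemma emeasure_lborel_translate:
  fixes A :: "'a::euclidean_space set"
  assumes [measurable]: "A \<in> sets borel"
  shows "(\<integral>\<^sup>+x. indicator A (x + c) \<partial>lborel) = emeasure lborel A"
  by (subst nn_integral_lborel_translate[of "indicator A"]) auto

text \<open>Uniqueness of Haar measure: for the unit ball \<open>B\<close>, Tonelli's theorem identifies
  \<open>\<bar>B\<bar> \<cdot> \<bar>T\<^sup>-\<^sup>1 A\<bar>\<close> and \<open>\<bar>A\<bar> \<cdot> \<bar>B\<bar>\<close>.\<close>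
lemma distr_lborel_isometric_involution:
  fixes T :: "'a::euclidean_space \<Rightarrow> 'a"
  assumes "linear T" and nT: "\<And>x. norm (T x) = norm x" and TT: "\<And>x. T (T x) = x"
  shows "distr lborel borel T = lborel"
proof -
  interpret T: linear T by fact
  have [measurable]: "T \<in> borel_measurable borel"
    using linear_continuous_on[of T UNIV] \<open>linear T\<close>
    by (intro borel_measurable_continuous_onI) (simp add: linear_conv_bounded_linear)
  have "emeasure (distr lborel borel T) A = emeasure lborel A" if "A \<in> sets borel" for A
  proof -
    note [measurable] = that
    have [measurable]: "ball (0::'a) 1 \<in> sets borel" by simp
    define c where "c = emeasure lborel (ball (0::'a) 1)"
    have c: "c \<noteq> 0" "c \<noteq> \<infinity>"
      by (simp_all add: c_def emeasure_ball ennreal_eq_0_iff not_le)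
    define \<mu> where "\<mu> = (\<integral>\<^sup>+x. indicator A (T x) \<partial>lborel)"
    have B: "(\<integral>\<^sup>+x. indicator (ball 0 1) (y - T x) \<partial>lborel) = c" for y :: 'a
    proof -
      have "norm (y - T x) = norm (x - T y)" for x
        by (metis TT nT T.diff norm_minus_commute)
      then have "indicator (ball 0 1) (y - T x) = (indicator (ball 0 1) (x + - T y) :: ennreal)" for x
        by (auto simp: indicator_def)
      then show ?thesis
        using emeasure_lborel_translate[of "ball 0 1" "- T y"] by (simp add: c_def)
    qed
    have tr: "(\<integral>\<^sup>+x. indicator A (T x + y) \<partial>lborel) = \<mu>" for y
    proof -
      have "(\<integral>\<^sup>+x. indicator A (T x + y) \<partial>lborel) = (\<integral>\<^sup>+x. indicator A (T (x + T y)) \<partial>lborel)"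
        by (simp add: T.add TT)
      also have "\<dots> = \<mu>" unfolding \<mu>_def
        by (rule nn_integral_lborel_translate[where f="\<lambda>x. indicator A (T x)"]) auto
      finally show ?thesis .
    qed
    have "c * \<mu> = (\<integral>\<^sup>+y. indicator (ball 0 1) y * (\<integral>\<^sup>+x. indicator A (T x + y) \<partial>lborel) \<partial>lborel)"
      unfolding tr by (subst nn_integral_multc) (measurable, simp_all add: c_def nn_integral_indicator)
    also have "\<dots> = (\<integral>\<^sup>+y. \<integral>\<^sup>+x. indicator (ball 0 1) y * indicator A (T x + y) \<partial>lborel \<partial>lborel)"
      by (intro nn_integral_cong nn_integral_cmult[symmetric]) auto
    also have "\<dots> = (\<integral>\<^sup>+x. \<integral>\<^sup>+y. indicator (ball 0 1) y * indicator A (T x + y) \<partial>lborel \<partial>lborel)"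
      by (intro lborel_pair.Fubini') measurable
    also have "\<dots> = (\<integral>\<^sup>+x. \<integral>\<^sup>+y. indicator (ball 0 1) (y - T x) * indicator A y \<partial>lborel \<partial>lborel)"
    proof (rule nn_integral_cong)
      fix x
      show "(\<integral>\<^sup>+y. indicator (ball 0 1) y * indicator A (T x + y) \<partial>lborel)
        = (\<integral>\<^sup>+y. indicator (ball 0 1) (y - T x) * indicator A y \<partial>lborel)"
        using nn_integral_lborel_translate[of "\<lambda>y. indicator (ball 0 1) (y - T x) * indicator A y" "T x"]
        by (simp add: add.commute)
    qed
    also have "\<dots> = (\<integral>\<^sup>+y. \<integral>\<^sup>+x. indicator (ball 0 1) (y - T x) * indicator A y \<partial>lborel \<partial>lborel)"
      by (intro lborel_pair.Fubini') measurable
    also have "\<dots> = (\<integral>\<^sup>+y. c * indicator A y \<partial>lborel)"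
      by (intro nn_integral_cong) (simp add: nn_integral_multc B)
    also have "\<dots> = c * emeasure lborel A"
      by (simp add: nn_integral_cmult)
    finally have "\<mu> = emeasure lborel A"
      using c by (simp add: ennreal_mult_cancel_left)
    moreover have "emeasure (distr lborel borel T) A = \<mu>" unfolding \<mu>_def
      using nn_integral_distr[of T lborel borel "indicator A"] that by simp
    ultimately show ?thesis by simp
  qed
  then show ?thesis by (intro measure_eqI) auto
qed

text \<open>For a unit vector \<open>e\<close> this is the reflection in the hyperplane
  \<open>x \<bullet> e = s\<close>. The pair of \<open>e\<close> and \<open>s\<close> also orients
  this mirror: \<open>halfspace e s\<close> is its upper side.\<close>

definition reflect :: "'a::euclidean_space \<Rightarrow> real \<Rightarrow> 'a \<Rightarrow> 'a" where
  "reflect e s x = x - (2 * (x \<bullet> e - s)) *\<^sub>R e"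

lemma reflect_measurable [measurable]: "reflect e s \<in> borel_measurable borel"
  unfolding reflect_def by measurable

lemma reflect_inner: "norm e = 1 \<Longrightarrow> reflect e s x \<bullet> e = 2 * s - x \<bullet> e"
  by (simp add: reflect_def inner_diff_left dot_square_norm)

text \<open>Parallel mirrors compose to a translation by twice their distance; the equality case of
  Riesz' inequality represents every nonzero translation in this way.\<close>

lemma reflect_comp: "norm e = 1 \<Longrightarrow> reflect e s (reflect e t x) = x + (2 * (s - t)) *\<^sub>R e"
  using reflect_inner[of e t x]
  by (simp add: reflect_def[of e s]) (simp add: reflect_def scaleR_left_diff_distrib[symmetric] scaleR_left_distrib[symmetric] diff_diff_eq algebra_simps del: scaleR_left_diff_distrib)

lemma reflect_reflect: "norm e = 1 \<Longrightarrow> reflect e s (reflect e s x) = x"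
  by (simp add: reflect_comp)

text \<open>Reversing the orientation exchanges the two sides of one mirror, so a result about upper
  half-spaces also yields the one about lower half-spaces.\<close>

lemma reflect_minus: "reflect (- e) (- s) = reflect e s"
  by (auto simp: reflect_def fun_eq_iff algebra_simps)

text \<open>The sign of the last product decides whether \<open>x\<close> is nearer to
  \<open>y\<close> or to the mirror image of \<open>y\<close>. The isometry property, the Lipschitz
  bound and the kernel comparison for polarization all rest on this identity.\<close>

lemma norm_diff_reflect_sq:
  assumes "norm e = 1"
  shows "(norm (x - reflect e s y))\<^sup>2 = (norm (x - y))\<^sup>2 + 4 * (x \<bullet> e - s) * (y \<bullet> e - s)"
proof -
  have [simp]: "e \<bullet> e = 1" using assms by (simp add: dot_square_norm)
  define a where "a = 2 * (y \<bullet> e - s)"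
  have "x - reflect e s y = (x - y) + a *\<^sub>R e"
    by (simp add: reflect_def a_def)
  moreover have "(norm (w + a *\<^sub>R e))\<^sup>2 = (norm w)\<^sup>2 + 2 * a * (w \<bullet> e) + a\<^sup>2" for w
    unfolding power2_norm_eq_inner
    by (simp add: inner_add_left inner_add_right inner_commute power2_eq_square)
  ultimately have "(norm (x - reflect e s y))\<^sup>2 = (norm (x - y))\<^sup>2 + 2 * a * ((x - y) \<bullet> e) + a\<^sup>2"
    by presburger
  also have "(x - y) \<bullet> e = x \<bullet> e - y \<bullet> e" by (simp add: inner_diff_left)
  finally show ?thesis by (simp add: a_def algebra_simps power2_eq_square)
qed

lemma norm_reflect_diff:
  assumes "norm e = 1"
  shows "norm (reflect e s x - reflect e s y) = norm (x - y)"
proof -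
  have "(norm (reflect e s x - reflect e s y))\<^sup>2 = (norm (reflect e s x - y))\<^sup>2 + 4 * (s - x \<bullet> e) * (y \<bullet> e - s)"
    using assms by (simp add: norm_diff_reflect_sq reflect_inner)
  also have "(norm (reflect e s x - y))\<^sup>2 = (norm (x - y))\<^sup>2 + 4 * (x \<bullet> e - s) * (y \<bullet> e - s)"
    using norm_diff_reflect_sq[OF assms, of y s x] by (simp add: norm_minus_commute algebra_simps)
  finally have "(norm (reflect e s x - reflect e s y))\<^sup>2 = (norm (x - y))\<^sup>2"
    by (simp add: algebra_simps)
  then show ?thesis by simp
qed

lemma norm_reflect_diff': "norm e = 1 \<Longrightarrow> norm (reflect e s x - y) = norm (x - reflect e s y)"
  by (metis norm_reflect_diff reflect_reflect)

lemma distr_reflect: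
  fixes e :: "'a::euclidean_space"
  assumes "norm e = 1"
  shows "distr lborel borel (reflect e s) = lborel"
proof -
  have 1: "distr lborel borel (reflect e 0) = lborel"
  proof (rule distr_lborel_isometric_involution)
    show "linear (reflect e 0)"
      by (rule linearI) (simp_all add: reflect_def inner_add_left algebra_simps)
    show "norm (reflect e 0 x) = norm x" for x
      using norm_reflect_diff[OF assms, of 0 x 0] by (simp add: reflect_def)
  qed (simp add: reflect_reflect assms)
  \<comment> \<open>An affine reflection is a linear one followed by a translation along
    \<open>e\<close>.\<close>
  have "distr lborel borel (reflect e s) = distr (distr lborel borel (reflect e 0)) borel ((+) ((2 * s) *\<^sub>R e))"
    by (subst distr_distr) (auto intro!: distr_cong simp: reflect_def algebra_simps)
  also have "\<dots> = lborel" unfolding 1 by (simp add: lborel_distr_plus)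
  finally show ?thesis .
qed

lemma nn_integral_reflect:
  fixes f :: "'a::euclidean_space \<Rightarrow> ennreal"
  assumes "norm e = 1" and [measurable]: "f \<in> borel_measurable borel"
  shows "(\<integral>\<^sup>+x. f (reflect e s x) \<partial>lborel) = (\<integral>\<^sup>+x. f x \<partial>lborel)"
  using nn_integral_distr[of "reflect e s" lborel borel f] distr_reflect[OF assms(1), of s] by simp

lemma AE_reflect:
  fixes e :: "'a::euclidean_space"
  assumes "norm e = 1" and "AE x in lborel. P x"
  shows "AE x in lborel. P (reflect e s x)"
proof -
  have "distr lborel borel (reflect e s) = lborel" by (rule distr_reflect[OF assms(1)])
  then have "AE x in distr lborel borel (reflect e s). P x" using assms(2) by (rule ssubst)
  from AE_distrD[OF _ this] show ?thesis by simp
qed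

lemma AE_not_hyperplane:
  fixes e :: "'a::euclidean_space"
  assumes "norm e = 1"
  shows "AE x in lborel. x \<bullet> e \<noteq> s"
proof -
  have "negligible {x. e \<bullet> x = s}" using assms by (intro negligible_hyperplane) auto
  then have "{x. e \<bullet> x = s} \<in> null_sets lborel"
    by (simp add: negligible_iff_null_sets null_sets_completion_iff)
  then show ?thesis
    by (rule AE_I') (auto simp: inner_commute)
qed

abbreviation halfspace :: "'a::euclidean_space \<Rightarrow> real \<Rightarrow> 'a set" where
  "halfspace e s \<equiv> {x. s < x \<bullet> e}"

text \<open>The reflection carries the lower half-space to the upper one, and the mirror itself is a
  null set. Comparisons of integrals thus reduce to pointwise comparisons between a point and its
  mirror image.\<close>

lemma nn_integral_fold:
  fixes f :: "'a::euclidean_space \<Rightarrow> ennreal"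
  assumes e: "norm e = 1" and [measurable]: "f \<in> borel_measurable borel"
  shows "(\<integral>\<^sup>+x. f x \<partial>lborel) = (\<integral>\<^sup>+x. indicator (halfspace e s) x * (f x + f (reflect e s x)) \<partial>lborel)"
proof -
  have "(\<integral>\<^sup>+x. f x \<partial>lborel) = (\<integral>\<^sup>+x. indicator (halfspace e s) x * f x + indicator {x. x \<bullet> e < s} x * f x \<partial>lborel)"
    using AE_not_hyperplane[OF e, of s] by (intro nn_integral_cong_AE) (auto split: split_indicator)
  also have "\<dots> = (\<integral>\<^sup>+x. indicator (halfspace e s) x * f x \<partial>lborel) + (\<integral>\<^sup>+x. indicator {x. x \<bullet> e < s} x * f x \<partial>lborel)"
    by (intro nn_integral_add) auto
  also have "(\<integral>\<^sup>+x. indicator {x. x \<bullet> e < s} x * f x \<partial>lborel)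
      = (\<integral>\<^sup>+x. indicator {x. x \<bullet> e < s} (reflect e s x) * f (reflect e s x) \<partial>lborel)"
    by (rule nn_integral_reflect[OF e, symmetric]) auto
  also have "\<dots> = (\<integral>\<^sup>+x. indicator (halfspace e s) x * f (reflect e s x) \<partial>lborel)"
    by (intro nn_integral_cong) (auto simp: reflect_inner[OF e] split: split_indicator)
  finally show ?thesis
    by (simp add: distrib_left nn_integral_add)
qed

section \<open>Polarization\<close>

text \<open>Two-point rearrangement: in each mirror pair the larger value is placed on the upper
  side.\<close>

definition polarize :: "'a::euclidean_space \<Rightarrow> real \<Rightarrow> ('a \<Rightarrow> real) \<Rightarrow> 'a \<Rightarrow> real" where
  "polarize e s u x = (if s \<le> x \<bullet> e then max (u x) (u (reflect e s x)) else min (u x) (u (reflect e s x)))"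

definition energy :: "(real \<Rightarrow> real) \<Rightarrow> ('a::euclidean_space \<Rightarrow> real) \<Rightarrow> ennreal" where
  "energy k u = (\<integral>\<^sup>+x. \<integral>\<^sup>+y. ennreal (u x * u y * k (norm (x - y))) \<partial>lborel \<partial>lborel)"

text \<open>For \<open>x\<close> and \<open>y\<close> in the upper half-space, this is the energy
  gained from the four pairs formed by the two points and their mirror images: the excess of the
  kernel on the near pairs, times the growth of the products over these pairs.\<close>

definition pol_gap :: "(real \<Rightarrow> real) \<Rightarrow> 'a::euclidean_space \<Rightarrow> real \<Rightarrow> ('a \<Rightarrow> real) \<Rightarrow> 'a \<Rightarrow> 'a \<Rightarrow> real" where
  "pol_gap k e s u x y = (k (norm (x - y)) - k (norm (x - reflect e s y))) *
     (max (u x) (u (reflect e s x)) * max (u y) (u (reflect e s y))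
      + min (u x) (u (reflect e s x)) * min (u y) (u (reflect e s y))
      - u x * u y - u (reflect e s x) * u (reflect e s y))"

lemma polarize_measurable [measurable]:
  assumes [measurable]: "u \<in> borel_measurable borel"
  shows "polarize e s u \<in> borel_measurable borel"
  unfolding polarize_def[abs_def] by measurable

lemma polarize_hs:
  assumes "norm e = 1" "s < x \<bullet> e"
  shows "polarize e s u x = max (u x) (u (reflect e s x))"
    and "polarize e s u (reflect e s x) = min (u x) (u (reflect e s x))"
  using assms by (auto simp: polarize_def reflect_inner reflect_reflect min.commute)

lemma pol_gap_measurable [measurable]:
  assumes [measurable]: "u \<in> borel_measurable borel" "k \<in> borel_measurable borel"
  shows "(\<lambda>(x, y). pol_gap k e s u x y) \<in> borel_measurable (borel \<Otimes>\<^sub>M borel)"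
  unfolding pol_gap_def[abs_def] by measurable

lemma norm_diff_le_reflect:
  assumes "norm e = 1" "s < x \<bullet> e" "s < y \<bullet> e"
  shows "norm (x - y) < norm (x - reflect e s y)"
proof -
  have "0 < (x \<bullet> e - s) * (y \<bullet> e - s)" using assms by (intro mult_pos_pos) auto
  then have "(norm (x - y))\<^sup>2 < (norm (x - reflect e s y))\<^sup>2"
    unfolding norm_diff_reflect_sq[OF assms(1)] by linarith
  then show ?thesis by (rule power2_less_imp_less) simp
qed

lemma nn_integral_fold2:
  fixes F :: "'a::euclidean_space \<Rightarrow> 'a \<Rightarrow> ennreal"
  assumes e: "norm e = 1" and [measurable]: "case_prod F \<in> borel_measurable (borel \<Otimes>\<^sub>M borel)"
  shows "(\<integral>\<^sup>+x. \<integral>\<^sup>+y. F x y \<partial>lborel \<partial>lborel) =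
    (\<integral>\<^sup>+x. \<integral>\<^sup>+y. indicator (halfspace e s) x * indicator (halfspace e s) y *
        (F x y + F (reflect e s x) (reflect e s y) + F x (reflect e s y) + F (reflect e s x) y) \<partial>lborel \<partial>lborel)"
proof -
  let ?s = "reflect e s" and ?H = "indicator (halfspace e s) :: 'a \<Rightarrow> ennreal"
  have [measurable]: "(\<lambda>y. F x y) \<in> borel_measurable borel" for x by measurable
  have [measurable]: "halfspace e s \<in> sets borel" by measurable
  have "(\<integral>\<^sup>+x. \<integral>\<^sup>+y. F x y \<partial>lborel \<partial>lborel)
    = (\<integral>\<^sup>+x. ?H x * ((\<integral>\<^sup>+y. F x y \<partial>lborel) + (\<integral>\<^sup>+y. F (?s x) y \<partial>lborel)) \<partial>lborel)"
    by (rule nn_integral_fold[OF e]) measurable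
  also have "\<dots> = (\<integral>\<^sup>+x. ?H x * ((\<integral>\<^sup>+y. ?H y * (F x y + F x (?s y)) \<partial>lborel)
       + (\<integral>\<^sup>+y. ?H y * (F (?s x) y + F (?s x) (?s y)) \<partial>lborel)) \<partial>lborel)"
    by (subst (1 2) nn_integral_fold[OF e, of _ s]) auto
  also have "\<dots> = (\<integral>\<^sup>+x. \<integral>\<^sup>+y. ?H x * (?H y * (F x y + F x (?s y)) + ?H y * (F (?s x) y + F (?s x) (?s y))) \<partial>lborel \<partial>lborel)"
    by (subst nn_integral_add[symmetric], measurable, subst nn_integral_cmult[symmetric], measurable)
  finally show ?thesis by (simp add: distrib_left ac_simps)
qed

text \<open>Pairing larger with larger maximizes a sum of two products. For oppositely ordered pairs
  the excess factors as \<open>(a' - a) * (b - b')\<close>; otherwise it is 0.\<close>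

lemma pol_gap_nonneg:
  fixes a a' b b' :: real
  shows "0 \<le> max a a' * max b b' + min a a' * min b b' - a * b - a' * b'"
proof -
  have *: "0 \<le> (a' - a) * (b - b')" if "a \<le> a'" "b' \<le> b" for a a' b b' :: real
    using that by simp
  show ?thesis
    using *[of a a' b' b] *[of a' a b b'] by (auto simp: max_def min_def algebra_simps)
qed

text \<open>Polarization keeps the total of the four products over \<open>x\<close>,
  \<open>y\<close> and their mirror images and shifts weight from the far pairs to the near ones.
  The exact gain is recorded: its sign shows that the energy does not drop, and its vanishing drives
  the equality case.\<close>

lemma energy_polarize:
  fixes u :: "'a::euclidean_space \<Rightarrow> real"
  assumes e: "norm e = 1" and u[measurable]: "u \<in> borel_measurable borel" and k[measurable]: "k \<in> borel_measurable borel"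
    and u0: "\<And>x. 0 \<le> u x" and k0: "\<And>r. 0 \<le> k r"
    and mono: "\<And>r r'. 0 < r \<Longrightarrow> r \<le> r' \<Longrightarrow> k r' \<le> k r"
  shows "energy k (polarize e s u) = energy k u +
    (\<integral>\<^sup>+x. \<integral>\<^sup>+y. indicator (halfspace e s) x * indicator (halfspace e s) y * ennreal (pol_gap k e s u x y) \<partial>lborel \<partial>lborel)"
    (is "_ = _ + ?G")
proof -
  let ?s = "reflect e s" and ?H = "indicator (halfspace e s) :: 'a \<Rightarrow> ennreal"
  define F where "F v x y = ennreal (v x * v y * k (norm (x - y)))" for v and x y :: 'a
  have F [measurable]: "case_prod (F v) \<in> borel_measurable (borel \<Otimes>\<^sub>M borel)" if [measurable]: "v \<in> borel_measurable borel" for v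
    unfolding F_def by measurable
  define S where "S v x y = F v x y + F v (?s x) (?s y) + F v x (?s y) + F v (?s x) y" for v x y
  have [measurable]: "case_prod (S u) \<in> borel_measurable (borel \<Otimes>\<^sub>M borel)"
    unfolding S_def by measurable
  have [measurable]: "halfspace e s \<in> sets borel" by measurable
  have pol0: "0 \<le> polarize e s u x" for x by (simp add: polarize_def u0 le_max_iff_disj)
  have pw: "?H x * ?H y * S (polarize e s u) x y = ?H x * ?H y * S u x y + ?H x * ?H y * ennreal (pol_gap k e s u x y)" for x y
  proof (cases "s < x \<bullet> e \<and> s < y \<bullet> e")
    case True
    then have x: "s < x \<bullet> e" and y: "s < y \<bullet> e" by auto
    define k1 k2 where "k1 = k (norm (x - y))" and "k2 = k (norm (x - ?s y))"
    have eq: "norm (?s x - ?s y) = norm (x - y)" "norm (?s x - y) = norm (x - ?s y)"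
      by (rule norm_reflect_diff[OF e], rule norm_reflect_diff'[OF e])
    have S: "S v x y = ennreal ((v x * v y + v (?s x) * v (?s y)) * k1 + (v x * v (?s y) + v (?s x) * v y) * k2)"
      if "\<And>x. 0 \<le> v x" for v
    proof -
      have "0 \<le> k1" "0 \<le> k2" by (simp_all add: k1_def k2_def k0)
      then have "S v x y = ennreal (v x * v y * k1 + v (?s x) * v (?s y) * k1 + v x * v (?s y) * k2 + v (?s x) * v y * k2)"
        unfolding S_def F_def eq k1_def[symmetric] k2_def[symmetric]
        using that by (simp add: ennreal_plus[symmetric] del: ennreal_plus)
      then show ?thesis by (simp add: distrib_right add.assoc)
    qed
    have gap: "0 \<le> pol_gap k e s u x y"
    \<comment> \<open>\<open>mono\<close> does not control \<open>k 0\<close>, but on the diagonal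
      the second factor of \<open>pol_gap\<close> is zero.\<close>
    proof (cases "x = y")
      case False
      then have "k2 \<le> k1" unfolding k1_def k2_def
        using norm_diff_le_reflect[OF e x y] by (intro mono) auto
      then show ?thesis unfolding pol_gap_def k1_def[symmetric] k2_def[symmetric]
        by (intro mult_nonneg_nonneg pol_gap_nonneg) auto
    qed (auto simp: pol_gap_def max_def min_def)
    have sum: "max a a' * min b b' + min a a' * max b b' = a * b + a' * b' + a * b' + a' * b - max a a' * max b b' - min a a' * min b b'"
      for a a' b b' :: real by (auto simp: max_def min_def)
    have "S (polarize e s u) x y = ennreal ((u x * u y + u (?s x) * u (?s y)) * k1 + (u x * u (?s y) + u (?s x) * u y) * k2 + pol_gap k e s u x y)"
      unfolding S[OF pol0] polarize_hs[OF e x] polarize_hs[OF e y] pol_gap_def k1_def[symmetric] k2_def[symmetric] sum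
      by (simp add: algebra_simps)
    also have "\<dots> = S u x y + ennreal (pol_gap k e s u x y)"
      unfolding S[OF u0] using u0 k0 gap by (subst ennreal_plus) (auto simp: k1_def k2_def)
    finally show ?thesis using True by simp
  qed auto
  have "energy k (polarize e s u) = (\<integral>\<^sup>+x. \<integral>\<^sup>+y. ?H x * ?H y * S (polarize e s u) x y \<partial>lborel \<partial>lborel)"
    unfolding energy_def S_def F_def[symmetric]
    by (rule nn_integral_fold2[OF e]) (intro F polarize_measurable u)
  also have "\<dots> = (\<integral>\<^sup>+x. \<integral>\<^sup>+y. ?H x * ?H y * S u x y \<partial>lborel \<partial>lborel) + ?G"
    unfolding pw by (subst nn_integral_add, measurable)+
  also have "(\<integral>\<^sup>+x. \<integral>\<^sup>+y. ?H x * ?H y * S u x y \<partial>lborel \<partial>lborel) = energy k u"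
    unfolding energy_def S_def F_def[symmetric]
    by (rule nn_integral_fold2[OF e, symmetric]) (intro F u)
  finally show ?thesis .
qed

text \<open>A mirror pair keeps its two values, at most exchanged, so polarization is
  equimeasurable.\<close>

lemma nn_integral_polarize:
  fixes u :: "'a::euclidean_space \<Rightarrow> real" and \<psi> :: "real \<Rightarrow> ennreal"
  assumes e: "norm e = 1" and [measurable]: "u \<in> borel_measurable borel" "\<psi> \<in> borel_measurable borel"
  shows "(\<integral>\<^sup>+x. \<psi> (polarize e s u x) \<partial>lborel) = (\<integral>\<^sup>+x. \<psi> (u x) \<partial>lborel)"
proof -
  have "(\<integral>\<^sup>+x. \<psi> (polarize e s u x) \<partial>lborel) = (\<integral>\<^sup>+x. indicator (halfspace e s) x * (\<psi> (polarize e s u x) + \<psi> (polarize e s u (reflect e s x))) \<partial>lborel)"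
    by (rule nn_integral_fold[OF e]) measurable
  also have "\<dots> = (\<integral>\<^sup>+x. indicator (halfspace e s) x * (\<psi> (u x) + \<psi> (u (reflect e s x))) \<partial>lborel)"
    by (intro nn_integral_cong) (auto simp: polarize_hs[OF e] max_def min_def add.commute split: split_indicator)
  also have "\<dots> = (\<integral>\<^sup>+x. \<psi> (u x) \<partial>lborel)"
    by (rule nn_integral_fold[OF e, symmetric]) measurable
  finally show ?thesis .
qed

text \<open>Where the weight is larger on the lower side, moving the larger values up lowers the
  integral. The exact difference is kept, because for the second moment it has to vanish at a
  minimizer.\<close>

lemma nn_integral_polarize_weight:
  fixes u :: "'a::euclidean_space \<Rightarrow> real" and w :: "'a \<Rightarrow> real"
  assumes e: "norm e = 1" and u[measurable]: "u \<in> borel_measurable borel" and w[measurable]: "w \<in> borel_measurable borel"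
    and u0: "\<And>x. 0 \<le> u x" and w0: "\<And>x. 0 \<le> w x"
    and mono: "\<And>x. s < x \<bullet> e \<Longrightarrow> w x \<le> w (reflect e s x)"
  shows "(\<integral>\<^sup>+x. ennreal (u x * w x) \<partial>lborel) = (\<integral>\<^sup>+x. ennreal (polarize e s u x * w x) \<partial>lborel) +
    (\<integral>\<^sup>+x. indicator (halfspace e s) x * ennreal ((w (reflect e s x) - w x) * max 0 (u (reflect e s x) - u x)) \<partial>lborel)"
proof -
  let ?s = "reflect e s" and ?H = "indicator (halfspace e s) :: 'a \<Rightarrow> ennreal"
  have [measurable]: "halfspace e s \<in> sets borel" by measurable
  have "(\<integral>\<^sup>+x. ennreal (u x * w x) \<partial>lborel) = (\<integral>\<^sup>+x. ?H x * (ennreal (u x * w x) + ennreal (u (?s x) * w (?s x))) \<partial>lborel)"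
    by (rule nn_integral_fold[OF e]) measurable
  also have "\<dots> = (\<integral>\<^sup>+x. ?H x * (ennreal (polarize e s u x * w x) + ennreal (polarize e s u (?s x) * w (?s x)))
       + ?H x * ennreal ((w (?s x) - w x) * max 0 (u (?s x) - u x)) \<partial>lborel)"
  proof (intro nn_integral_cong)
    fix x
    show "?H x * (ennreal (u x * w x) + ennreal (u (?s x) * w (?s x)))
      = ?H x * (ennreal (polarize e s u x * w x) + ennreal (polarize e s u (?s x) * w (?s x)))
       + ?H x * ennreal ((w (?s x) - w x) * max 0 (u (?s x) - u x))"
    proof (cases "s < x \<bullet> e")
      case True
      have "0 \<le> (w (?s x) - w x) * max 0 (u (?s x) - u x)" using mono[OF True] by simp
      moreover have "0 \<le> max (u x) (u (?s x)) * w x" "0 \<le> min (u x) (u (?s x)) * w (?s x)"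
        using u0 w0 by (simp_all add: le_max_iff_disj)
      moreover have "u x * w x + u (?s x) * w (?s x) = max (u x) (u (?s x)) * w x
          + min (u x) (u (?s x)) * w (?s x) + (w (?s x) - w x) * max 0 (u (?s x) - u x)"
        by (auto simp: max_def min_def algebra_simps)
      ultimately show ?thesis using True u0 w0
        by (simp add: polarize_hs[OF e True] ennreal_plus[symmetric] del: ennreal_plus)
    qed auto
  qed
  also have "\<dots> = (\<integral>\<^sup>+x. ?H x * (ennreal (polarize e s u x * w x) + ennreal (polarize e s u (?s x) * w (?s x))) \<partial>lborel)
       + (\<integral>\<^sup>+x. ?H x * ennreal ((w (?s x) - w x) * max 0 (u (?s x) - u x)) \<partial>lborel)"
    by (intro nn_integral_add) measurable
  also have "(\<integral>\<^sup>+x. ?H x * (ennreal (polarize e s u x * w x) + ennreal (polarize e s u (?s x) * w (?s x))) \<partial>lborel)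
     = (\<integral>\<^sup>+x. ennreal (polarize e s u x * w x) \<partial>lborel)"
    by (rule nn_integral_fold[OF e, symmetric]) measurable
  finally show ?thesis .
qed

text \<open>Points on opposite sides are the essential case: there the mirror image of
  \<open>y\<close> is at least as near to \<open>x\<close> as \<open>y\<close> is, so the Lipschitz
  bounds between the two values at \<open>x\<close> and the two at \<open>y\<close> all hold with
  \<open>norm (x - y)\<close>.\<close>

lemma polarize_lipschitz:
  assumes e: "norm e = 1" and L: "\<And>x y. \<bar>u x - u y\<bar> \<le> L * norm (x - y)"
  shows "\<bar>polarize e s u x - polarize e s u y\<bar> \<le> L * norm (x - y)"
proof -
  let ?s = "reflect e s"
  have L0: "0 \<le> L"
  proof -
    have "\<bar>u e - u 0\<bar> \<le> L * norm (e - 0)" by (rule L)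
    then show ?thesis using e by simp
  qed
  have lip: "\<bar>u x - u y\<bar> \<le> L * norm (x - y)" "\<bar>u (?s x) - u (?s y)\<bar> \<le> L * norm (x - y)" for x y
    using L[of x y] L[of "?s x" "?s y"] unfolding norm_reflect_diff[OF e] .
  have *: "\<bar>polarize e s u x - polarize e s u y\<bar> \<le> L * norm (x - y)" if "s \<le> x \<bullet> e" "\<not> s \<le> y \<bullet> e" for x y
  proof -
    have "(x \<bullet> e - s) * (y \<bullet> e - s) \<le> 0" using that by (intro mult_nonneg_nonpos) auto
    then have "(norm (x - ?s y))\<^sup>2 \<le> (norm (x - y))\<^sup>2"
      unfolding norm_diff_reflect_sq[OF e] by linarith
    then have "norm (x - ?s y) \<le> norm (x - y)"
      by (rule power2_le_imp_le) simp
    then have "L * norm (x - ?s y) \<le> L * norm (x - y)" using L0 by (rule mult_left_mono)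
    moreover have "\<bar>u x - u (?s y)\<bar> \<le> L * norm (x - ?s y)" "\<bar>u (?s x) - u y\<bar> \<le> L * norm (x - ?s y)"
      using L[of x "?s y"] L[of "?s x" y] unfolding norm_reflect_diff'[OF e] .
    ultimately have "\<bar>max (u x) (u (?s x)) - min (u y) (u (?s y))\<bar> \<le> L * norm (x - y)"
      using lip[of x y] by linarith
    then show ?thesis using that by (simp add: polarize_def)
  qed
  consider "s \<le> x \<bullet> e \<and> s \<le> y \<bullet> e" | "\<not> s \<le> x \<bullet> e \<and> \<not> s \<le> y \<bullet> e"
    | "s \<le> x \<bullet> e \<and> \<not> s \<le> y \<bullet> e" | "\<not> s \<le> x \<bullet> e \<and> s \<le> y \<bullet> e" by blast
  then show ?thesis
  proof cases
    case 1
    then show ?thesis using lip[of x y] by (simp add: polarize_def; linarith)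
  next
    case 2
    then show ?thesis using lip[of x y] by (simp add: polarize_def; linarith)
  next
    case 3
    then show ?thesis using *[of x y] by simp
  next
    case 4
    with *[of y x] show ?thesis by (simp add: norm_minus_commute abs_minus_commute)
  qed
qed

lemma norm_reflect_sq:
  "norm e = 1 \<Longrightarrow> (norm (reflect e s x))\<^sup>2 = (norm x)\<^sup>2 - 4 * s * (x \<bullet> e - s)"
  using norm_diff_reflect_sq[of e 0 s x] by (simp add: norm_minus_commute algebra_simps)

lemma nn_integral_pair_lborel:
  fixes F :: "'a::euclidean_space \<Rightarrow> 'b::euclidean_space \<Rightarrow> ennreal"
  assumes [measurable]: "case_prod F \<in> borel_measurable (borel \<Otimes>\<^sub>M borel)"
  shows "(\<integral>\<^sup>+x. \<integral>\<^sup>+y. F x y \<partial>lborel \<partial>lborel) = (\<integral>\<^sup>+(x, y). F x y \<partial>lborel)"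
proof -
  have "case_prod F \<in> borel_measurable (lborel \<Otimes>\<^sub>M lborel)" by measurable
  from lborel.nn_integral_fst[OF this] show ?thesis by (simp add: lborel_prod)
qed

text \<open>For a bounded kernel the energy is continuous in the mean:
  \<open>w x * w y - u x * u y\<close> equals \<open>(w x - u x) * w y + u x * (w y - u y)\<close>.
  The additive form avoids differences of energies that might be infinite.\<close>

lemma energy_le_energy:
  fixes u w :: "'a::euclidean_space \<Rightarrow> real"
  assumes [measurable]: "u \<in> borel_measurable borel" "w \<in> borel_measurable borel" "k \<in> borel_measurable borel"
    and u0: "\<And>x. 0 \<le> u x" and w0: "\<And>x. 0 \<le> w x" and k0: "\<And>r. 0 \<le> k r" and kM: "\<And>r. k r \<le> M"
  shows "energy k w \<le> energy k u + ennreal M * ((\<integral>\<^sup>+x. ennreal (u x) \<partial>lborel) + (\<integral>\<^sup>+x. ennreal (w x) \<partial>lborel))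
    * (\<integral>\<^sup>+x. ennreal \<bar>u x - w x\<bar> \<partial>lborel)"
    (is "_ \<le> _ + _ * (?U + ?W) * ?D")
proof -
  have M0: "0 \<le> M" using k0[of 0] kM[of 0] by simp
  have pw: "ennreal (w x * w y * k (norm (x - y))) \<le> ennreal (u x * u y * k (norm (x - y))) +
      (ennreal M * ennreal \<bar>u x - w x\<bar> * ennreal (w y) + ennreal M * ennreal (u x) * ennreal \<bar>u y - w y\<bar>)" for x y :: 'a
  proof -
    define \<kappa> where "\<kappa> = k (norm (x - y))"
    have \<kappa>: "0 \<le> \<kappa>" "\<kappa> \<le> M" by (auto simp: \<kappa>_def k0 kM)
    have "w x * w y * \<kappa> = u x * u y * \<kappa> + \<kappa> * ((w x - u x) * w y + u x * (w y - u y))"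
      by (simp add: algebra_simps)
    also have "\<dots> \<le> u x * u y * \<kappa> + \<kappa> * (\<bar>u x - w x\<bar> * w y + u x * \<bar>u y - w y\<bar>)"
      using \<kappa> u0[of x] u0[of y] w0[of y] by (intro add_left_mono mult_left_mono add_mono mult_right_mono) auto
    also have "\<dots> \<le> u x * u y * \<kappa> + M * (\<bar>u x - w x\<bar> * w y + u x * \<bar>u y - w y\<bar>)"
      using \<kappa> u0[of x] w0[of y] by (intro add_left_mono mult_right_mono) auto
    finally have "w x * w y * \<kappa> \<le> u x * u y * \<kappa> + (M * \<bar>u x - w x\<bar> * w y + M * u x * \<bar>u y - w y\<bar>)"
      by (simp add: algebra_simps)
    then have "ennreal (w x * w y * \<kappa>) \<le> ennreal (u x * u y * \<kappa> + (M * \<bar>u x - w x\<bar> * w y + M * u x * \<bar>u y - w y\<bar>))"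
      by (rule ennreal_leI)
    also have "\<dots> = ennreal (u x * u y * \<kappa>) +
      (ennreal M * ennreal \<bar>u x - w x\<bar> * ennreal (w y) + ennreal M * ennreal (u x) * ennreal \<bar>u y - w y\<bar>)"
      using \<kappa> u0 w0 M0 by (simp add: ennreal_mult ennreal_plus)
    finally show ?thesis unfolding \<kappa>_def .
  qed
  have "energy k w \<le> (\<integral>\<^sup>+x. \<integral>\<^sup>+y. ennreal (u x * u y * k (norm (x - y))) +
      (ennreal M * ennreal \<bar>u x - w x\<bar> * ennreal (w y) + ennreal M * ennreal (u x) * ennreal \<bar>u y - w y\<bar>) \<partial>lborel \<partial>lborel)"
    unfolding energy_def by (intro nn_integral_mono pw)
  also have "\<dots> = energy k u + ((\<integral>\<^sup>+x. ennreal M * ennreal \<bar>u x - w x\<bar> * ?W \<partial>lborel) + (\<integral>\<^sup>+x. ennreal M * ennreal (u x) * ?D \<partial>lborel))"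
    unfolding energy_def by (simp add: nn_integral_add nn_integral_cmult)
  also have "\<dots> = energy k u + ennreal M * (?U + ?W) * ?D"
    by (simp add: nn_integral_multc nn_integral_cmult algebra_simps)
  finally show ?thesis .
qed

section \<open>Existence of a radially decreasing competitor\<close>

text \<open>Serves to turn almost-everywhere comparisons of continuous functions into pointwise
  ones.\<close>

lemma open_AE_not_in_imp_empty:
  assumes "open S" "AE x in lborel. x \<notin> S"
  shows "S = {}"
proof -
  have "S \<in> null_sets lborel"
    using assms by (subst (asm) AE_iff_null_sets[symmetric]) auto
  then have "negligible S" by (simp add: negligible_iff_null_sets null_sets_completionI)
  then show ?thesis using open_not_negligible[OF assms(1)] by blast
qed

lemma lipschitz_borel_measurable:
  fixes v :: "'a::euclidean_space \<Rightarrow> real"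
  assumes "\<And>x y. \<bar>v x - v y\<bar> \<le> L * norm (x - y)"
  shows "continuous_on UNIV v" "v \<in> borel_measurable borel"
proof -
  have "0 \<le> L"
  proof -
    obtain b :: 'a where "b \<in> Basis" using nonempty_Basis by blast
    have "\<bar>v b - v 0\<bar> \<le> L * norm (b - 0)" by (rule assms)
    then show ?thesis using \<open>b \<in> Basis\<close> by simp
  qed
  then have "L-lipschitz_on UNIV v"
    by (intro lipschitz_onI) (auto simp: dist_norm assms)
  then show "continuous_on UNIV v" by (rule lipschitz_on_continuous_on)
  then show "v \<in> borel_measurable borel" by (rule borel_measurable_continuous_onI)
qed

text \<open>Among the Lipschitz functions with the same \<open>\<integral> v\<close> and \<open>\<integral> v\<^sup>2\<close> and no smaller energy,
  one of least second moment \<open>\<integral> v \<bar>x\<bar>\<^sup>2\<close> exists by Arzela--Ascoli; since polarization would decrease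
  the second moment further, it is radially decreasing.\<close>
lemma radially_decreasing_competitor:
  fixes u :: "'a::euclidean_space \<Rightarrow> real"
  assumes uL: "\<And>x y. \<bar>u x - u y\<bar> \<le> L * norm (x - y)" and u01: "\<And>x. 0 \<le> u x" "\<And>x. u x \<le> 1"
    and uR: "\<And>x. R < norm x \<Longrightarrow> u x = 0"
    and k[measurable]: "k \<in> borel_measurable borel" and k0: "\<And>r. 0 \<le> k r" and kM: "\<And>r. k r \<le> M"
    and mono: "\<And>r r'. 0 < r \<Longrightarrow> r \<le> r' \<Longrightarrow> k r' \<le> k r"
  obtains v :: "'a \<Rightarrow> real" where "v \<in> borel_measurable borel" "\<And>x. 0 \<le> v x" "\<And>x. v x \<le> 1"
    "\<And>x y. norm x < norm y \<Longrightarrow> v y \<le> v x"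
    "(\<integral>\<^sup>+x. ennreal (v x) \<partial>lborel) = (\<integral>\<^sup>+x. ennreal (u x) \<partial>lborel)"
    "(\<integral>\<^sup>+x. ennreal ((v x)\<^sup>2) \<partial>lborel) = (\<integral>\<^sup>+x. ennreal ((u x)\<^sup>2) \<partial>lborel)"
    "energy k u \<le> energy k v"
proof -
  \<comment> \<open>Prescribing both integrals fixes the integral of \<open>v - v\<^sup>2\<close>.
    For values in the unit interval its smallness means that \<open>v\<close> is close to an
    indicator, so this property of \<open>u\<close> is inherited by every member of
    \<open>K\<close>.\<close>
  define K :: "('a \<Rightarrow> real) set" where "K = {v. (\<forall>x y. \<bar>v x - v y\<bar> \<le> L * norm (x - y)) \<and> (\<forall>x. 0 \<le> v x \<and> v x \<le> 1)
    \<and> (\<forall>x. R < norm x \<longrightarrow> v x = 0)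
    \<and> (\<integral>\<^sup>+x. ennreal (v x) \<partial>lborel) = (\<integral>\<^sup>+x. ennreal (u x) \<partial>lborel)
    \<and> (\<integral>\<^sup>+x. ennreal ((v x)\<^sup>2) \<partial>lborel) = (\<integral>\<^sup>+x. ennreal ((u x)\<^sup>2) \<partial>lborel)
    \<and> energy k u \<le> energy k v}"
  define \<Phi> where "\<Phi> v = (\<integral>\<^sup>+x. ennreal (v x * (norm x)\<^sup>2) \<partial>lborel)" for v :: "'a \<Rightarrow> real"
  have M0: "0 \<le> M" using k0[of 0] kM[of 0] by simp
  have KL: "\<bar>v x - v y\<bar> \<le> L * norm (x - y)" "0 \<le> v x" "v x \<le> 1" "R < norm x \<Longrightarrow> v x = 0"
       "(\<integral>\<^sup>+x. ennreal (v x) \<partial>lborel) = (\<integral>\<^sup>+x. ennreal (u x) \<partial>lborel)"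
       "(\<integral>\<^sup>+x. ennreal ((v x)\<^sup>2) \<partial>lborel) = (\<integral>\<^sup>+x. ennreal ((u x)\<^sup>2) \<partial>lborel)" "energy k u \<le> energy k v"
    if "v \<in> K" for v x y using that by (auto simp: K_def)
  have Km: "v \<in> borel_measurable borel" if "v \<in> K" for v
    using lipschitz_borel_measurable(2)[of v L] KL(1)[OF that] by blast
  have "u \<in> K" using uL u01 uR by (auto simp: K_def)
  let ?B = "cball (0::'a) R"
  have Bs [measurable]: "?B \<in> sets borel" by simp
  have iB [measurable]: "indicat_real ?B \<in> borel_measurable borel" by (simp add: borel_measurable_indicator Bs)
  have ind: "v x \<le> indicator ?B x" if "v \<in> K" for v x
    using KL(2-4)[OF that] by (auto simp: indicator_def)
  have fin: "emeasure lborel ?B < \<infinity>" by (rule emeasure_lborel_cball_finite)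
  have w: "v x * (norm x)\<^sup>2 \<le> R\<^sup>2 * indicator ?B x" if "v \<in> K" for v x
  proof (cases "norm x \<le> R")
    case True
    then have "v x * (norm x)\<^sup>2 \<le> 1 * R\<^sup>2"
      using KL(2,3)[OF that] by (intro mult_mono power_mono) auto
    then show ?thesis using True by simp
  qed (use KL(4)[OF that] in auto)
  have Rfin: "(\<integral>\<^sup>+x. ennreal (R\<^sup>2 * indicator ?B x) \<partial>lborel) < \<infinity>"
  proof -
    have "ennreal (R\<^sup>2 * indicator ?B x) = ennreal (R\<^sup>2) * indicator ?B x" for x by (auto simp: indicator_def)
    then show ?thesis using fin by (simp only:) (simp add: nn_integral_cmult_indicator ennreal_mult_less_top)
  qed
  have \<Phi>fin: "\<Phi> v < \<infinity>" if "v \<in> K" for v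
    unfolding \<Phi>_def using Rfin w[OF that] by (intro le_less_trans[OF nn_integral_mono Rfin] ennreal_leI)
  define I where "I = (INF v\<in>K. \<Phi> v)"
  have "I < \<infinity>" using \<Phi>fin[OF \<open>u \<in> K\<close>] INF_lower[OF \<open>u \<in> K\<close>, of \<Phi>] by (auto simp: I_def)
  have "\<exists>v\<in>K. \<Phi> v < I + ennreal (1 / Suc j)" for j
  proof -
    have "I < I + ennreal (1 / Suc j)" using \<open>I < \<infinity>\<close> by (simp add: ennreal_less_top ennreal_add_left_cancel_less[of I 0, simplified])
    then show ?thesis unfolding I_def[of, abs_def] INF_less_iff[symmetric] by (simp add: I_def)
  qed
  then obtain v where vK: "\<And>j. v j \<in> K" and v\<Phi>: "\<And>j. \<Phi> (v j) < I + ennreal (1 / Suc j)" by metis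
  obtain g and r :: "nat \<Rightarrow> nat" where r: "strict_mono r"
    and g: "\<And>e. 0 < e \<Longrightarrow> \<exists>N. \<forall>n x. N \<le> n \<and> x \<in> ?B \<longrightarrow> norm (v (r n) x - g x) < e"
  proof (rule Arzela_Ascoli[of ?B v 1])
    show "compact ?B" by simp
    show "norm (v n x) \<le> 1" for n x using KL(2,3)[OF vK] by simp
    show "\<exists>d>0. \<forall>n y. y \<in> ?B \<and> norm (x - y) < d \<longrightarrow> norm (v n x - v n y) < e" if "0 < e" for x :: 'a and e :: real
    \<comment> \<open>The \<open>+ 1\<close> keeps the denominator positive when
      \<open>L = 0\<close>.\<close>
    proof (intro exI[of _ "e / (\<bar>L\<bar> + 1)"] conjI allI impI)
      fix n y assume "y \<in> ?B \<and> norm (x - y) < e / (\<bar>L\<bar> + 1)"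
      then have "norm (x - y) * (\<bar>L\<bar> + 1) < e" by (simp add: field_simps)
      moreover have "norm (v n x - v n y) \<le> L * norm (x - y)" using KL(1)[OF vK] by simp
      moreover have "L * norm (x - y) \<le> norm (x - y) * (\<bar>L\<bar> + 1)"
        unfolding mult.commute[of L] by (intro mult_left_mono) auto
      ultimately show "norm (v n x - v n y) < e" by linarith
    qed (use that in simp)
  qed (blast intro: that)
  \<comment> \<open>Arzela--Ascoli yields the limit on the ball; outside the ball every
    \<open>v j\<close> vanishes.\<close>
  define h where "h x = (if norm x \<le> R then g x else 0)" for x
  have lim: "(\<lambda>n. v (r n) x) \<longlonglongrightarrow> h x" for x
  proof (cases "norm x \<le> R")
    case True
    then show ?thesis unfolding LIMSEQ_iff h_def using g by fastforce
  next
    case False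
    then show ?thesis using KL(4)[OF vK] by (simp add: h_def)
  qed
  have hL: "\<bar>h x - h y\<bar> \<le> L * norm (x - y)" for x y
    by (rule tendsto_upperbound[OF tendsto_rabs[OF tendsto_diff[OF lim lim]]]) (use KL(1)[OF vK] in auto)
  have h01: "0 \<le> h x" "h x \<le> 1" for x
    using tendsto_lowerbound[OF lim, of 0 x] tendsto_upperbound[OF lim, of x 1] KL(2,3)[OF vK] by auto
  have hm [measurable]: "h \<in> borel_measurable borel" and [measurable]: "\<And>n. v n \<in> borel_measurable borel"
    using lipschitz_borel_measurable(2)[of h L] hL Km[OF vK] by auto
  have Bfin: "(\<integral>\<^sup>+x. ennreal (indicator ?B x) \<partial>lborel) < \<infinity>" using fin by (simp add: ennreal_indicator)
  have "(\<lambda>n. \<integral>\<^sup>+x. ennreal (v (r n) x) \<partial>lborel) \<longlonglongrightarrow> (\<integral>\<^sup>+x. ennreal (h x) \<partial>lborel)"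
    by (rule nn_integral_dominated_convergence[where w="\<lambda>x. ennreal (indicator ?B x)"])
       (use Bfin in \<open>auto intro!: ennreal_leI ind vK tendsto_ennrealI lim\<close>)
  then have h1: "(\<integral>\<^sup>+x. ennreal (h x) \<partial>lborel) = (\<integral>\<^sup>+x. ennreal (u x) \<partial>lborel)"
    unfolding KL(5)[OF vK] by (rule LIMSEQ_unique) (rule tendsto_const)
  have "(\<lambda>n. \<integral>\<^sup>+x. ennreal ((v (r n) x)\<^sup>2) \<partial>lborel) \<longlonglongrightarrow> (\<integral>\<^sup>+x. ennreal ((h x)\<^sup>2) \<partial>lborel)"
  proof (rule nn_integral_dominated_convergence[where w="\<lambda>x. ennreal (indicator ?B x)"])
    show "AE x in lborel. ennreal ((v (r j) x)\<^sup>2) \<le> ennreal (indicator ?B x)" for j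
    proof (intro AE_I2 ennreal_leI)
      fix x
      have "(v (r j) x)\<^sup>2 \<le> v (r j) x"
        using KL(2,3)[OF vK] by (simp add: power2_eq_square mult_left_le)
      then show "(v (r j) x)\<^sup>2 \<le> indicator ?B x" using ind[OF vK] order_trans by blast
    qed
  qed (use Bfin in \<open>auto intro!: tendsto_ennrealI tendsto_power lim\<close>)
  then have h2: "(\<integral>\<^sup>+x. ennreal ((h x)\<^sup>2) \<partial>lborel) = (\<integral>\<^sup>+x. ennreal ((u x)\<^sup>2) \<partial>lborel)"
    unfolding KL(6)[OF vK] by (rule LIMSEQ_unique) (rule tendsto_const)
  have en: "energy k w = (\<integral>\<^sup>+(x, y). ennreal (w x * w y * k (norm (x - y))) \<partial>lborel)"
    if [measurable]: "w \<in> borel_measurable borel" for w :: "'a \<Rightarrow> real"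
    unfolding energy_def by (rule nn_integral_pair_lborel) measurable
  have "(\<lambda>n. energy k (v (r n))) \<longlonglongrightarrow> energy k h"
  proof (simp add: en, rule nn_integral_dominated_convergence[where w="\<lambda>(x, y). ennreal (M * (indicator ?B x * indicator ?B y))"])
    show "(\<lambda>(x, y). ennreal (v (r j) x * v (r j) y * k (norm (x - y)))) \<in> borel_measurable lborel" for j
      unfolding lborel_prod[symmetric] by measurable
    show "(\<lambda>(x, y). ennreal (h x * h y * k (norm (x - y)))) \<in> borel_measurable lborel"
      unfolding lborel_prod[symmetric] by measurable
    show m: "(\<lambda>(x, y). ennreal (M * (indicator ?B x * indicator ?B y))) \<in> borel_measurable lborel"
      unfolding lborel_prod[symmetric] by measurable
    have "v (r j) x * v (r j) y * k (norm (x - y)) \<le> (indicator ?B x * indicator ?B y) * M" for j x y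
      using ind[OF vK, of "r j" x] ind[OF vK, of "r j" y] kM[of "norm (x - y)"] KL(2)[OF vK] k0
      by (intro mult_mono mult_nonneg_nonneg) auto
    then show "AE z in lborel. (case z of (x, y) \<Rightarrow> ennreal (v (r j) x * v (r j) y * k (norm (x - y))))
        \<le> (case z of (x, y) \<Rightarrow> ennreal (M * (indicator ?B x * indicator ?B y)))" for j
      by (intro AE_I2) (auto intro!: ennreal_leI simp: mult.commute)
    have "(\<integral>\<^sup>+(x, y). ennreal (M * (indicator ?B x * indicator ?B y)) \<partial>(lborel :: ('a \<times> 'a) measure))
      = (\<integral>\<^sup>+x. \<integral>\<^sup>+y. ennreal M * (indicator ?B x * indicator ?B y) \<partial>lborel \<partial>lborel)"
      using M0 by (subst nn_integral_pair_lborel[symmetric]) (measurable, simp add: ennreal_mult ennreal_indicator)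
    also have "\<dots> < \<infinity>"
      using fin by (simp add: nn_integral_cmult nn_integral_multc ennreal_mult_less_top)
    finally show "(\<integral>\<^sup>+z. (case z of (x, y) \<Rightarrow> ennreal (M * (indicator ?B x * indicator ?B y))) \<partial>(lborel :: ('a \<times> 'a) measure)) < \<infinity>" .
    show "AE z in lborel. (\<lambda>n. case z of (x, y) \<Rightarrow> ennreal (v (r n) x * v (r n) y * k (norm (x - y))))
        \<longlonglongrightarrow> (case z of (x, y) \<Rightarrow> ennreal (h x * h y * k (norm (x - y))))"
      by (intro AE_I2) (auto intro!: tendsto_ennrealI tendsto_mult lim)
  qed
  then have h3: "energy k u \<le> energy k h"
    by (rule tendsto_lowerbound) (use KL(7)[OF vK] in auto)
  have hK: "h \<in> K" using hL h01 h1 h2 h3 by (auto simp: K_def h_def)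
  have "(\<lambda>n. \<Phi> (v (r n))) \<longlonglongrightarrow> \<Phi> h" unfolding \<Phi>_def
    by (rule nn_integral_dominated_convergence[where w="\<lambda>x. ennreal (R\<^sup>2 * indicator ?B x)"])
       (use Rfin in \<open>auto intro!: ennreal_leI w vK tendsto_ennrealI tendsto_mult lim\<close>)
  moreover have "(\<lambda>n. I + ennreal (1 / Suc n)) \<longlonglongrightarrow> I + ennreal 0"
    by (intro tendsto_add tendsto_const tendsto_ennrealI LIMSEQ_Suc[OF lim_1_over_n])
  moreover have "\<Phi> (v (r n)) \<le> I + ennreal (1 / Suc n)" for n
  proof -
    have "ennreal (1 / Suc (r n)) \<le> ennreal (1 / Suc n)"
      using strict_mono_imp_increasing[OF r, of n] by (intro ennreal_leI divide_left_mono) auto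
    then show ?thesis using v\<Phi>[of "r n"] by (meson add_left_mono le_less order_trans)
  qed
  ultimately have "\<Phi> h \<le> I + ennreal 0" by (elim LIMSEQ_le) (assumption, blast)
  then have \<Phi>h: "\<Phi> h \<le> I" by simp
  have dec: "h y \<le> h x" if "norm x < norm y" for x y
  proof -
    \<comment> \<open>The mirror is the perpendicular bisector of \<open>x\<close> and
      \<open>y\<close>, with \<open>x\<close> on the upper side. Since
      \<open>norm x < norm y\<close>, the origin lies strictly on the upper side too
      (\<open>s < 0\<close>), so polarization moves mass towards the origin.\<close>
    define e where "e = (x - y) /\<^sub>R norm (x - y)"
    define s where "s = (x + y) \<bullet> e / 2"
    have xy: "x \<noteq> y" using that by auto
    have e: "norm e = 1" using xy by (simp add: e_def)
    have xye: "(x - y) \<bullet> e = norm (x - y)"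
      using xy by (simp add: e_def dot_square_norm power2_eq_square)
    have xey: "(norm (x - y)) *\<^sub>R e = x - y" using xy by (simp add: e_def)
    have "(x + y) \<bullet> (x - y) = (norm x)\<^sup>2 - (norm y)\<^sup>2"
      by (simp only: power2_norm_eq_inner inner_add_left inner_diff_right) (simp add: inner_commute)
    moreover have "(norm x)\<^sup>2 < (norm y)\<^sup>2" using that by (intro power_strict_mono) auto
    ultimately have "(x + y) \<bullet> (x - y) < 0" by simp
    moreover have "s = (x + y) \<bullet> (x - y) / (2 * norm (x - y))"
      by (simp add: s_def e_def inverse_eq_divide)
    ultimately have s0: "s < 0" using xy by (simp only: divide_less_0_iff) simp
    have xs: "x \<bullet> e - s = norm (x - y) / 2" "y \<bullet> e - s = - norm (x - y) / 2"
      using xye by (simp_all add: s_def inner_add_left inner_diff_left field_simps)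
    have sx: "reflect e s x = y" unfolding reflect_def xs(1) using xey by simp
    let ?p = "polarize e s h"
    have pm [measurable]: "?p \<in> borel_measurable borel" by measurable
    have pK: "?p \<in> K"
    proof -
      \<comment> \<open>The support stays in the ball: above the mirror the image of
        \<open>z\<close> is even farther from the origin, so both values vanish; below it the
        minimum is taken.\<close>
      have "?p z = 0" if "R < norm z" for z
      proof (cases "s \<le> z \<bullet> e")
        case True
        have "(norm z)\<^sup>2 \<le> (norm (reflect e s z))\<^sup>2"
          using True s0 by (simp add: norm_reflect_sq[OF e] mult_nonpos_nonneg)
        then have "norm z \<le> norm (reflect e s z)" by (rule power2_le_imp_le) simp
        then show ?thesis using KL(4)[OF hK, of z] KL(4)[OF hK, of "reflect e s z"] True that by (simp add: polarize_def)
      next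
        case False
        then show ?thesis using KL(4)[OF hK, of z] h01(1) that by (simp add: polarize_def)
      qed
      moreover have "energy k u \<le> energy k ?p"
        using h3 energy_polarize[where u=h and s=s, OF e hm k h01(1) k0 mono] by (simp add: add_increasing2)
      moreover have "0 \<le> ?p x \<and> ?p x \<le> 1" for x by (auto simp: polarize_def h01 le_max_iff_disj min_le_iff_disj)
      ultimately show ?thesis
        using polarize_lipschitz[OF e, where u=h and L=L] hL h1 h2 nn_integral_polarize[OF e, where u=h and \<psi>=ennreal and s=s] nn_integral_polarize[OF e, where u=h and \<psi>="\<lambda>t. ennreal (t\<^sup>2)" and s=s]
        by (auto simp: K_def)
    qed
    let ?G = "\<integral>\<^sup>+z. indicator (halfspace e s) z * ennreal (((norm (reflect e s z))\<^sup>2 - (norm z)\<^sup>2) * max 0 (h (reflect e s z) - h z)) \<partial>lborel"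
    have "\<Phi> h = \<Phi> ?p + ?G" unfolding \<Phi>_def
      by (rule nn_integral_polarize_weight[OF e])
         (use s0 h01 in \<open>auto simp: norm_reflect_sq[OF e] mult_nonpos_nonneg simp del: norm_scaleR\<close>)
    moreover have "\<Phi> h \<le> \<Phi> ?p" using \<Phi>h INF_lower[OF pK, of \<Phi>] by (simp add: I_def)
    \<comment> \<open>Minimality of \<open>h\<close> leaves no room for the decrease, and finiteness
      of \<open>\<Phi> ?p\<close> allows it to be cancelled.\<close>
    ultimately have "?G = 0" using \<Phi>fin[OF pK]
      using ennreal_add_left_cancel_le[of "\<Phi> ?p" ?G 0] by (auto simp: less_top)
    then have "AE z in lborel. indicator (halfspace e s) z * ennreal (((norm (reflect e s z))\<^sup>2 - (norm z)\<^sup>2) * max 0 (h (reflect e s z) - h z)) = 0"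
      by (subst (asm) nn_integral_0_iff_AE) auto
    then have "AE z in lborel. z \<notin> {z. s < z \<bullet> e \<and> h z < h (reflect e s z)}"
    proof eventually_elim
      case (elim z)
      show ?case
      proof
        assume "z \<in> {z. s < z \<bullet> e \<and> h z < h (reflect e s z)}"
        then have z: "s < z \<bullet> e" "h z < h (reflect e s z)" by auto
        have "0 < (norm (reflect e s z))\<^sup>2 - (norm z)\<^sup>2"
          using z s0 by (simp add: norm_reflect_sq[OF e] mult_neg_pos)
        then have "0 < ((norm (reflect e s z))\<^sup>2 - (norm z)\<^sup>2) * max 0 (h (reflect e s z) - h z)"
          using z by (intro mult_pos_pos) auto
        then show False using elim z by simp
      qed
    qed
    \<comment> \<open>The null set of violations is open by continuity and therefore empty; in
      particular \<open>x\<close> is no violation.\<close>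
    moreover have "open {z. s < z \<bullet> e \<and> h z < h (reflect e s z)}"
    proof -
      have ch: "continuous_on UNIV h" using lipschitz_borel_measurable(1)[of h L] hL by blast
      have "continuous_on UNIV (\<lambda>z. h (reflect e s z))"
        by (rule continuous_on_compose2[OF ch]) (auto simp: reflect_def intro!: continuous_intros)
      with ch show ?thesis
        by (intro open_Collect_conj open_Collect_less continuous_intros)
    qed
    ultimately have "{z. s < z \<bullet> e \<and> h z < h (reflect e s z)} = {}"
      by (intro open_AE_not_in_imp_empty)
    moreover have "s < x \<bullet> e" using xs(1) xy by (smt (verit) half_gt_zero right_minus_eq zero_less_norm_iff)
    ultimately show "h y \<le> h x" using sx by fastforce
  qed
  show thesis by (rule that[of h]) (use h01 dec h1 h2 h3 in auto)
qed

section \<open>Riesz' rearrangement inequality\<close>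

lemma compact_inner_approx:
  fixes E :: "'a::euclidean_space set"
  assumes [measurable]: "E \<in> sets borel" and fin: "emeasure lborel E < \<infinity>" and "0 < \<eta>"
  obtains K where "compact K" "K \<subseteq> E" "emeasure lborel (E - K) \<le> ennreal \<eta>"
proof -
  obtain T where T: "closed T" "T \<subseteq> E" "emeasure lebesgue (E - T) < ennreal (\<eta>/2)"
    using sets_lebesgue_inner_closed[of E "\<eta>/2"] \<open>0 < \<eta>\<close> by (metis assms(1) half_gt_zero sets_completionI_sets sets_lborel)
  have [measurable]: "T \<in> sets borel" using T by simp
  have ET: "emeasure lborel (E - T) < ennreal (\<eta>/2)"
    using T by (simp add: emeasure_completion)
  define A where "A n = T - cball 0 (real n)" for n
  have [measurable]: "A n \<in> sets borel" for n by (simp add: A_def)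
  have "emeasure lborel (A n) \<le> emeasure lborel E" for n
    using T by (intro emeasure_mono) (auto simp: A_def)
  then have "emeasure lborel (A n) \<noteq> \<infinity>" for n
    using fin le_less_trans[of "emeasure lborel (A n)" "emeasure lborel E" \<infinity>] by auto
  then have "(\<lambda>n. emeasure lborel (A n)) \<longlonglongrightarrow> emeasure lborel (\<Inter>n. A n)"
    by (intro Lim_emeasure_decseq) (auto simp: decseq_def A_def)
  moreover have "(\<Inter>n. A n) = {}"
    using real_arch_simple by (fastforce simp: A_def)
  ultimately have "(\<lambda>n. emeasure lborel (A n)) \<longlonglongrightarrow> 0" by simp
  then have "eventually (\<lambda>n. emeasure lborel (A n) < ennreal (\<eta>/2)) sequentially"
    by (rule order_tendstoD) (use \<open>0 < \<eta>\<close> in simp)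
  then obtain n where n: "emeasure lborel (A n) < ennreal (\<eta>/2)" by (auto simp: eventually_sequentially)
  have "emeasure lborel (E - T \<inter> cball 0 (real n)) \<le> emeasure lborel ((E - T) \<union> A n)"
    by (intro emeasure_mono) (auto simp: A_def)
  also have "\<dots> \<le> emeasure lborel (E - T) + emeasure lborel (A n)"
    by (intro emeasure_subadditive) auto
  also have "\<dots> \<le> ennreal (\<eta>/2) + ennreal (\<eta>/2)"
    using ET n by (intro add_mono) auto
  also have "\<dots> = ennreal \<eta>" using \<open>0 < \<eta>\<close> by (simp add: ennreal_plus[symmetric] del: ennreal_plus)
  finally show thesis
    using T by (intro that[of "T \<inter> cball 0 (real n)"]) (auto simp: closed_Int_compact)
qed

lemma lipschitz_approx_compact:
  fixes K :: "'a::euclidean_space set"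
  assumes K: "compact K" and "0 < \<eta>"
  obtains u :: "'a \<Rightarrow> real" and L R where "\<And>x y. \<bar>u x - u y\<bar> \<le> L * norm (x - y)" "\<And>x. 0 \<le> u x" "\<And>x. u x \<le> 1"
    "\<And>x. R < norm x \<Longrightarrow> u x = 0" "(\<integral>\<^sup>+x. ennreal \<bar>u x - indicator K x\<bar> \<partial>lborel) \<le> ennreal \<eta>"
proof (cases "K = {}")
  case True
  then show thesis by (intro that[of "\<lambda>_. 0" 0 0]) auto
next
  case False
  obtain R where R: "\<And>x. x \<in> K \<Longrightarrow> norm x \<le> R" using compact_imp_bounded[OF K] by (auto simp: bounded_iff)
  \<comment> \<open>Tents over \<open>K\<close> whose slopes grow with \<open>n\<close>. Slope at
    least 1 keeps all supports within distance 1 of \<open>K\<close>, which gives a common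
    dominating ball.\<close>
  define u where "u n x = max 0 (1 - real (Suc n) * infdist x K)" for n x
  have [measurable]: "u n \<in> borel_measurable borel" for n
    unfolding u_def by (intro borel_measurable_continuous_onI continuous_intros)
  have Ks [measurable]: "K \<in> sets borel" using K by (simp add: compact_imp_closed)
  have [measurable]: "cball 0 (R + 1) \<in> sets (borel :: 'a measure)" by simp
  have u01: "0 \<le> u n x" "u n x \<le> 1" for n x by (auto simp: u_def infdist_nonneg)
  have uK: "u n x = 1" if "x \<in> K" for n x using that by (simp add: u_def)
  have uR: "u n x = 0" if "R + 1 < norm x" for n x
  proof -
    obtain y where y: "y \<in> K" "infdist x K = dist x y"
      using infdist_attains_inf[OF compact_imp_closed[OF K] False] by blast
    have "norm x \<le> dist x y + norm y" using norm_triangle_sub[of x y] by (simp add: dist_norm)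
    then have "1 < infdist x K" using that R[OF y(1)] y(2) by linarith
    moreover have "1 * infdist x K \<le> real (Suc n) * infdist x K"
      by (intro mult_right_mono) (auto simp: infdist_nonneg)
    ultimately have "1 \<le> real (Suc n) * infdist x K" by linarith
    then show ?thesis by (simp add: u_def del: of_nat_Suc)
  qed
  have uL: "\<bar>u n x - u n y\<bar> \<le> real (Suc n) * norm (x - y)" for n x y
  proof -
    have "\<bar>infdist x K - infdist y K\<bar> \<le> norm (x - y)"
      using infdist_triangle[of x K y] infdist_triangle[of y K x] by (auto simp: dist_norm norm_minus_commute)
    then have "real (Suc n) * \<bar>infdist x K - infdist y K\<bar> \<le> real (Suc n) * norm (x - y)"
      by (intro mult_left_mono) auto
    moreover have "real (Suc n) * \<bar>infdist x K - infdist y K\<bar> = \<bar>real (Suc n) * infdist x K - real (Suc n) * infdist y K\<bar>"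
      by (simp only: right_diff_distrib[symmetric] abs_mult abs_of_nat)
    ultimately show ?thesis by (simp only: u_def; linarith)
  qed
  have pt: "(\<lambda>n. u n x) \<longlonglongrightarrow> indicator K x" for x
  proof (cases "x \<in> K")
    case True
    then show ?thesis by (simp add: uK)
  next
    case False
    then have "0 < infdist x K"
      using in_closed_iff_infdist_zero[OF compact_imp_closed[OF K] \<open>K \<noteq> {}\<close>] infdist_nonneg[of x K] by (metis less_eq_real_def)
    then obtain N where N: "1 < real N * infdist x K" using reals_Archimedean3 by blast
    have "u n x = 0" if "N \<le> n" for n
    proof -
      have "real N * infdist x K \<le> real (Suc n) * infdist x K"
        using that by (intro mult_right_mono) (auto simp: infdist_nonneg)
      then show ?thesis using N by (simp add: u_def)
    qed
    then show ?thesis using False by (auto intro!: tendsto_eventually exI[of _ N] simp: eventually_sequentially)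
  qed
  have "(\<lambda>n. \<integral>\<^sup>+x. ennreal \<bar>u n x - indicator K x\<bar> \<partial>lborel) \<longlonglongrightarrow> (\<integral>\<^sup>+x. ennreal 0 \<partial>(lborel :: 'a measure))"
  proof (rule nn_integral_dominated_convergence[where w="\<lambda>x. indicator (cball 0 (R + 1)) x"])
    show "AE x in lborel. ennreal \<bar>u j x - indicator K x\<bar> \<le> indicator (cball 0 (R + 1)) x" for j
    proof (intro AE_I2)
      fix x
      have "\<bar>u j x - indicator K x\<bar> \<le> 1" using u01[of j x] by (auto simp: indicator_def)
      moreover have "\<bar>u j x - indicator K x\<bar> = 0" if "R + 1 < norm x"
        using uR[OF that] R[of x] that by (auto simp: indicator_def)
      ultimately show "ennreal \<bar>u j x - indicator K x\<bar> \<le> indicator (cball 0 (R + 1)) x"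
        by (auto simp: indicator_def not_le simp flip: ennreal_1 intro!: ennreal_leI)
    qed
    show "AE x in lborel. (\<lambda>i. ennreal \<bar>u i x - indicator K x\<bar>) \<longlonglongrightarrow> ennreal 0"
    proof (intro AE_I2 tendsto_ennrealI)
      fix x
      show "(\<lambda>i. \<bar>u i x - indicator K x\<bar>) \<longlonglongrightarrow> 0"
        using tendsto_rabs[OF tendsto_diff[OF pt[of x] tendsto_const[of "indicator K x"]]] by simp
    qed
  qed (use emeasure_lborel_cball_finite[of 0 "R + 1"] in auto)
  then have "(\<lambda>n. \<integral>\<^sup>+x. ennreal \<bar>u n x - indicator K x\<bar> \<partial>lborel) \<longlonglongrightarrow> 0" by simp
  then have "eventually (\<lambda>n. (\<integral>\<^sup>+x. ennreal \<bar>u n x - indicator K x\<bar> \<partial>lborel) < ennreal \<eta>) sequentially"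
    by (rule order_tendstoD) (use \<open>0 < \<eta>\<close> in simp)
  then obtain n where "(\<integral>\<^sup>+x. ennreal \<bar>u n x - indicator K x\<bar> \<partial>lborel) < ennreal \<eta>" by (auto simp: eventually_sequentially)
  then show thesis using u01 uR uL by (intro that[of "u n" "real (Suc n)" "R + 1"]) auto
qed

text \<open>A Lipschitz approximation \<open>u\<close> of the indicator of \<open>E\<close> is
  replaced by a radially decreasing \<open>v\<close> of no smaller energy. As
  \<open>v - v\<^sup>2\<close> has the same small integral as \<open>u - u\<^sup>2\<close>,
  \<open>v\<close> is close to the indicator of a level set. This level set is nested with the ball
  and has almost its measure, hence is close to it.\<close>

lemma riesz_rearrangement_bounded_kernel:
  fixes E :: "'a::euclidean_space set"
  assumes E[measurable]: "E \<in> sets borel" and fin: "emeasure lborel E < \<infinity>"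
    and B: "emeasure lborel (ball (0::'a) \<rho>) = emeasure lborel E"
    and k[measurable]: "k \<in> borel_measurable borel" and k0: "\<And>r. 0 \<le> k r" and kM: "\<And>r. k r \<le> M"
    and mono: "\<And>r r'. 0 < r \<Longrightarrow> r \<le> r' \<Longrightarrow> k r' \<le> k r"
  shows "energy k (indicator E) \<le> energy k (indicator (ball (0::'a) \<rho>))"
proof -
  let ?B = "ball (0::'a) \<rho>"
  have [measurable]: "?B \<in> sets borel" by simp
  have M0: "0 \<le> M" using k0[of 0] kM[of 0] by simp
  obtain m where m: "emeasure lborel E = ennreal m" "0 \<le> m"
    using fin by (cases "emeasure lborel E") auto
  have mE: "(\<integral>\<^sup>+x. ennreal (indicator E x) \<partial>lborel) = ennreal m"
    and mB: "(\<integral>\<^sup>+x. ennreal (indicator ?B x) \<partial>lborel) = ennreal m"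
    using m B by (simp_all add: ennreal_indicator)
  \<comment> \<open>The errors in the mean are \<open>\<eta>\<close> from \<open>E\<close> to
    \<open>u\<close> and \<open>5 * \<eta>\<close> from \<open>v\<close> to the ball. Each is
    multiplied by \<open>M\<close> and by a total mass of at most \<open>2 * m + \<eta>\<close>, and
    \<open>\<eta> \<le> 1\<close>.\<close>
  have main: "energy k (indicator E) \<le> energy k (indicator ?B) + ennreal (6 * M * (2 * m + 1) * \<eta>)"
    if \<eta>: "0 < \<eta>" "\<eta> \<le> 1" for \<eta>
  proof -
    obtain K where K: "compact K" "K \<subseteq> E" "emeasure lborel (E - K) \<le> ennreal (\<eta>/2)"
      using compact_inner_approx[OF E fin, of "\<eta>/2"] \<eta> by auto
    have [measurable]: "K \<in> sets borel" using K by (simp add: compact_imp_closed)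
    obtain u :: "'a \<Rightarrow> real" and L R where u: "\<And>x y. \<bar>u x - u y\<bar> \<le> L * norm (x - y)" and u01: "\<And>x. 0 \<le> u x" "\<And>x. u x \<le> 1"
      and uR: "\<And>x. R < norm x \<Longrightarrow> u x = 0" and uK: "(\<integral>\<^sup>+x. ennreal \<bar>u x - indicator K x\<bar> \<partial>lborel) \<le> ennreal (\<eta>/2)"
      by (rule lipschitz_approx_compact[OF K(1) half_gt_zero[OF \<eta>(1)]]) (blast intro: that)
    have um [measurable]: "u \<in> borel_measurable borel" by (rule lipschitz_borel_measurable(2)[of u L]) (rule u)
    have D: "(\<integral>\<^sup>+x. ennreal \<bar>u x - indicator E x\<bar> \<partial>lborel) \<le> ennreal \<eta>"
    proof -
      have "(\<integral>\<^sup>+x. ennreal \<bar>u x - indicator E x\<bar> \<partial>lborel) \<le> (\<integral>\<^sup>+x. ennreal \<bar>u x - indicator K x\<bar> + indicator (E - K) x \<partial>lborel)"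
      proof (intro nn_integral_mono)
        fix x
        have "\<bar>u x - indicator E x\<bar> \<le> \<bar>u x - indicator K x\<bar> + indicator (E - K) x"
          using K(2) by (auto simp: indicator_def)
        then have "ennreal \<bar>u x - indicator E x\<bar> \<le> ennreal (\<bar>u x - indicator K x\<bar> + indicator (E - K) x)" by (rule ennreal_leI)
        then show "ennreal \<bar>u x - indicator E x\<bar> \<le> ennreal \<bar>u x - indicator K x\<bar> + indicator (E - K) x"
          by (simp add: ennreal_plus ennreal_indicator)
      qed
      also have "\<dots> = (\<integral>\<^sup>+x. ennreal \<bar>u x - indicator K x\<bar> \<partial>lborel) + emeasure lborel (E - K)"
        by (simp add: nn_integral_add)
      also have "\<dots> \<le> ennreal (\<eta>/2) + ennreal (\<eta>/2)" using uK K by (intro add_mono)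
      also have "\<dots> = ennreal \<eta>" using \<eta> by (simp add: ennreal_plus[symmetric] del: ennreal_plus)
      finally show ?thesis .
    qed
    obtain v :: "'a \<Rightarrow> real" where v[measurable]: "v \<in> borel_measurable borel" and v01: "\<And>x. 0 \<le> v x" "\<And>x. v x \<le> 1"
      and vdec: "\<And>x y. norm x < norm y \<Longrightarrow> v y \<le> v x"
      and v1: "(\<integral>\<^sup>+x. ennreal (v x) \<partial>lborel) = (\<integral>\<^sup>+x. ennreal (u x) \<partial>lborel)"
      and v2: "(\<integral>\<^sup>+x. ennreal ((v x)\<^sup>2) \<partial>lborel) = (\<integral>\<^sup>+x. ennreal ((u x)\<^sup>2) \<partial>lborel)"
      and ven: "energy k u \<le> energy k v"
      by (rule radially_decreasing_competitor[OF u u01 uR k k0 kM mono]) (blast intro: that)+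
    have triangle: "(\<integral>\<^sup>+x. ennreal (a x) \<partial>lborel) \<le> (\<integral>\<^sup>+x. ennreal (b x) \<partial>lborel) + (\<integral>\<^sup>+x. ennreal \<bar>a x - b x\<bar> \<partial>lborel)"
      if [measurable]: "a \<in> borel_measurable borel" "b \<in> borel_measurable borel" and "\<And>x. 0 \<le> a x" "\<And>x. 0 \<le> b x" for a b :: "'a \<Rightarrow> real"
      using that by (subst nn_integral_add[symmetric])
        (auto intro!: nn_integral_mono ennreal_leI simp: ennreal_plus[symmetric] simp del: ennreal_plus)
    have u_le: "(\<integral>\<^sup>+x. ennreal (u x) \<partial>lborel) \<le> ennreal (m + \<eta>)"
    proof -
      have "(\<integral>\<^sup>+x. ennreal (u x) \<partial>lborel) \<le> ennreal m + (\<integral>\<^sup>+x. ennreal \<bar>u x - indicator E x\<bar> \<partial>lborel)"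
        unfolding mE[symmetric] by (rule triangle) (auto simp: u01)
      also have "\<dots> \<le> ennreal m + ennreal \<eta>" by (intro add_left_mono D)
      finally have "(\<integral>\<^sup>+x. ennreal (u x) \<partial>lborel) \<le> ennreal m + ennreal \<eta>" .
      then show ?thesis using m \<eta> by (simp add: ennreal_plus[symmetric] del: ennreal_plus)
    qed
    have m_le: "ennreal m \<le> (\<integral>\<^sup>+x. ennreal (u x) \<partial>lborel) + ennreal \<eta>"
    proof -
      have "ennreal m \<le> (\<integral>\<^sup>+x. ennreal (u x) \<partial>lborel) + (\<integral>\<^sup>+x. ennreal \<bar>indicator E x - u x\<bar> \<partial>lborel)"
        unfolding mE[symmetric] by (rule triangle) (auto simp: u01)
      also have "\<dots> \<le> (\<integral>\<^sup>+x. ennreal (u x) \<partial>lborel) + ennreal \<eta>"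
        using D by (intro add_left_mono) (simp only: abs_minus_commute)
      finally show ?thesis .
    qed
    \<comment> \<open>At the threshold 1/2 the distance from \<open>v x\<close> to the nearer of 0
      and 1 is at most \<open>2 * (v x - (v x)\<^sup>2)\<close>.\<close>
    define G where "G = {x. 1/2 \<le> v x}"
    have [measurable]: "G \<in> sets borel" unfolding G_def by measurable
    have vv: "(\<integral>\<^sup>+x. ennreal (v x - (v x)\<^sup>2) \<partial>lborel) \<le> ennreal \<eta>"
    proof -
      have *: "(\<integral>\<^sup>+x. ennreal (w x) \<partial>lborel) = (\<integral>\<^sup>+x. ennreal ((w x)\<^sup>2) \<partial>lborel) + (\<integral>\<^sup>+x. ennreal (w x - (w x)\<^sup>2) \<partial>lborel)"
        if [measurable]: "w \<in> borel_measurable borel" and w: "\<And>x. 0 \<le> w x" "\<And>x. w x \<le> 1" for w :: "'a \<Rightarrow> real"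
      proof -
        have "(w x)\<^sup>2 \<le> w x" for x using w by (simp add: power2_eq_square mult_left_le)
        then show ?thesis
          by (subst nn_integral_add[symmetric]) (auto simp: ennreal_plus[symmetric] simp del: ennreal_plus)
      qed
      have eq: "(\<integral>\<^sup>+x. ennreal ((u x)\<^sup>2) \<partial>lborel) + (\<integral>\<^sup>+x. ennreal (v x - (v x)\<^sup>2) \<partial>lborel)
          = (\<integral>\<^sup>+x. ennreal ((u x)\<^sup>2) \<partial>lborel) + (\<integral>\<^sup>+x. ennreal (u x - (u x)\<^sup>2) \<partial>lborel)"
        using *[OF v v01] *[OF um u01] unfolding v1 v2 by (rule trans[OF sym])
      have "(\<integral>\<^sup>+x. ennreal ((u x)\<^sup>2) \<partial>lborel) \<le> (\<integral>\<^sup>+x. ennreal (u x) \<partial>lborel)"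
        using u01 by (intro nn_integral_mono ennreal_leI) (simp add: power2_eq_square mult_left_le)
      also note u_le
      finally have "(\<integral>\<^sup>+x. ennreal ((u x)\<^sup>2) \<partial>lborel) \<noteq> \<infinity>"
        by (auto simp: top_unique)
      with eq have "(\<integral>\<^sup>+x. ennreal (v x - (v x)\<^sup>2) \<partial>lborel) = (\<integral>\<^sup>+x. ennreal (u x - (u x)\<^sup>2) \<partial>lborel)"
        by (simp add: ennreal_add_left_cancel)
      also have "\<dots> \<le> (\<integral>\<^sup>+x. ennreal \<bar>u x - indicator E x\<bar> \<partial>lborel)"
      proof (intro nn_integral_mono ennreal_leI)
        fix x
        have "u x * (1 - u x) \<le> 1 * (1 - u x)" "u x * (1 - u x) \<le> u x * 1"
          using u01[of x] by (intro mult_right_mono mult_left_mono; simp)+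
        then show "u x - (u x)\<^sup>2 \<le> \<bar>u x - indicator E x\<bar>"
          using u01[of x] by (auto simp: indicator_def power2_eq_square algebra_simps)
      qed
      also note D
      finally show ?thesis .
    qed
    have vG: "(\<integral>\<^sup>+x. ennreal \<bar>v x - indicator G x\<bar> \<partial>lborel) \<le> ennreal (2 * \<eta>)"
    proof -
      have "\<bar>v x - indicator G x\<bar> \<le> 2 * (v x - (v x)\<^sup>2)" for x
      proof (cases "x \<in> G")
        case True
        then have "0 \<le> (1 - v x) * (2 * v x - 1)" using v01(2)[of x] by (auto simp: G_def)
        then show ?thesis using True v01(2)[of x] by (simp add: algebra_simps power2_eq_square)
      next
        case False
        then have "0 \<le> v x * (1 - 2 * v x)" using v01(1)[of x] by (auto simp: G_def)
        then show ?thesis using False v01(1)[of x] by (simp add: algebra_simps power2_eq_square)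
      qed
      then have "(\<integral>\<^sup>+x. ennreal \<bar>v x - indicator G x\<bar> \<partial>lborel) \<le> (\<integral>\<^sup>+x. ennreal 2 * ennreal (v x - (v x)\<^sup>2) \<partial>lborel)"
        using v01 by (intro nn_integral_mono) (simp only: ennreal_mult'[symmetric] zero_le_numeral ennreal_leI)
      also have "\<dots> \<le> ennreal 2 * ennreal \<eta>"
        using vv by (subst nn_integral_cmult) (auto intro: mult_left_mono)
      finally show ?thesis using \<eta> by (simp add: ennreal_mult)
    qed
    have GB: "(\<integral>\<^sup>+x. ennreal \<bar>indicator G x - indicator ?B x\<bar> \<partial>lborel) \<le> ennreal (3 * \<eta>)"
    \<comment> \<open>Because \<open>v\<close> is radially decreasing, \<open>G\<close> either
      contains the ball or is contained in it. The distance of the indicators is then a difference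
      of measures: \<open>2 * \<eta>\<close> for replacing \<open>v\<close> by \<open>G\<close>, and
      \<open>\<eta>\<close> for the mass of \<open>v\<close>.\<close>
    proof (cases "\<exists>y\<in>G. \<rho> \<le> norm y")
      case True
      then obtain y where "1/2 \<le> v y" "\<rho> \<le> norm y" by (auto simp: G_def)
      then have "?B \<subseteq> G"
      proof (intro subsetI)
        fix x assume "x \<in> ?B"
        with \<open>\<rho> \<le> norm y\<close> have "norm x < norm y" by simp
        from vdec[OF this] \<open>1/2 \<le> v y\<close> show "x \<in> G" by (simp add: G_def)
      qed
      then have "(\<integral>\<^sup>+x. ennreal \<bar>indicator G x - indicator ?B x\<bar> \<partial>lborel) + ennreal m = (\<integral>\<^sup>+x. ennreal (indicator G x) \<partial>lborel)"
        unfolding mB[symmetric] by (subst nn_integral_add[symmetric])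
          (auto intro!: nn_integral_cong simp: ennreal_plus[symmetric] indicator_def simp del: ennreal_plus)
      also have "\<dots> \<le> (\<integral>\<^sup>+x. ennreal (v x) \<partial>lborel) + (\<integral>\<^sup>+x. ennreal \<bar>indicator G x - v x\<bar> \<partial>lborel)"
        by (rule triangle) (auto simp: v01)
      also have "\<dots> \<le> (\<integral>\<^sup>+x. ennreal (v x) \<partial>lborel) + ennreal (2 * \<eta>)"
        using vG by (intro add_left_mono) (simp only: abs_minus_commute)
      also have "\<dots> \<le> ennreal (m + \<eta>) + ennreal (2 * \<eta>)" using u_le v1 by (intro add_mono) auto
      also have "\<dots> = ennreal (3 * \<eta>) + ennreal m" using m \<eta> by (simp add: ennreal_plus[symmetric] del: ennreal_plus)
      finally show ?thesis by (simp add: add.commute)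
    next
      case False
      then have "G \<subseteq> ?B" by force
      then have "(\<integral>\<^sup>+x. ennreal \<bar>indicator G x - indicator ?B x\<bar> \<partial>lborel) + emeasure lborel G = ennreal m"
        unfolding mB[symmetric] by (subst nn_integral_indicator[symmetric], simp, subst nn_integral_add[symmetric])
          (auto intro!: nn_integral_cong simp: indicator_def)
      also have "ennreal m \<le> (\<integral>\<^sup>+x. ennreal (v x) \<partial>lborel) + ennreal \<eta>" using m_le v1 by simp
      also have "(\<integral>\<^sup>+x. ennreal (v x) \<partial>lborel) + ennreal \<eta> \<le> (emeasure lborel G + ennreal (2 * \<eta>)) + ennreal \<eta>"
      proof (rule add_right_mono)
        have "(\<integral>\<^sup>+x. ennreal (v x) \<partial>lborel) \<le> (\<integral>\<^sup>+x. ennreal (indicator G x) \<partial>lborel) + (\<integral>\<^sup>+x. ennreal \<bar>v x - indicator G x\<bar> \<partial>lborel)"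
          by (rule triangle) (auto simp: v01)
        also have "\<dots> \<le> emeasure lborel G + ennreal (2 * \<eta>)"
          using vG by (simp add: ennreal_indicator add_left_mono)
        finally show "(\<integral>\<^sup>+x. ennreal (v x) \<partial>lborel) \<le> emeasure lborel G + ennreal (2 * \<eta>)" .
      qed
      also have "emeasure lborel G + ennreal (2 * \<eta>) + ennreal \<eta> = ennreal (3 * \<eta>) + emeasure lborel G"
        using \<eta> by (simp add: add.assoc ennreal_plus[symmetric] del: ennreal_plus)
      finally have le: "(\<integral>\<^sup>+x. ennreal \<bar>indicator G x - indicator ?B x\<bar> \<partial>lborel) + emeasure lborel G \<le> ennreal (3 * \<eta>) + emeasure lborel G" .
      have "emeasure lborel G \<le> emeasure lborel ?B" using \<open>G \<subseteq> ?B\<close> by (intro emeasure_mono) auto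
      then have "emeasure lborel G < \<infinity>" using emeasure_lborel_ball_finite[of 0 \<rho>] by (rule le_less_trans)
      with le show ?thesis by (auto simp: add.commute)
    qed
    have vB: "(\<integral>\<^sup>+x. ennreal \<bar>indicator ?B x - v x\<bar> \<partial>lborel) \<le> ennreal (5 * \<eta>)"
    proof -
      have "(\<integral>\<^sup>+x. ennreal \<bar>indicator ?B x - v x\<bar> \<partial>lborel) \<le> (\<integral>\<^sup>+x. ennreal \<bar>v x - indicator G x\<bar> + ennreal \<bar>indicator G x - indicator ?B x\<bar> \<partial>lborel)"
        by (intro nn_integral_mono) (simp add: ennreal_plus[symmetric] ennreal_leI del: ennreal_plus)
      also have "\<dots> \<le> ennreal (2 * \<eta>) + ennreal (3 * \<eta>)"
        using vG GB by (subst nn_integral_add) (auto intro: add_mono)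
      finally show ?thesis using \<eta> by (simp add: ennreal_plus[symmetric] del: ennreal_plus)
    qed
    have "energy k (indicator E) \<le> energy k u + ennreal M * ((\<integral>\<^sup>+x. ennreal (u x) \<partial>lborel) + (\<integral>\<^sup>+x. ennreal (indicator E x) \<partial>lborel))
        * (\<integral>\<^sup>+x. ennreal \<bar>u x - indicator E x\<bar> \<partial>lborel)"
      using u01 k0 kM by (intro energy_le_energy) auto
    also have "\<dots> \<le> energy k u + ennreal M * (ennreal (m + \<eta>) + ennreal m) * ennreal \<eta>"
      unfolding mE using u_le D by (intro add_mono mult_mono order_refl) auto
    also have "\<dots> \<le> energy k v + ennreal M * (ennreal (m + \<eta>) + ennreal m) * ennreal \<eta>"
      by (intro add_right_mono ven)
    also have "energy k v \<le> energy k (indicator ?B) + ennreal M * ((\<integral>\<^sup>+x. ennreal (indicator ?B x) \<partial>lborel) + (\<integral>\<^sup>+x. ennreal (v x) \<partial>lborel))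
        * (\<integral>\<^sup>+x. ennreal \<bar>indicator ?B x - v x\<bar> \<partial>lborel)"
      using v01 k0 kM by (intro energy_le_energy) auto
    also have "\<dots> \<le> energy k (indicator ?B) + ennreal M * (ennreal m + ennreal (m + \<eta>)) * ennreal (5 * \<eta>)"
      unfolding mB v1 using u_le vB by (intro add_mono mult_mono order_refl) auto
    finally have "energy k (indicator E) \<le> energy k (indicator ?B) + ennreal M * (ennreal m + ennreal (m + \<eta>)) * ennreal (5 * \<eta>)
       + ennreal M * (ennreal (m + \<eta>) + ennreal m) * ennreal \<eta>" by (simp add: add_right_mono)
    also have "\<dots> = energy k (indicator ?B) + ennreal (M * (2 * m + \<eta>) * (5 * \<eta>) + M * (2 * m + \<eta>) * \<eta>)"
      using m \<eta> M0 by (simp add: ennreal_plus[symmetric] ennreal_mult[symmetric] add.assoc add.commute del: ennreal_plus;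
          simp add: algebra_simps)
    also have "\<dots> \<le> energy k (indicator ?B) + ennreal (6 * M * (2 * m + 1) * \<eta>)"
    proof (intro add_left_mono ennreal_leI)
      have "M * (2 * m + \<eta>) * (5 * \<eta>) + M * (2 * m + \<eta>) * \<eta> = 6 * M * (2 * m + \<eta>) * \<eta>" by (simp add: algebra_simps)
      also have "\<dots> \<le> 6 * M * (2 * m + 1) * \<eta>" using M0 \<eta> by (intro mult_right_mono mult_left_mono) auto
      finally show "M * (2 * m + \<eta>) * (5 * \<eta>) + M * (2 * m + \<eta>) * \<eta> \<le> 6 * M * (2 * m + 1) * \<eta>" .
    qed
    finally show ?thesis .
  qed
  show ?thesis
  proof (rule ennreal_le_epsilon)
    fix e :: real assume "0 < e"
    define C where "C = 6 * M * (2 * m + 1)"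
    have C: "0 \<le> C" using M0 m by (simp add: C_def)
    define \<eta> where "\<eta> = min 1 (e / (C + 1))"
    have \<eta>: "0 < \<eta>" "\<eta> \<le> 1" "\<eta> \<le> e / (C + 1)" using \<open>0 < e\<close> C by (auto simp: \<eta>_def)
    have "C * \<eta> \<le> C * (e / (C + 1))" using \<eta> C by (intro mult_left_mono)
    also have "\<dots> \<le> e" using C \<open>0 < e\<close> by (simp add: field_simps)
    finally have "ennreal (C * \<eta>) \<le> ennreal e" by (rule ennreal_leI)
    then show "energy k (indicator E) \<le> energy k (indicator ?B) + ennreal e"
      using main[OF \<eta>(1,2)] unfolding C_def[symmetric] by (meson add_left_mono order_trans)
  qed
qed

section \<open>Unbounded kernels and interactions with the complement\<close>

text \<open>Truncation at height \<open>j\<close> and monotone convergence reduce to bounded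
  kernels. The two functions \<open>u\<close> and \<open>w\<close> may differ so that interactions
  with a complement are covered as well.\<close>

lemma energy_SUP:
  fixes u :: "'a::euclidean_space \<Rightarrow> real"
  assumes [measurable]: "u \<in> borel_measurable borel" "k \<in> borel_measurable borel" and u0: "\<And>x. 0 \<le> u x" and k0: "\<And>r. 0 \<le> k r"
    and [measurable]: "w \<in> borel_measurable borel" and w0: "\<And>x. 0 \<le> w x"
  shows "(\<integral>\<^sup>+x. \<integral>\<^sup>+y. ennreal (u x * w y * k (norm (x - y))) \<partial>lborel \<partial>lborel) =
     (SUP j. \<integral>\<^sup>+x. \<integral>\<^sup>+y. ennreal (u x * w y * min (k (norm (x - y))) (real j)) \<partial>lborel \<partial>lborel)"
proof -
  have inc: "ennreal (u x * w y * min (k (norm (x - y))) (real i)) \<le> ennreal (u x * w y * min (k (norm (x - y))) (real j))" if "i \<le> j" for i j and x y :: 'a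
    using that u0 w0 by (intro ennreal_leI mult_left_mono) auto
  have sup: "ennreal (u x * w y * k (norm (x - y))) = (SUP j. ennreal (u x * w y * min (k (norm (x - y))) (real j)))" for x y :: 'a
  proof (rule antisym)
    obtain j where "k (norm (x - y)) \<le> real j" using real_arch_simple by blast
    then show "ennreal (u x * w y * k (norm (x - y))) \<le> (SUP j. ennreal (u x * w y * min (k (norm (x - y))) (real j)))"
      by (intro SUP_upper2[of j]) auto
    show "(SUP j. ennreal (u x * w y * min (k (norm (x - y))) (real j))) \<le> ennreal (u x * w y * k (norm (x - y)))"
      using u0 w0 by (intro SUP_least ennreal_leI mult_left_mono) auto
  qed
  have "(\<integral>\<^sup>+x. \<integral>\<^sup>+y. ennreal (u x * w y * k (norm (x - y))) \<partial>lborel \<partial>lborel) =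
     (\<integral>\<^sup>+x. (SUP j. \<integral>\<^sup>+y. ennreal (u x * w y * min (k (norm (x - y))) (real j)) \<partial>lborel) \<partial>lborel)"
    unfolding sup
    by (intro nn_integral_cong nn_integral_monotone_convergence_SUP) (auto simp: incseq_def le_fun_def intro!: inc)
  also have "\<dots> = (SUP j. \<integral>\<^sup>+x. \<integral>\<^sup>+y. ennreal (u x * w y * min (k (norm (x - y))) (real j)) \<partial>lborel \<partial>lborel)"
    by (intro nn_integral_monotone_convergence_SUP) (auto simp: incseq_def le_fun_def intro!: inc nn_integral_mono)
  finally show ?thesis .
qed

lemma riesz_rearrangement:
  fixes E :: "'a::euclidean_space set"
  assumes E[measurable]: "E \<in> sets borel" and fin: "emeasure lborel E < \<infinity>"
    and B: "emeasure lborel (ball (0::'a) \<rho>) = emeasure lborel E"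
    and k[measurable]: "k \<in> borel_measurable borel" and k0: "\<And>r. 0 \<le> k r"
    and mono: "\<And>r r'. 0 < r \<Longrightarrow> r \<le> r' \<Longrightarrow> k r' \<le> k r"
  shows "energy k (indicator E) \<le> energy k (indicator (ball (0::'a) \<rho>))"
proof -
  have [measurable]: "ball (0::'a) \<rho> \<in> sets borel" by simp
  have "energy k (indicator E) = (SUP j. energy (\<lambda>r. min (k r) (real j)) (indicator E))"
    unfolding energy_def by (rule energy_SUP) (auto simp: k0)
  also have "\<dots> \<le> (SUP j. energy (\<lambda>r. min (k r) (real j)) (indicator (ball (0::'a) \<rho>)))"
  proof (rule SUP_mono')
    show "energy (\<lambda>r. min (k r) (real j)) (indicator E) \<le> energy (\<lambda>r. min (k r) (real j)) (indicator (ball (0::'a) \<rho>))" for j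
      using k0 mono by (intro riesz_rearrangement_bounded_kernel[OF E fin B, where M="real j"]) (auto intro: min.coboundedI1)
  qed
  also have "\<dots> = energy k (indicator (ball (0::'a) \<rho>))"
    unfolding energy_def by (rule energy_SUP[symmetric]) (auto simp: k0)
  finally show ?thesis .
qed

definition boundary_energy :: "(real \<Rightarrow> real) \<Rightarrow> 'a::euclidean_space set \<Rightarrow> ennreal" where
  "boundary_energy k E = (\<integral>\<^sup>+x. \<integral>\<^sup>+y. ennreal (indicator E x * indicator (- E) y * k (norm (x - y))) \<partial>lborel \<partial>lborel)"

text \<open>For an integrable kernel, energy and boundary energy of a set add up to its measure
  times the total mass of the kernel, so the first is largest when the second is smallest. The
  hypothesis \<open>tail\<close> concerns truncations because the intended kernel has a
  logarithmically divergent integral at 0.\<close>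

lemma riesz_rearrangement_boundary:
  fixes E :: "'a::euclidean_space set"
  assumes E[measurable]: "E \<in> sets borel" and fin: "emeasure lborel E < \<infinity>"
    and B: "emeasure lborel (ball (0::'a) \<rho>) = emeasure lborel E"
    and k[measurable]: "k \<in> borel_measurable borel" and k0: "\<And>r. 0 \<le> k r"
    and mono: "\<And>r r'. 0 < r \<Longrightarrow> r \<le> r' \<Longrightarrow> k r' \<le> k r"
    and tail: "\<And>j::nat. (\<integral>\<^sup>+z. ennreal (min (k (norm z)) (real j)) \<partial>(lborel::'a measure)) < \<infinity>"
  shows "boundary_energy k (ball (0::'a) \<rho>) \<le> boundary_energy k E"
proof -
  let ?k = "\<lambda>j r. min (k r) (real j)"
  have Bm [measurable]: "ball (0::'a) \<rho> \<in> sets borel" by simp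
  have sum: "energy (?k j) (indicator A) + boundary_energy (?k j) A = emeasure lborel A * (\<integral>\<^sup>+z. ennreal (?k j (norm z)) \<partial>(lborel::'a measure))"
    if [measurable]: "A \<in> sets borel" for A :: "'a set" and j
  proof -
    have [measurable]: "- A \<in> sets borel" by (simp add: borel_comp)
    have tr: "(\<integral>\<^sup>+y. ennreal (?k j (norm (x - y))) \<partial>lborel) = (\<integral>\<^sup>+z. ennreal (?k j (norm z)) \<partial>(lborel::'a measure))" for x :: 'a
      using nn_integral_lborel_translate[of "\<lambda>z. ennreal (?k j (norm z))" "- x"] by (simp add: norm_minus_commute)
    have "energy (?k j) (indicator A) + boundary_energy (?k j) A
      = (\<integral>\<^sup>+x. \<integral>\<^sup>+y. ennreal (indicator A x * indicator A y * ?k j (norm (x - y))) + ennreal (indicator A x * indicator (- A) y * ?k j (norm (x - y))) \<partial>lborel \<partial>lborel)"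
      unfolding energy_def boundary_energy_def by (subst nn_integral_add[symmetric], measurable)+
    also have "\<dots> = (\<integral>\<^sup>+x. \<integral>\<^sup>+y. indicator A x * ennreal (?k j (norm (x - y))) \<partial>lborel \<partial>lborel)"
      by (intro nn_integral_cong) (auto simp: indicator_def)
    also have "\<dots> = emeasure lborel A * (\<integral>\<^sup>+z. ennreal (?k j (norm z)) \<partial>(lborel::'a measure))"
    proof -
      have "(\<integral>\<^sup>+y. indicator A x * ennreal (?k j (norm (x - y))) \<partial>lborel) = indicator A x * (\<integral>\<^sup>+z. ennreal (?k j (norm z)) \<partial>(lborel::'a measure))" for x
        unfolding tr[of x, symmetric] by (rule nn_integral_cmult) measurable
      then show ?thesis by (simp only:) (subst nn_integral_multc, simp_all)
    qed
    finally show ?thesis .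
  qed
  have step: "boundary_energy (?k j) (ball (0::'a) \<rho>) \<le> boundary_energy (?k j) E" for j
  proof -
    let ?a = "energy (?k j) (indicator E)" and ?a' = "energy (?k j) (indicator (ball (0::'a) \<rho>))"
    have eq: "?a + boundary_energy (?k j) E = ?a' + boundary_energy (?k j) (ball (0::'a) \<rho>)"
    proof -
      have e1: "?a + boundary_energy (?k j) E = emeasure lborel E * (\<integral>\<^sup>+z. ennreal (?k j (norm z)) \<partial>(lborel::'a measure))"
        by (rule sum[OF E])
      have e2: "?a' + boundary_energy (?k j) (ball (0::'a) \<rho>) = emeasure lborel E * (\<integral>\<^sup>+z. ennreal (?k j (norm z)) \<partial>(lborel::'a measure))"
        using sum[OF Bm, of j] by (simp only: B)
      show ?thesis by (simp only: e1 e2)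
    qed
    have "?a' + boundary_energy (?k j) (ball (0::'a) \<rho>) < \<infinity>"
      unfolding sum[OF Bm] B using tail[of j] fin by (simp add: ennreal_mult_less_top)
    then have "?a' \<noteq> \<infinity>" by auto
    moreover have "?a \<le> ?a'"
      using k0 mono by (intro riesz_rearrangement_bounded_kernel[OF E fin B, where M="real j"]) (auto intro: min.coboundedI1)
    then have "?a' + boundary_energy (?k j) (ball (0::'a) \<rho>) \<le> ?a' + boundary_energy (?k j) E"
      unfolding eq[symmetric] by (rule add_right_mono)
    ultimately show ?thesis by (simp add: ennreal_add_left_cancel_le)
  qed
  have bS: "boundary_energy k A = (SUP j. boundary_energy (?k j) A)" if [measurable]: "A \<in> sets borel" for A :: "'a set"
    unfolding boundary_energy_def by (rule energy_SUP) (auto simp: k0 borel_comp)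
  show ?thesis using step by (simp add: bS SUP_mono')
qed

section \<open>Equality in Riesz' inequality\<close>

lemma nn_integral_point_reflect:
  fixes f :: "'a::euclidean_space \<Rightarrow> ennreal"
  assumes [measurable]: "f \<in> borel_measurable borel"
  shows "(\<integral>\<^sup>+x. f (c - x) \<partial>lborel) = (\<integral>\<^sup>+x. f x \<partial>lborel)"
proof -
  have "distr lborel borel uminus = (lborel :: 'a measure)"
    by (rule distr_lborel_isometric_involution) (auto intro: linearI)
  then have "(\<integral>\<^sup>+x. f (x + c) \<partial>lborel) = (\<integral>\<^sup>+x. f (x + c) \<partial>distr lborel borel uminus)" by simp
  also have "\<dots> = (\<integral>\<^sup>+x. f (c - x) \<partial>lborel)" by (subst nn_integral_distr) auto
  finally show ?thesis by (simp add: nn_integral_lborel_translate)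
qed

lemma emeasure_lborel_ball_translate:
  "emeasure lborel (ball (c::'a::euclidean_space) \<rho>) = emeasure lborel (ball (0::'a) \<rho>)"
proof -
  have "indicator (ball c \<rho>) (x + c) = (indicator (ball 0 \<rho>) x :: ennreal)" for x
    by (simp add: indicator_def dist_norm)
  then show ?thesis
    using emeasure_lborel_translate[of "ball c \<rho>" c] by simp
qed

text \<open>At a maximizer the polarization gap vanishes almost everywhere. For a strictly
  decreasing kernel the gap is positive at \<open>x\<close> and \<open>y\<close> when
  \<open>x\<close> lies in \<open>E\<close> without its mirror image and the mirror image of
  \<open>y\<close> lies in \<open>E\<close> without \<open>y\<close>; hence points of the two kinds
  cannot coexist beyond null sets.\<close>

lemma energy_maximal_imp_one_sided:
  fixes E :: "'a::euclidean_space set"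
  assumes E[measurable]: "E \<in> sets borel" and fin: "emeasure lborel E < \<infinity>"
    and B: "emeasure lborel (ball (0::'a) \<rho>) = emeasure lborel E"
    and k[measurable]: "k \<in> borel_measurable borel" and k0: "\<And>r. 0 \<le> k r"
    and mono: "\<And>r r'. 0 < r \<Longrightarrow> r < r' \<Longrightarrow> k r' < k r"
    and maximal: "energy k (indicator E) = energy k (indicator (ball (0::'a) \<rho>))" and efin: "energy k (indicator E) < \<infinity>"
    and e: "norm e = 1"
  shows "(AE x in lborel. \<not> (s < x \<bullet> e \<and> x \<in> E \<and> reflect e s x \<notin> E)) \<or>
    (AE x in lborel. \<not> (s < x \<bullet> e \<and> x \<notin> E \<and> reflect e s x \<in> E))"
proof -
  let ?s = "reflect e s"
  define F where "F = {x. if s \<le> x \<bullet> e then x \<in> E \<or> ?s x \<in> E else x \<in> E \<and> ?s x \<in> E}"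
  have [measurable]: "F \<in> sets borel" unfolding F_def by measurable
  have pF: "polarize e s (indicator E) = indicator F"
    by (auto simp: polarize_def F_def indicator_def fun_eq_iff)
  have "emeasure lborel F = (\<integral>\<^sup>+x. ennreal (polarize e s (indicator E) x) \<partial>lborel)"
    unfolding pF by (simp add: ennreal_indicator)
  also have "\<dots> = emeasure lborel E"
    by (subst nn_integral_polarize[OF e]) (auto simp: ennreal_indicator)
  finally have mF: "emeasure lborel F = emeasure lborel E" .
  have mono': "k r' \<le> k r" if "0 < r" "r \<le> r'" for r r'
    using mono[of r r'] that by (cases "r = r'") auto
  let ?G = "\<integral>\<^sup>+x. \<integral>\<^sup>+y. indicator (halfspace e s) x * indicator (halfspace e s) y * ennreal (pol_gap k e s (indicator E) x y) \<partial>lborel \<partial>lborel"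
  have [measurable]: "halfspace e s \<in> sets borel" by measurable
  have [measurable]: "indicat_real E \<in> borel_measurable borel" by simp
  have "energy k (indicator E) + ?G = energy k (indicator F)"
    unfolding pF[symmetric] by (rule energy_polarize[OF e _ k _ k0 mono', symmetric]) auto
  also have "\<dots> \<le> energy k (indicator E)"
    unfolding maximal by (rule riesz_rearrangement[OF _ _ _ k k0 mono']) (use mF fin B in auto)
  finally have "?G = 0"
    using ennreal_add_left_cancel_le[of "energy k (indicator E)" ?G 0] efin by (auto simp: less_top)
  then have "AE x in lborel. (\<integral>\<^sup>+y. indicator (halfspace e s) x * indicator (halfspace e s) y * ennreal (pol_gap k e s (indicator E) x y) \<partial>lborel) = 0"
    by (subst (asm) nn_integral_0_iff_AE) measurable
  then have AEAE: "AE x in lborel. AE y in lborel. indicator (halfspace e s) x * indicator (halfspace e s) y * ennreal (pol_gap k e s (indicator E) x y) = 0"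
    by (subst (asm) nn_integral_0_iff_AE) measurable
  show ?thesis
  \<comment> \<open>A single \<open>x\<close> of the first kind for which the inner
    almost-everywhere statement holds already excludes the second kind.\<close>
  proof (cases "\<exists>x. (AE y in lborel. indicator (halfspace e s) x * indicator (halfspace e s) y * ennreal (pol_gap k e s (indicator E) x y) = 0)
      \<and> s < x \<bullet> e \<and> x \<in> E \<and> ?s x \<notin> E")
    case False
    with AEAE have "AE x in lborel. \<not> (s < x \<bullet> e \<and> x \<in> E \<and> ?s x \<notin> E)" by (auto elim: eventually_mono)
    then show ?thesis ..
  next
    case True
    then obtain x where x: "s < x \<bullet> e" "x \<in> E" "?s x \<notin> E"
      and AE: "AE y in lborel. indicator (halfspace e s) x * indicator (halfspace e s) y * ennreal (pol_gap k e s (indicator E) x y) = 0" by blast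
    from AE have "AE y in lborel. \<not> (s < y \<bullet> e \<and> y \<notin> E \<and> ?s y \<in> E)"
    proof eventually_elim
      case (elim y)
      show ?case
      proof
        assume y: "s < y \<bullet> e \<and> y \<notin> E \<and> ?s y \<in> E"
        then have "x \<noteq> y" using x by auto
        then have "k (norm (x - ?s y)) < k (norm (x - y))"
          using y by (intro mono norm_diff_le_reflect[OF e x(1)]) auto
        then have "0 < pol_gap k e s (indicator E) x y"
          using x y by (simp add: pol_gap_def)
        then show False using elim x y by simp
      qed
    qed
    then show ?thesis ..
  qed
qed

section \<open>Symmetries of a maximizing set\<close>

text \<open>Removing the symmetric part \<open>S\<close> from both halves leaves \<open>D\<close>
  below and \<open>D'\<close> above, and \<open>D\<close> has no larger measure than
  \<open>D'\<close>. One of the two is null by hypothesis, so \<open>D\<close> is null in either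
  case.\<close>

lemma AE_reflect_subset:
  fixes E :: "'a::euclidean_space set"
  assumes E[measurable]: "E \<in> sets borel" and fin: "emeasure lborel E < \<infinity>" and e: "norm e = 1"
    and one_sided: "(AE x in lborel. \<not> (s < x \<bullet> e \<and> x \<in> E \<and> reflect e s x \<notin> E)) \<or>
      (AE x in lborel. \<not> (s < x \<bullet> e \<and> x \<notin> E \<and> reflect e s x \<in> E))"
    and le: "emeasure lborel (E \<inter> {x. x \<bullet> e < s}) \<le> emeasure lborel (E \<inter> {x. s < x \<bullet> e})"
  shows "AE x in lborel. s < x \<bullet> e \<longrightarrow> reflect e s x \<in> E \<longrightarrow> x \<in> E"
proof -
  let ?s = "reflect e s"
  define S where "S = {x. s < x \<bullet> e \<and> x \<in> E \<and> ?s x \<in> E}"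
  define D where "D = {x. s < x \<bullet> e \<and> x \<notin> E \<and> ?s x \<in> E}"
  define D' where "D' = {x. s < x \<bullet> e \<and> x \<in> E \<and> ?s x \<notin> E}"
  have [measurable]: "S \<in> sets borel" "D \<in> sets borel" "D' \<in> sets borel" unfolding S_def D_def D'_def by measurable
  have [measurable]: "E \<inter> {x. x \<bullet> e < s} \<in> sets borel" by measurable
  have "emeasure lborel (E \<inter> {x. x \<bullet> e < s}) = (\<integral>\<^sup>+x. indicator (E \<inter> {x. x \<bullet> e < s}) (?s x) \<partial>lborel)"
    using nn_integral_reflect[OF e, of "indicator (E \<inter> {x. x \<bullet> e < s})" s] by simp
  also have "\<dots> = (\<integral>\<^sup>+x. indicator (D \<union> S) x \<partial>lborel)"
    by (intro nn_integral_cong) (auto simp: S_def D_def reflect_inner[OF e] indicator_def)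
  also have "\<dots> = emeasure lborel D + emeasure lborel S"
    by (subst plus_emeasure) (auto simp: D_def S_def)
  finally have 1: "emeasure lborel (E \<inter> {x. x \<bullet> e < s}) = emeasure lborel D + emeasure lborel S" .
  have 2: "emeasure lborel (E \<inter> {x. s < x \<bullet> e}) = emeasure lborel D' + emeasure lborel S"
    by (subst plus_emeasure) (auto simp: D'_def S_def intro!: arg_cong[where f="emeasure lborel"])
  have "emeasure lborel S \<le> emeasure lborel E"
    by (intro emeasure_mono) (auto simp: S_def)
  then have Sfin: "emeasure lborel S \<noteq> \<infinity>"
    using fin by (auto simp: top_unique)
  have "emeasure lborel D = 0"
    using one_sided
  proof
    assume "AE x in lborel. \<not> (s < x \<bullet> e \<and> x \<in> E \<and> ?s x \<notin> E)"
    then have "AE x in lborel. x \<notin> D'" by (simp add: D'_def)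
    then have "emeasure lborel D' = 0" by (subst (asm) AE_iff_measurable[OF _ refl]) auto
    then have "emeasure lborel S + emeasure lborel D \<le> emeasure lborel S + 0" using le 1 2 by (simp add: add.commute)
    then show ?thesis using Sfin by (simp only: ennreal_add_left_cancel_le) auto
  next
    assume "AE x in lborel. \<not> (s < x \<bullet> e \<and> x \<notin> E \<and> ?s x \<in> E)"
    then have "AE x in lborel. x \<notin> D" by (simp add: D_def)
    then show "emeasure lborel D = 0" by (subst (asm) AE_iff_measurable[OF _ refl]) auto
  qed
  then have "AE x in lborel. x \<notin> D" by (subst AE_iff_measurable[OF _ refl]) auto
  then show ?thesis by eventually_elim (auto simp: D_def)
qed

lemma AE_reflect_iff:
  fixes E :: "'a::euclidean_space set"
  assumes E: "E \<in> sets borel" and fin: "emeasure lborel E < \<infinity>" and e: "norm e = 1"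
    and one_sided: "\<And>e s. norm e = 1 \<Longrightarrow> (AE x in lborel. \<not> (s < x \<bullet> e \<and> x \<in> E \<and> reflect e s x \<notin> E)) \<or>
      (AE x in lborel. \<not> (s < x \<bullet> e \<and> x \<notin> E \<and> reflect e s x \<in> E))"
    and eq: "emeasure lborel (E \<inter> {x. x \<bullet> e < s}) = emeasure lborel (E \<inter> {x. s < x \<bullet> e})"
  shows "AE x in lborel. reflect e s x \<in> E \<longleftrightarrow> x \<in> E"
proof -
  have 1: "AE x in lborel. s < x \<bullet> e \<longrightarrow> reflect e s x \<in> E \<longrightarrow> x \<in> E"
    using eq by (intro AE_reflect_subset[OF E fin e one_sided[OF e]]) simp
  \<comment> \<open>The same mirror with the opposite orientation.\<close>
  have "AE x in lborel. - s < x \<bullet> (- e) \<longrightarrow> reflect (- e) (- s) x \<in> E \<longrightarrow> x \<in> E"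
    using eq e by (intro AE_reflect_subset[OF E fin] one_sided) simp_all
  then have 2: "AE x in lborel. x \<bullet> e < s \<longrightarrow> reflect e s x \<in> E \<longrightarrow> x \<in> E"
    by (simp add: reflect_minus)
  show ?thesis
    using 1 2 AE_reflect[OF e 1, of s] AE_reflect[OF e 2, of s] AE_not_hyperplane[OF e, of s]
    by eventually_elim (auto simp: reflect_inner[OF e] reflect_reflect[OF e])
qed

text \<open>The measure above the mirror depends continuously on \<open>s\<close>, since hyperplanes
  are null sets, and runs from the full measure to 0; the intermediate value theorem
  applies.\<close>

lemma exists_median_hyperplane:
  fixes E :: "'a::euclidean_space set"
  assumes E[measurable]: "E \<in> sets borel" and fin: "emeasure lborel E < \<infinity>" and e: "norm e = 1"
  obtains s where "emeasure lborel (E \<inter> {x. x \<bullet> e < s}) = emeasure lborel (E \<inter> {x. s < x \<bullet> e})"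
proof -
  define f where "f s = measure lborel (E \<inter> {x. s < x \<bullet> e})" for s
  have fE: "E \<in> fmeasurable lborel" using fin by (intro fmeasurableI) auto
  have [measurable]: "E \<inter> {x. s < x \<bullet> e} \<in> sets borel" "E \<inter> {x. x \<bullet> e < s} \<in> sets borel" for s by measurable
  have lim: "(\<lambda>n. f (X n)) \<longlonglongrightarrow> measure lborel G"
    if [measurable]: "G \<in> sets borel"
      and AE: "AE x in lborel. (\<lambda>n. indicat_real (E \<inter> {x. X n < x \<bullet> e}) x) \<longlonglongrightarrow> indicator G x" for X G
  proof -
    have "(\<lambda>n. LINT x|lborel. indicat_real (E \<inter> {x. X n < x \<bullet> e}) x) \<longlonglongrightarrow> (LINT x|lborel. indicat_real G x)"
      by (rule integral_dominated_convergence[where w="indicator E"])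
         (use AE fE in \<open>auto simp: indicator_def fmeasurable_def\<close>)
    then show ?thesis by (simp add: f_def)
  qed
  have cont: "isCont f s" for s
  proof (rule continuous_at_sequentiallyI)
    fix X :: "nat \<Rightarrow> real" assume X: "X \<longlonglongrightarrow> s"
    show "(\<lambda>n. f (X n)) \<longlonglongrightarrow> f s"
      unfolding f_def[of s]
    proof (rule lim)
      show "AE x in lborel. (\<lambda>n. indicat_real (E \<inter> {x. X n < x \<bullet> e}) x) \<longlonglongrightarrow> indicator (E \<inter> {x. s < x \<bullet> e}) x"
        using AE_not_hyperplane[OF e, of s]
      proof eventually_elim
        case (elim x)
        have "eventually (\<lambda>n. (X n < x \<bullet> e) = (s < x \<bullet> e)) sequentially"
        proof (cases "s < x \<bullet> e")
          case True
          then show ?thesis using order_tendstoD(2)[OF X True] by (auto elim: eventually_mono)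
        next
          case False
          then have xs: "x \<bullet> e < s" using elim by simp
          show ?thesis using order_tendstoD(1)[OF X xs] False by (auto elim!: eventually_mono)
        qed
        then show ?case by (intro tendsto_eventually) (auto elim!: eventually_mono simp: indicator_def)
      qed
    qed auto
  qed
  have "(\<lambda>n. f (real n)) \<longlonglongrightarrow> measure lborel ({} :: 'a set)"
  proof (rule lim)
    show "AE x in lborel. (\<lambda>n. indicat_real (E \<inter> {x. real n < x \<bullet> e}) x) \<longlonglongrightarrow> indicator {} x"
    proof (intro AE_I2 tendsto_eventually)
      fix x
      obtain N where "x \<bullet> e \<le> real N" using real_arch_simple by blast
      then show "\<forall>\<^sub>F n in sequentially. indicat_real (E \<inter> {x. real n < x \<bullet> e}) x = indicator {} x"
        unfolding eventually_sequentially by (intro exI[of _ N]) (auto simp: indicator_def)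
    qed
  qed simp
  then have top: "(\<lambda>n. f (real n)) \<longlonglongrightarrow> 0" by simp
  have bot: "(\<lambda>n. f (- real n)) \<longlonglongrightarrow> measure lborel E"
  proof (rule lim)
    show "AE x in lborel. (\<lambda>n. indicat_real (E \<inter> {x. - real n < x \<bullet> e}) x) \<longlonglongrightarrow> indicator E x"
    proof (intro AE_I2 tendsto_eventually)
      fix x
      obtain N where "- (x \<bullet> e) < real N" using reals_Archimedean2 by blast
      then show "\<forall>\<^sub>F n in sequentially. indicat_real (E \<inter> {x. - real n < x \<bullet> e}) x = indicator E x"
        unfolding eventually_sequentially by (intro exI[of _ N]) (auto simp: indicator_def)
    qed
  qed simp
  let ?m = "measure lborel E"
  have "\<exists>s. f s = ?m / 2"
  proof (cases "?m = 0")
    case True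
    have "f 0 \<le> ?m" unfolding f_def using fE by (intro measure_mono_fmeasurable) auto
    then show ?thesis using True by (intro exI[of _ 0]) (simp add: f_def measure_le_0_iff)
  next
    case False
    then have m: "0 < ?m" by (simp add: zero_less_measure_iff)
    obtain a :: nat where a: "f (real a) < ?m / 2"
      using order_tendstoD(2)[OF top, of "?m / 2"] m by (auto simp: eventually_sequentially)
    obtain b :: nat where b: "?m / 2 < f (- real b)"
      using order_tendstoD(1)[OF bot, of "?m / 2"] m by (auto simp: eventually_sequentially)
    have "\<exists>s\<ge>- real b. s \<le> real a \<and> f s = ?m / 2"
      using a b cont by (intro IVT2) auto
    then show ?thesis by blast
  qed
  then obtain s where s: "f s = ?m / 2" by blast
  have fm: "E \<inter> {x. s < x \<bullet> e} \<in> fmeasurable lborel" "E \<inter> {x. x \<bullet> e < s} \<in> fmeasurable lborel"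
    by (rule fmeasurableI2[OF fE]; auto)+
  have "?m = measure lborel ((E \<inter> {x. s < x \<bullet> e}) \<union> (E \<inter> {x. x \<bullet> e < s}))"
    using AE_not_hyperplane[OF e, of s] by (intro measure_eq_AE) (auto elim!: eventually_mono)
  also have "\<dots> = f s + measure lborel (E \<inter> {x. x \<bullet> e < s})"
    unfolding f_def using fmeasurableD2[OF fm(1)] fmeasurableD2[OF fm(2)] by (intro measure_Union) auto
  finally have "measure lborel (E \<inter> {x. x \<bullet> e < s}) = f s" using s by simp
  then show thesis
    using fm by (intro that[of s]) (simp add: f_def emeasure_eq_measure2)
qed

text \<open>Reflections in orthogonal directions \<open>b\<close> act on different coordinates, so
  they can be composed one at a time. For all of \<open>Basis\<close> the result is the point
  reflection about the common point of the mirrors.\<close>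

lemma AE_reflect_center:
  fixes E :: "'a::euclidean_space set"
  assumes "B \<subseteq> Basis"
    and sym: "\<And>b. b \<in> Basis \<Longrightarrow> AE x in lborel. reflect b (t b) x \<in> E \<longleftrightarrow> x \<in> E"
  shows "AE x in lborel. x - 2 *\<^sub>R (\<Sum>b\<in>B. (x \<bullet> b - t b) *\<^sub>R b) \<in> E \<longleftrightarrow> x \<in> E"
  using finite_subset[OF assms(1) finite_Basis] assms(1)
proof (induction B rule: finite_induct)
  case (insert b B)
  then have b: "b \<in> Basis" "norm b = 1" by auto
  have *: "reflect b (t b) x - 2 *\<^sub>R (\<Sum>b'\<in>B. (reflect b (t b) x \<bullet> b' - t b') *\<^sub>R b') =
    x - 2 *\<^sub>R (\<Sum>b\<in>insert b B. (x \<bullet> b - t b) *\<^sub>R b)" for x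
  proof -
    have "reflect b (t b) x \<bullet> b' = x \<bullet> b'" if "b' \<in> B" for b'
    proof -
      have "b \<bullet> b' = 0" using that insert b by (intro inner_not_same_Basis) auto
      then show ?thesis by (simp add: reflect_def inner_diff_left)
    qed
    then have "(\<Sum>b'\<in>B. (reflect b (t b) x \<bullet> b' - t b') *\<^sub>R b') = (\<Sum>b'\<in>B. (x \<bullet> b' - t b') *\<^sub>R b')" by simp
    then show ?thesis using insert by (simp add: reflect_def scaleR_add_right diff_diff_eq)
  qed
  have IH: "AE x in lborel. x - 2 *\<^sub>R (\<Sum>b\<in>B. (x \<bullet> b - t b) *\<^sub>R b) \<in> E \<longleftrightarrow> x \<in> E" using insert by blast
  from AE_reflect[OF b(2) IH, of "t b"] sym[OF b(1)] show ?case
    unfolding * by eventually_elim blast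
qed simp

text \<open>The bisecting hyperplanes in the coordinate directions meet in a point \<open>c\<close>,
  and \<open>E\<close> is symmetric about \<open>c\<close>. Hence every hyperplane through
  \<open>c\<close> bisects \<open>E\<close>, and a hyperplane off \<open>c\<close> has the larger
  part of \<open>E\<close> on the side of \<open>c\<close>. This gives a symmetry at each mirror
  through \<open>c\<close> and a one-sided inclusion at each other mirror; together they prevent
  \<open>E\<close> minus the ball and the ball minus \<open>E\<close> from both having positive
  measure.\<close>

lemma riesz_rearrangement_equality:
  fixes E :: "'a::euclidean_space set"
  assumes E[measurable]: "E \<in> sets borel" and fin: "emeasure lborel E < \<infinity>"
    and B: "emeasure lborel (ball (0::'a) \<rho>) = emeasure lborel E"
    and k: "k \<in> borel_measurable borel" and k0: "\<And>r. 0 \<le> k r"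
    and mono: "\<And>r r'. 0 < r \<Longrightarrow> r < r' \<Longrightarrow> k r' < k r"
    and maximal: "energy k (indicator E) = energy k (indicator (ball (0::'a) \<rho>))" and efin: "energy k (indicator E) < \<infinity>"
  obtains c where "AE x in lborel. x \<in> E \<longleftrightarrow> x \<in> ball c \<rho>"
proof -
  have one_sided: "(AE x in lborel. \<not> (s < x \<bullet> e \<and> x \<in> E \<and> reflect e s x \<notin> E)) \<or>
      (AE x in lborel. \<not> (s < x \<bullet> e \<and> x \<notin> E \<and> reflect e s x \<in> E))" if "norm e = 1" for e s
    using that by (intro energy_maximal_imp_one_sided[OF E fin B k k0 mono maximal efin])
  have "\<exists>s. emeasure lborel (E \<inter> {x. x \<bullet> b < s}) = emeasure lborel (E \<inter> {x. s < x \<bullet> b})" if "b \<in> Basis" for b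
    using exists_median_hyperplane[OF E fin, of b] that by (metis norm_Basis)
  then obtain t where t: "\<And>b. b \<in> Basis \<Longrightarrow> emeasure lborel (E \<inter> {x. x \<bullet> b < t b}) = emeasure lborel (E \<inter> {x. t b < x \<bullet> b})"
    by metis
  define c where "c = (\<Sum>b\<in>Basis. t b *\<^sub>R b)"
  have sym: "AE x in lborel. reflect b (t b) x \<in> E \<longleftrightarrow> x \<in> E" if "b \<in> Basis" for b
    using that by (intro AE_reflect_iff[OF E fin _ one_sided] t) auto
  have "x - 2 *\<^sub>R (\<Sum>b\<in>Basis. (x \<bullet> b - t b) *\<^sub>R b) = 2 *\<^sub>R c - x" for x
  proof -
    have "(\<Sum>b\<in>Basis. (x \<bullet> b - t b) *\<^sub>R b) = x - c"
      by (simp add: scaleR_diff_left sum_subtractf euclidean_representation c_def)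
    then show ?thesis by (simp add: scaleR_diff_right scaleR_2)
  qed
  with AE_reflect_center[OF order_refl, of t E] sym have point: "AE x in lborel. 2 *\<^sub>R c - x \<in> E \<longleftrightarrow> x \<in> E" by simp
  have halves: "emeasure lborel (E \<inter> {x. x \<bullet> e < c \<bullet> e}) = emeasure lborel (E \<inter> {x. c \<bullet> e < x \<bullet> e})" for e
  proof -
    have [measurable]: "E \<inter> {x. x \<bullet> e < c \<bullet> e} \<in> sets borel" by measurable
    have "emeasure lborel (E \<inter> {x. x \<bullet> e < c \<bullet> e}) = (\<integral>\<^sup>+x. indicator (E \<inter> {x. x \<bullet> e < c \<bullet> e}) (2 *\<^sub>R c - x) \<partial>lborel)"
      using nn_integral_point_reflect[of "indicator (E \<inter> {x. x \<bullet> e < c \<bullet> e})" "2 *\<^sub>R c"] by simp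
    also have "\<dots> = (\<integral>\<^sup>+x. indicator (E \<inter> {x. c \<bullet> e < x \<bullet> e}) x \<partial>lborel)"
      using point by (intro nn_integral_cong_AE) (auto elim!: eventually_mono simp: indicator_def inner_diff_left)
    finally show ?thesis by simp
  qed
  have sym_c: "AE x in lborel. reflect e (c \<bullet> e) x \<in> E \<longleftrightarrow> x \<in> E" if "norm e = 1" for e
    by (intro AE_reflect_iff[OF E fin that one_sided] halves) auto
  have toward: "AE x in lborel. s < x \<bullet> e \<longrightarrow> reflect e s x \<in> E \<longrightarrow> x \<in> E" if "norm e = 1" "s < c \<bullet> e" for e s
  proof (rule AE_reflect_subset[OF E fin that(1) one_sided[OF that(1)]])
    have "emeasure lborel (E \<inter> {x. x \<bullet> e < s}) \<le> emeasure lborel (E \<inter> {x. x \<bullet> e < c \<bullet> e})"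
      using that by (intro emeasure_mono) auto
    also have "\<dots> = emeasure lborel (E \<inter> {x. c \<bullet> e < x \<bullet> e})" by (rule halves)
    also have "\<dots> \<le> emeasure lborel (E \<inter> {x. s < x \<bullet> e})"
      using that by (intro emeasure_mono) auto
    finally show "emeasure lborel (E \<inter> {x. x \<bullet> e < s}) \<le> emeasure lborel (E \<inter> {x. s < x \<bullet> e})" .
  qed
  let ?B = "ball c \<rho>"
  define A C where "A = E - ?B" and "C = ?B - E"
  have [measurable]: "?B \<in> sets borel" by simp
  have [measurable]: "A \<in> sets borel" "C \<in> sets borel" unfolding A_def C_def by measurable
  txt \<open>A translation is the product of two reflections, the first of which preserves \<open>E\<close> while the
    second moves points towards \<open>c\<close>.\<close>
  have null: "AE x in lborel. \<not> (x \<in> C \<and> x - z \<in> A)" if "z \<noteq> 0" for z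
  proof -
    \<comment> \<open>The translation by \<open>z\<close> is twice the spacing of the mirrors, hence
      \<open>norm z / 2\<close>. The direction is opposite to \<open>z\<close>, so that
      \<open>c\<close> lies above the second mirror.\<close>
    define e where "e = - z /\<^sub>R norm z"
    define s where "s = c \<bullet> e - norm z / 2"
    have e: "norm e = 1" using that by (simp add: e_def)
    have s: "s < c \<bullet> e" using that by (simp add: s_def)
    have ze: "(2 * (s - c \<bullet> e)) *\<^sub>R e = z" using that by (simp add: s_def e_def)
    have y: "reflect e s x = reflect e (c \<bullet> e) (x - z)" for x
    proof -
      have "reflect e s (reflect e (c \<bullet> e) (x - z)) = x" using ze by (simp add: reflect_comp[OF e])
      then have "reflect e s (reflect e s (reflect e (c \<bullet> e) (x - z))) = reflect e s x" by (rule arg_cong)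
      then show ?thesis unfolding reflect_reflect[OF e] by (rule HOL.sym)
    qed
    have "AE x in distr lborel borel ((+) (- z)). reflect e (c \<bullet> e) x \<in> E \<longleftrightarrow> x \<in> E"
      unfolding lborel_distr_plus by (rule sym_c[OF e])
    from AE_distrD[OF _ this] have "AE x in lborel. reflect e (c \<bullet> e) (x - z) \<in> E \<longleftrightarrow> x - z \<in> E" by simp
    with toward[OF e s] show ?thesis
    proof eventually_elim
      case (elim x)
      show ?case
      proof
        assume "x \<in> C \<and> x - z \<in> A"
        then have x: "dist c x < \<rho>" "x \<notin> E" and xz: "x - z \<in> E" "\<rho> \<le> dist c (x - z)" by (auto simp: A_def C_def)
        have yE: "reflect e s x \<in> E" using elim(2) xz(1) y by simp
        have cc: "reflect e (c \<bullet> e) c = c" by (simp add: reflect_def)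
        have "dist c (x - z) = norm (reflect e (c \<bullet> e) c - reflect e (c \<bullet> e) (x - z))"
          by (simp add: norm_reflect_diff[OF e] dist_norm)
        then have "dist c (x - z) = norm (c - reflect e s x)" by (simp add: y cc)
        with x xz have "norm (c - x) < norm (c - reflect e s x)" by (simp add: dist_norm)
        then have "(norm (c - x))\<^sup>2 < (norm (c - reflect e s x))\<^sup>2" by (intro power_strict_mono) auto
        then have "0 < 4 * (c \<bullet> e - s) * (x \<bullet> e - s)" by (simp add: norm_diff_reflect_sq[OF e])
        then have "s < x \<bullet> e" using s by (simp add: zero_less_mult_iff)
        with elim(1) yE x(2) show False by blast
      qed
    qed
  qed
  \<comment> \<open>By Tonelli the product of the measures is the integral over \<open>z\<close> of
    the measure of \<open>C\<close> intersected with the translate of \<open>A\<close> by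
    \<open>z\<close>, which \<open>null\<close> makes vanish for nonzero \<open>z\<close>. So one of
    \<open>A\<close> and \<open>C\<close> is null, and both are, because \<open>E\<close> and the
    ball have equal measure.\<close>
  have "emeasure lborel C * emeasure lborel A = (\<integral>\<^sup>+x. indicator C x * (\<integral>\<^sup>+z. indicator A (x - z) \<partial>lborel) \<partial>lborel)"
  proof -
    have "(\<integral>\<^sup>+z. indicator A (x - z) \<partial>lborel) = emeasure lborel A" for x
      using nn_integral_point_reflect[of "indicator A" x] by simp
    then show ?thesis by (simp only:) (subst nn_integral_multc, simp_all)
  qed
  also have "\<dots> = (\<integral>\<^sup>+x. \<integral>\<^sup>+z. indicator C x * indicator A (x - z) \<partial>lborel \<partial>lborel)"
    by (intro nn_integral_cong nn_integral_cmult[symmetric]) auto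
  also have "\<dots> = (\<integral>\<^sup>+z. \<integral>\<^sup>+x. indicator C x * indicator A (x - z) \<partial>lborel \<partial>lborel)"
    by (intro lborel_pair.Fubini') measurable
  also have "\<dots> = (\<integral>\<^sup>+z. 0 \<partial>(lborel :: 'a measure))"
  proof (rule nn_integral_cong_AE)
    have "AE z in lborel. z \<noteq> (0::'a)" by (rule AE_lborel_singleton)
    then show "AE z in lborel. (\<integral>\<^sup>+x. indicator C x * indicator A (x - z) \<partial>lborel) = 0"
    proof eventually_elim
      case (elim z)
      then show ?case using null[OF elim] by (subst nn_integral_0_iff_AE) (auto elim!: eventually_mono simp: indicator_def)
    qed
  qed
  finally have prod: "emeasure lborel C = 0 \<or> emeasure lborel A = 0" by simp
  have mB: "emeasure lborel ?B = emeasure lborel E"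
    using emeasure_lborel_ball_translate[of c \<rho>] B by (rule trans)
  have eq: "emeasure lborel (E \<inter> ?B) + emeasure lborel A = emeasure lborel (E \<inter> ?B) + emeasure lborel C"
  proof -
    have "emeasure lborel (E \<inter> ?B) + emeasure lborel A = emeasure lborel ((E \<inter> ?B) \<union> A)"
      by (rule plus_emeasure) (simp_all, auto simp: A_def)
    also have "(E \<inter> ?B) \<union> A = E" by (auto simp: A_def)
    finally have 1: "emeasure lborel (E \<inter> ?B) + emeasure lborel A = emeasure lborel E" .
    have "emeasure lborel (E \<inter> ?B) + emeasure lborel C = emeasure lborel ((E \<inter> ?B) \<union> C)"
      by (rule plus_emeasure) (simp_all, auto simp: C_def)
    also have "(E \<inter> ?B) \<union> C = ?B" by (auto simp: C_def)
    finally show ?thesis by (simp only: mB 1)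
  qed
  have "emeasure lborel (E \<inter> ?B) \<le> emeasure lborel E" by (intro emeasure_mono) auto
  then have "emeasure lborel (E \<inter> ?B) \<noteq> \<infinity>" using fin by auto
  with eq have "emeasure lborel A = emeasure lborel C" by (simp add: ennreal_add_left_cancel)
  with prod have "emeasure lborel A = 0" "emeasure lborel C = 0" by auto
  then have "AE x in lborel. x \<notin> A" "AE x in lborel. x \<notin> C"
    by (subst AE_iff_measurable[OF _ refl]; auto)+
  then have "AE x in lborel. x \<in> E \<longleftrightarrow> x \<in> ?B"
    by eventually_elim (auto simp: A_def C_def)
  then show thesis by (rule that)
qed

section \<open>Interaction energies of balls\<close>

text \<open>Polar coordinates for radial functions: on the generating rays \<open>{..a}\<close> both
  measures give the volume of the ball of radius \<open>a\<close>.\<close>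

lemma distr_norm_lborel:
  "distr lborel borel (norm :: 'a::euclidean_space \<Rightarrow> real) =
    density lborel (\<lambda>r. ennreal (indicator {0..} r * (real DIM('a) * unit_ball_vol DIM('a) * r ^ (DIM('a) - 1))))"
  (is "?M = ?N")
proof -
  let ?n = "DIM('a)" and ?w = "unit_ball_vol (real DIM('a))"
  have M: "emeasure ?M {..a} = (if a < 0 then 0 else ennreal (?w * a ^ ?n))" for a
  proof (cases "a < 0")
    case True
    then have "\<not> norm x \<le> a" for x :: 'a using norm_ge_zero[of x] by linarith
    then have "norm -` {..a} = ({} :: 'a set)" by auto
    then show ?thesis using True by (simp add: emeasure_distr)
  next
    case False
    have "norm -` {..a} = cball (0::'a) a" by auto
    then show ?thesis using False by (simp add: emeasure_distr emeasure_cball)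
  qed
  have N: "emeasure ?N {..a} = (if a < 0 then 0 else ennreal (?w * a ^ ?n))" for a
  proof (cases "a < 0")
    case True
    then show ?thesis
      by (simp add: emeasure_density indicator_def if_distrib cong: if_cong) (subst nn_integral_0_iff_AE; auto)
  next
    case False
    have "emeasure ?N {..a} = (\<integral>\<^sup>+r. ennreal (real ?n * ?w * r ^ (?n - 1)) * indicator {0..a} r \<partial>lborel)"
      by (simp add: emeasure_density) (intro nn_integral_cong, auto simp: indicator_def)
    also have "\<dots> = ennreal (?w * a ^ ?n - ?w * 0 ^ ?n)"
      using False by (intro nn_integral_FTC_Icc) (auto intro!: derivative_eq_intros simp: DERIV_power)
    finally show ?thesis using False by simp
  qed
  show ?thesis
  proof (rule measure_eqI_generator_eq[where E="range atMost" and \<Omega>=UNIV and A="\<lambda>i. {..real i}"])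
    show "Int_stable (range (atMost :: real \<Rightarrow> _))"
      by (auto simp: Int_stable_def)
    show "sets ?M = sigma_sets UNIV (range atMost)" "sets ?N = sigma_sets UNIV (range atMost)"
      by (simp_all add: borel_eq_atMost)
    show "(\<Union>i. {..real i}) = UNIV" using real_arch_simple by auto
    show "emeasure ?M X = emeasure ?N X" if "X \<in> range atMost" for X
      using that M N by auto
    show "emeasure ?M {..real i} \<noteq> \<infinity>" for i by (simp add: M)
  qed auto
qed

lemma nn_integral_norm:
  fixes \<phi> :: "real \<Rightarrow> ennreal"
  assumes [measurable]: "\<phi> \<in> borel_measurable borel"
  shows "(\<integral>\<^sup>+z. \<phi> (norm (z::'a::euclidean_space)) \<partial>lborel) =
    ennreal (real DIM('a) * unit_ball_vol DIM('a)) * (\<integral>\<^sup>+r. indicator {0<..} r * (ennreal (r ^ (DIM('a) - 1)) * \<phi> r) \<partial>lborel)"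
proof -
  let ?c = "real DIM('a) * unit_ball_vol (real DIM('a))"
  have "(\<integral>\<^sup>+z. \<phi> (norm (z::'a)) \<partial>lborel) = (\<integral>\<^sup>+r. \<phi> r \<partial>distr lborel borel (norm :: 'a \<Rightarrow> real))"
    by (rule nn_integral_distr[symmetric]) auto
  also have "\<dots> = (\<integral>\<^sup>+r. ennreal (indicator {0..} r * (?c * r ^ (DIM('a) - 1))) * \<phi> r \<partial>lborel)"
    unfolding distr_norm_lborel by (rule nn_integral_density) auto
  also have "\<dots> = (\<integral>\<^sup>+r. ennreal ?c * (indicator {0<..} r * (ennreal (r ^ (DIM('a) - 1)) * \<phi> r)) \<partial>lborel)"
  proof (rule nn_integral_cong_AE)
    have "AE r in lborel. r \<noteq> (0::real)" by (rule AE_lborel_singleton)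
    then show "AE r in lborel. ennreal (indicator {0..} r * (?c * r ^ (DIM('a) - 1))) * \<phi> r
      = ennreal ?c * (indicator {0<..} r * (ennreal (r ^ (DIM('a) - 1)) * \<phi> r))"
      by eventually_elim (auto simp: indicator_def ennreal_mult' mult.assoc)
  qed
  finally show ?thesis by (simp add: nn_integral_cmult)
qed

section \<open>Intersections of a ball with its translates\<close>

text \<open>Cavalieri's principle with the coordinate along \<open>b\<close> integrated last: the
  section at height \<open>t\<close> is a ball of radius \<open>sqrt (R\<^sup>2 - t\<^sup>2)\<close>
  in one dimension less.\<close>

lemma emeasure_cball_slice:
  fixes b :: "'a::euclidean_space"
  assumes b: "b \<in> Basis" and "0 < R" "0 \<le> s"
  shows "emeasure lborel {y \<in> cball 0 R. s < y \<bullet> b} =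
    (\<integral>\<^sup>+t. ennreal (indicator {s<..<R} t * (unit_ball_vol (real (DIM('a) - 1)) * sqrt (R\<^sup>2 - t\<^sup>2) ^ (DIM('a) - 1))) \<partial>lborel)"
proof -
  interpret product_sigma_finite "\<lambda>_::'a. lborel :: real measure" by standard
  let ?I = "Basis - {b}"
  let ?g = "\<lambda>f. \<Sum>b\<in>Basis. f b *\<^sub>R b :: 'a"
  have Ib: "insert b ?I = Basis" using b by auto
  have [measurable]: "{y \<in> cball (0::'a) R. s < y \<bullet> b} \<in> sets borel" by measurable
  have cardI: "card ?I = DIM('a) - 1" using b by (simp add: card_Diff_singleton)
  have norm_g: "norm (?g f) \<le> R \<longleftrightarrow> (\<Sum>i\<in>Basis. (f i)\<^sup>2) \<le> R\<^sup>2" for f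
  proof -
    have "norm (?g f) = sqrt (\<Sum>i\<in>Basis. (f i)\<^sup>2)"
      using euclidean_dist_l2[of 0 "?g f"] by (simp add: L2_set_def)
    then show ?thesis using real_sqrt_le_iff'[of "\<Sum>i\<in>Basis. (f i)\<^sup>2" R] \<open>0 < R\<close> by (simp add: sum_nonneg)
  qed
  have "emeasure lborel {y \<in> cball 0 R. s < y \<bullet> b} = (\<integral>\<^sup>+f. indicator {y \<in> cball 0 R. s < y \<bullet> b} (?g f) \<partial>Pi\<^sub>M Basis (\<lambda>_. lborel))"
    by (subst lborel_eq, subst nn_integral_indicator[symmetric], simp, subst nn_integral_distr, simp_all)
  also have "\<dots> = (\<integral>\<^sup>+t. (\<integral>\<^sup>+x. indicator {y \<in> cball 0 R. s < y \<bullet> b} (?g (x(b := t))) \<partial>Pi\<^sub>M ?I (\<lambda>_. lborel)) \<partial>lborel)"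
    using product_nn_integral_insert_rev[of ?I b "\<lambda>f. indicator {y \<in> cball 0 R. s < y \<bullet> b} (?g f)"]
    unfolding Ib by simp
  also have "\<dots> = (\<integral>\<^sup>+t. ennreal (indicator {s<..<R} t * (unit_ball_vol (real (DIM('a) - 1)) * sqrt (R\<^sup>2 - t\<^sup>2) ^ (DIM('a) - 1))) \<partial>lborel)"
  proof (rule nn_integral_cong_AE)
    \<comment> \<open>At \<open>t = R\<close> the section is a point, which has positive
      0-dimensional measure when the space is a line.\<close>
    have "AE t in lborel. t \<noteq> R" by (rule AE_lborel_singleton)
    then show "AE t in lborel. (\<integral>\<^sup>+x. indicator {y \<in> cball 0 R. s < y \<bullet> b} (?g (x(b := t))) \<partial>Pi\<^sub>M ?I (\<lambda>_. lborel)) =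
      ennreal (indicator {s<..<R} t * (unit_ball_vol (real (DIM('a) - 1)) * sqrt (R\<^sup>2 - t\<^sup>2) ^ (DIM('a) - 1)))"
    proof eventually_elim
      case (elim t)
      have sum: "(\<Sum>i\<in>Basis. ((x(b := t)) i)\<^sup>2) = t\<^sup>2 + (\<Sum>i\<in>?I. (x i)\<^sup>2)" for x
      proof -
        have "(\<Sum>i\<in>Basis. ((x(b := t)) i)\<^sup>2) = t\<^sup>2 + (\<Sum>i\<in>?I. ((x(b := t)) i)\<^sup>2)"
          using b by (subst sum.remove[of _ b]) auto
        also have "(\<Sum>i\<in>?I. ((x(b := t)) i)\<^sup>2) = (\<Sum>i\<in>?I. (x i)\<^sup>2)" by (intro sum.cong) auto
        finally show ?thesis .
      qed
      have mem: "?g (x(b := t)) \<in> {y \<in> cball 0 R. s < y \<bullet> b} \<longleftrightarrow> s < t \<and> t\<^sup>2 + (\<Sum>i\<in>?I. (x i)\<^sup>2) \<le> R\<^sup>2" for x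
        unfolding mem_Collect_eq mem_cball_0 norm_g sum using inner_sum_left_Basis[OF b, of "x(b := t)"] by auto
      show ?case
      proof (cases "s < t \<and> t < R")
        case True
        then have "t\<^sup>2 < R\<^sup>2" using \<open>0 \<le> s\<close> by (intro power_strict_mono) auto
        then have pos: "0 < sqrt (R\<^sup>2 - t\<^sup>2)" by simp
        have "indicator {y \<in> cball 0 R. s < y \<bullet> b} (?g (x(b := t))) =
           (indicator {f. sqrt (\<Sum>i\<in>?I. (f i)\<^sup>2) \<le> sqrt (R\<^sup>2 - t\<^sup>2)} x :: ennreal)" for x
          unfolding indicator_def mem using True by (simp add: algebra_simps)
        then have "(\<integral>\<^sup>+x. indicator {y \<in> cball 0 R. s < y \<bullet> b} (?g (x(b := t))) \<partial>Pi\<^sub>M ?I (\<lambda>_. lborel))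
          = (\<integral>\<^sup>+x. indicator ({f. sqrt (\<Sum>i\<in>?I. (f i)\<^sup>2) \<le> sqrt (R\<^sup>2 - t\<^sup>2)} \<inter> space (Pi\<^sub>M ?I (\<lambda>_. lborel))) x \<partial>Pi\<^sub>M ?I (\<lambda>_. lborel))"
          by (intro nn_integral_cong) (auto simp: indicator_def)
        also have "\<dots> = emeasure (Pi\<^sub>M ?I (\<lambda>_. lborel)) ({f. sqrt (\<Sum>i\<in>?I. (f i)\<^sup>2) \<le> sqrt (R\<^sup>2 - t\<^sup>2)} \<inter> space (Pi\<^sub>M ?I (\<lambda>_. lborel)))"
          by (subst nn_integral_indicator) (auto intro!: borel_measurable_le simp: Int_def conj_commute)
        also have "\<dots> = ennreal (unit_ball_vol (real (card ?I)) * sqrt (R\<^sup>2 - t\<^sup>2) ^ card ?I)"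
          by (rule emeasure_cball_aux) (use pos in auto)
        finally show ?thesis using True by (simp add: cardI)
      next
        case False
        have "\<not> (s < t \<and> t\<^sup>2 + (\<Sum>i\<in>?I. (x i)\<^sup>2) \<le> R\<^sup>2)" for x
        proof
          assume *: "s < t \<and> t\<^sup>2 + (\<Sum>i\<in>?I. (x i)\<^sup>2) \<le> R\<^sup>2"
          then have "R < t" using False elim by auto
          then have "R\<^sup>2 < t\<^sup>2" using \<open>0 < R\<close> by (intro power_strict_mono) auto
          moreover have "0 \<le> (\<Sum>i\<in>?I. (x i)\<^sup>2)" by (intro sum_nonneg) auto
          ultimately show False using * by linarith
        qed
        then have "indicator {y \<in> cball 0 R. s < y \<bullet> b} (?g (x(b := t))) = (0::ennreal)" for x
          unfolding indicator_def mem by simp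
        then have "(\<integral>\<^sup>+x. indicator {y \<in> cball 0 R. s < y \<bullet> b} (?g (x(b := t))) \<partial>Pi\<^sub>M ?I (\<lambda>_. lborel)) = 0"
          by (simp only: nn_integral_const mult_zero_left)
        moreover have "indicator {s<..<R} t = (0::real)" using False by simp
        ultimately show ?thesis by simp
      qed
    qed
  qed
  finally show ?thesis .
qed

text \<open>The hyperplane volume of the flat disc in which two spheres of radius \<open>R\<close>
  with centres at distance \<open>r\<close> meet. As a function of \<open>r\<close> it is minus the
  derivative of the volume of the intersection of the two balls.\<close>

definition chord :: "nat \<Rightarrow> real \<Rightarrow> real \<Rightarrow> real" where
  "chord n R r = indicator {0<..<2 * R} r * (unit_ball_vol (real (n - 1)) * sqrt (R\<^sup>2 - (r / 2)\<^sup>2) ^ (n - 1))"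

lemma chord_measurable [measurable]: "chord n R \<in> borel_measurable borel"
  unfolding chord_def[abs_def] by measurable

lemma chord_nonneg: "0 \<le> chord n R r"
proof (cases "0 < r \<and> r < 2 * R")
  case True
  then have "(r / 2)\<^sup>2 \<le> R\<^sup>2" by (intro power_mono) auto
  then show ?thesis by (simp add: chord_def)
qed (auto simp: chord_def)

text \<open>A reflection takes the direction \<open>e\<close> to a coordinate direction, where the
  cap can be sliced. The factor 2 is the Jacobian of \<open>r = 2 * t\<close>, with \<open>t\<close>
  the height of a slice and \<open>r\<close> the distance of the two centres.\<close>

lemma emeasure_ball_cap:
  fixes e :: "'a::euclidean_space"
  assumes e: "norm e = 1" and R: "0 < R" "0 \<le> s"
  shows "2 * emeasure lborel {y \<in> ball 0 R. s < y \<bullet> e} = (\<integral>\<^sup>+r. indicator {2 * s<..} r * ennreal (chord DIM('a) R r) \<partial>lborel)"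
proof -
  obtain b :: 'a where b: "b \<in> Basis" using nonempty_Basis by blast
  have nb: "norm b = 1" using b by simp
  have [measurable]: "ball (0::'a) R \<in> sets borel" "cball (0::'a) R \<in> sets borel" by simp_all
  have [measurable]: "{y \<in> ball (0::'a) R. s < y \<bullet> e} \<in> sets borel" "{y \<in> ball (0::'a) R. s < y \<bullet> b} \<in> sets borel"
    "{y \<in> cball (0::'a) R. s < y \<bullet> b} \<in> sets borel" by measurable
  have "emeasure lborel {y \<in> ball 0 R. s < y \<bullet> e} = emeasure lborel {y \<in> ball 0 R. s < y \<bullet> b}"
  proof (cases "e = b")
    case False
    \<comment> \<open>The mirror orthogonal to \<open>e - b\<close> exchanges the two unit
      vectors.\<close>
    define d where "d = (e - b) /\<^sub>R norm (e - b)"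
    have d: "norm d = 1" using False by (simp add: d_def)
    have "(norm (e - b))\<^sup>2 = e \<bullet> e - e \<bullet> b - (e \<bullet> b - b \<bullet> b)"
      unfolding power2_norm_eq_inner inner_diff_left inner_diff_right by (simp add: inner_commute)
    then have "(norm (e - b))\<^sup>2 = 2 * (e \<bullet> (e - b))"
      using e nb by (simp add: dot_square_norm inner_diff_right)
    then have "2 * (e \<bullet> d) = norm (e - b)"
      using False by (simp add: d_def power2_eq_square divide_simps mult.commute)
    then have "reflect d 0 e = b"
      using False by (simp add: reflect_def) (simp add: d_def)
    have inner: "reflect d 0 y \<bullet> e = y \<bullet> b" for y
    proof -
      have "reflect d 0 y \<bullet> e = y \<bullet> reflect d 0 e"
        by (simp add: reflect_def inner_diff_left inner_diff_right inner_commute)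
      then show ?thesis using \<open>reflect d 0 e = b\<close> by simp
    qed
    have nr: "norm (reflect d 0 y) = norm y" for y
      using norm_reflect_diff[OF d, of 0 y 0] by (simp add: reflect_def)
    have "emeasure lborel {y \<in> ball 0 R. s < y \<bullet> e} = (\<integral>\<^sup>+y. indicator {y \<in> ball 0 R. s < y \<bullet> e} (reflect d 0 y) \<partial>lborel)"
      using nn_integral_reflect[OF d, of "indicator {y \<in> ball 0 R. s < y \<bullet> e}" 0] by simp
    also have "\<dots> = (\<integral>\<^sup>+y. indicator {y \<in> ball 0 R. s < y \<bullet> b} y \<partial>lborel)"
      by (intro nn_integral_cong) (simp add: indicator_def inner nr)
    finally show ?thesis by simp
  qed simp
  also have "\<dots> = emeasure lborel {y \<in> cball 0 R. s < y \<bullet> b}"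
  proof (rule emeasure_eq_AE)
    have "sphere (0::'a) R \<in> null_sets lborel"
      using negligible_sphere[of "0::'a" R] by (simp add: null_sets_completion_iff negligible_iff_null_sets)
    then have "AE y in lborel. y \<notin> sphere (0::'a) R" by (rule AE_not_in)
    then show "AE y in lborel. y \<in> {y \<in> ball 0 R. s < y \<bullet> b} \<longleftrightarrow> y \<in> {y \<in> cball 0 R. s < y \<bullet> b}"
      by eventually_elim auto
  qed auto
  also have "\<dots> = (\<integral>\<^sup>+t. ennreal (indicator {s<..<R} t * (unit_ball_vol (real (DIM('a) - 1)) * sqrt (R\<^sup>2 - t\<^sup>2) ^ (DIM('a) - 1))) \<partial>lborel)"
    by (rule emeasure_cball_slice[OF b R])
  also have "\<dots> = (\<integral>\<^sup>+t. indicator {2 * s<..} (0 + 2 * t) * ennreal (chord DIM('a) R (0 + 2 * t)) \<partial>lborel)"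
    using R by (intro nn_integral_cong) (auto simp: chord_def indicator_def)
  finally have cap: "emeasure lborel {y \<in> ball 0 R. s < y \<bullet> e} =
    (\<integral>\<^sup>+t. indicator {2 * s<..} (0 + 2 * t) * ennreal (chord DIM('a) R (0 + 2 * t)) \<partial>lborel)" .
  have "(\<integral>\<^sup>+r. indicator {2 * s<..} r * ennreal (chord DIM('a) R r) \<partial>lborel) =
    ennreal \<bar>2\<bar> * (\<integral>\<^sup>+t. indicator {2 * s<..} (0 + 2 * t) * ennreal (chord DIM('a) R (0 + 2 * t)) \<partial>lborel)"
    by (rule nn_integral_real_affine) auto
  then show ?thesis unfolding cap by simp
qed

text \<open>The intersection is the lens of the balls centred at 0 and \<open>- z\<close>. It is
  symmetric about the bisecting hyperplane of the centres, and each half is a cap of a single ball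
  cut off at distance \<open>norm z / 2\<close> from its centre.\<close>

lemma emeasure_ball_Int_translate:
  fixes z :: "'a::euclidean_space"
  assumes R: "0 < R" and z: "z \<noteq> 0"
  shows "emeasure lborel {x \<in> ball 0 R. x + z \<in> ball 0 R} = (\<integral>\<^sup>+r. indicator {norm z<..} r * ennreal (chord DIM('a) R r) \<partial>lborel)"
proof -
  define e where "e = z /\<^sub>R norm z"
  have e: "norm e = 1" using z by (simp add: e_def)
  define s where "s = norm z / 2"
  have s: "0 < s" using z by (simp add: s_def)
  let ?T = "{x \<in> ball (0::'a) R. x + z \<in> ball 0 R}"
  let ?\<sigma> = "reflect e (- s)"
  have \<sigma>0: "?\<sigma> 0 = - z" using z by (simp add: reflect_def s_def e_def)
  have n1: "norm (?\<sigma> x) = norm (x + z)" for x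
    using norm_reflect_diff'[OF e, of "- s" x 0] unfolding \<sigma>0 by simp
  have n2: "norm (?\<sigma> x + z) = norm x" for x
    using norm_reflect_diff[OF e, of "- s" x 0] unfolding \<sigma>0 by simp
  have [measurable]: "ball (0::'a) R \<in> sets borel" by simp
  have [measurable]: "?T \<in> sets borel" "{y \<in> ball (0::'a) R. s < y \<bullet> e} \<in> sets borel" by measurable
  have ze: "z \<bullet> e = 2 * s" using z by (simp add: e_def s_def dot_square_norm power2_eq_square)
  have "emeasure lborel ?T = (\<integral>\<^sup>+x. indicator ?T x \<partial>lborel)" by simp
  also have "\<dots> = (\<integral>\<^sup>+x. indicator (halfspace e (- s)) x * (indicator ?T x + indicator ?T (?\<sigma> x)) \<partial>lborel)"
    by (rule nn_integral_fold[OF e]) auto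
  also have "\<dots> = (\<integral>\<^sup>+x. 2 * indicator {y \<in> ball 0 R. s < y \<bullet> e} (x + z) \<partial>lborel)"
  proof (intro nn_integral_cong)
    fix x
    have le: "norm x \<le> norm (x + z)" if "- s < x \<bullet> e"
    proof (rule power2_le_imp_le)
      have "0 \<le> 4 * (x \<bullet> e + s) * s"
        using that s by (intro mult_nonneg_nonneg) linarith+
      moreover have "(norm (x - - z))\<^sup>2 = (norm (x - 0))\<^sup>2 + 4 * (x \<bullet> e - - s) * (0 \<bullet> e - - s)"
        using norm_diff_reflect_sq[OF e, of x "- s" 0] unfolding \<sigma>0 .
      ultimately show "(norm x)\<^sup>2 \<le> (norm (x + z))\<^sup>2"
        by (simp only: diff_minus_eq_add diff_zero inner_zero_left add_0)
    qed simp
    have xz: "(x + z) \<bullet> e = x \<bullet> e + 2 * s" unfolding inner_add_left ze ..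
    show "indicator (halfspace e (- s)) x * (indicator ?T x + indicator ?T (?\<sigma> x)) = (2 * indicator {y \<in> ball 0 R. s < y \<bullet> e} (x + z) :: ennreal)"
    proof (cases "- s < x \<bullet> e")
      case True
      have "x \<in> ?T \<longleftrightarrow> norm (x + z) < R" "?\<sigma> x \<in> ?T \<longleftrightarrow> norm (x + z) < R"
        "x + z \<in> {y \<in> ball 0 R. s < y \<bullet> e} \<longleftrightarrow> norm (x + z) < R"
        using le[OF True] True by (auto simp: n1 n2 xz)
      then show ?thesis using True unfolding indicator_def by simp
    next
      case False
      then show ?thesis by (simp add: xz)
    qed
  qed
  also have "\<dots> = 2 * (\<integral>\<^sup>+x. indicator {y \<in> ball 0 R. s < y \<bullet> e} (x + z) \<partial>lborel)"
    by (rule nn_integral_cmult) auto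
  also have "\<dots> = 2 * emeasure lborel {y \<in> ball 0 R. s < y \<bullet> e}"
    by (subst emeasure_lborel_translate) auto
  also have "\<dots> = (\<integral>\<^sup>+r. indicator {2 * s<..} r * ennreal (chord DIM('a) R r) \<partial>lborel)"
    using s by (intro emeasure_ball_cap[OF e R]) auto
  finally show ?thesis by (simp add: s_def)
qed

lemma nn_integral_chord:
  assumes R: "0 < R"
  shows "(\<integral>\<^sup>+r. ennreal (chord DIM('a::euclidean_space) R r) \<partial>lborel) = ennreal (unit_ball_vol DIM('a) * R ^ DIM('a))"
proof -
  obtain b :: 'a where b: "b \<in> Basis" using nonempty_Basis by blast
  have nb: "norm b = 1" using b by simp
  have [measurable]: "ball (0::'a) R \<in> sets borel" by simp
  have [measurable]: "{y \<in> ball (0::'a) R. 0 < y \<bullet> b} \<in> sets borel" by measurable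
  have nr: "norm (reflect b 0 y) = norm y" for y
    using norm_reflect_diff[OF nb, of 0 y 0] by (simp add: reflect_def)
  have "ennreal (unit_ball_vol DIM('a) * R ^ DIM('a)) = (\<integral>\<^sup>+x. indicator (ball (0::'a) R) x \<partial>lborel)"
    using R by (simp add: emeasure_ball)
  also have "\<dots> = (\<integral>\<^sup>+x. indicator (halfspace b 0) x * (indicator (ball 0 R) x + indicator (ball 0 R) (reflect b 0 x)) \<partial>lborel)"
    by (rule nn_integral_fold[OF nb]) auto
  also have "\<dots> = (\<integral>\<^sup>+x. 2 * indicator {y \<in> ball (0::'a) R. 0 < y \<bullet> b} x \<partial>lborel)"
    by (intro nn_integral_cong) (auto simp: indicator_def nr)
  also have "\<dots> = (\<integral>\<^sup>+r. indicator {2 * 0<..} r * ennreal (chord DIM('a) R r) \<partial>lborel)"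
    using emeasure_ball_cap[OF nb R order_refl] by (simp add: nn_integral_cmult)
  also have "\<dots> = (\<integral>\<^sup>+r. ennreal (chord DIM('a) R r) \<partial>lborel)"
    by (intro nn_integral_cong) (auto simp: chord_def indicator_def)
  finally show ?thesis by simp
qed

lemma emeasure_ball_Diff_translate:
  fixes z :: "'a::euclidean_space"
  assumes R: "0 < R" and z: "z \<noteq> 0"
  shows "emeasure lborel {x \<in> ball 0 R. x + z \<notin> ball 0 R} = (\<integral>\<^sup>+r. indicator {..norm z} r * ennreal (chord DIM('a) R r) \<partial>lborel)"
    (is "?D = ?J")
proof -
  let ?T = "{x \<in> ball (0::'a) R. x + z \<in> ball 0 R}" and ?T' = "{x \<in> ball (0::'a) R. x + z \<notin> ball 0 R}"
  have [measurable]: "ball (0::'a) R \<in> sets borel" by simp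
  have [measurable]: "?T \<in> sets borel" "?T' \<in> sets borel" by measurable
  have "emeasure lborel ?T + ?D = emeasure lborel (?T \<union> ?T')"
    by (rule plus_emeasure) auto
  also have "?T \<union> ?T' = ball 0 R" by auto
  also have "emeasure lborel (ball (0::'a) R) = (\<integral>\<^sup>+r. ennreal (chord DIM('a) R r) \<partial>lborel)"
    using R by (simp add: nn_integral_chord emeasure_ball)
  also have "\<dots> = (\<integral>\<^sup>+r. indicator {norm z<..} r * ennreal (chord DIM('a) R r) + indicator {..norm z} r * ennreal (chord DIM('a) R r) \<partial>lborel)"
    by (intro nn_integral_cong) (auto simp: indicator_def)
  also have "\<dots> = emeasure lborel ?T + ?J"
    unfolding emeasure_ball_Int_translate[OF R z] by (rule nn_integral_add) auto
  finally have "emeasure lborel ?T + ?D = emeasure lborel ?T + ?J" .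
  moreover have "emeasure lborel ?T \<le> emeasure lborel (ball (0::'a) R)" by (intro emeasure_mono) auto
  then have "emeasure lborel ?T \<noteq> \<infinity>" using emeasure_lborel_ball_finite[of "0::'a" R] by auto
  ultimately show ?thesis by (simp add: ennreal_add_left_cancel)
qed

text \<open>Substituting \<open>y = x + z\<close> and integrating over \<open>x\<close> first leaves
  the kernel against a volume that depends on the shift alone.\<close>

lemma nn_integral_diff_swap:
  fixes A :: "'a::euclidean_space set" and C :: "'a set"
  assumes [measurable]: "A \<in> sets borel" "C \<in> sets borel" "k \<in> borel_measurable borel" and k0: "\<And>r. 0 \<le> k r"
  shows "(\<integral>\<^sup>+x. \<integral>\<^sup>+y. ennreal (indicator A x * indicator C y * k (norm (x - y))) \<partial>lborel \<partial>lborel)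
    = (\<integral>\<^sup>+z. ennreal (k (norm z)) * emeasure lborel {x \<in> A. x + z \<in> C} \<partial>lborel)"
proof -
  have "(\<integral>\<^sup>+x. \<integral>\<^sup>+y. ennreal (indicator A x * indicator C y * k (norm (x - y))) \<partial>lborel \<partial>lborel)
    = (\<integral>\<^sup>+x. \<integral>\<^sup>+z. ennreal (indicator A x * indicator C (z + x) * k (norm z)) \<partial>lborel \<partial>lborel)"
  proof (rule nn_integral_cong)
    fix x
    show "(\<integral>\<^sup>+y. ennreal (indicator A x * indicator C y * k (norm (x - y))) \<partial>lborel) = (\<integral>\<^sup>+z. ennreal (indicator A x * indicator C (z + x) * k (norm z)) \<partial>lborel)"
      using nn_integral_lborel_translate[of "\<lambda>y. ennreal (indicator A x * indicator C y * k (norm (x - y)))" x] by simp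
  qed
  also have "\<dots> = (\<integral>\<^sup>+z. \<integral>\<^sup>+x. ennreal (indicator A x * indicator C (z + x) * k (norm z)) \<partial>lborel \<partial>lborel)"
    by (intro lborel_pair.Fubini') measurable
  also have "\<dots> = (\<integral>\<^sup>+z. ennreal (k (norm z)) * emeasure lborel {x \<in> A. x + z \<in> C} \<partial>lborel)"
  proof (rule nn_integral_cong)
    fix z :: 'a
    have [measurable]: "{x \<in> A. x + z \<in> C} \<in> sets borel" by measurable
    have "(\<integral>\<^sup>+x. ennreal (indicator A x * indicator C (z + x) * k (norm z)) \<partial>lborel)
      = (\<integral>\<^sup>+x. ennreal (k (norm z)) * indicator {x \<in> A. x + z \<in> C} x \<partial>lborel)"
      by (intro nn_integral_cong) (auto simp: indicator_def add.commute)
    then show "(\<integral>\<^sup>+x. ennreal (indicator A x * indicator C (z + x) * k (norm z)) \<partial>lborel) = ennreal (k (norm z)) * emeasure lborel {x \<in> A. x + z \<in> C}"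
      by (simp add: nn_integral_cmult)
  qed
  finally show ?thesis .
qed

text \<open>The shifted volume is an integral of \<open>chord\<close> beyond \<open>norm z\<close>.
  In polar coordinates Tonelli's theorem moves \<open>chord\<close> outside, so the radial kernel is
  integrated up to \<open>r\<close>; for the boundary energy it is integrated beyond
  \<open>r\<close>.\<close>

lemma energy_ball:
  fixes k :: "real \<Rightarrow> real"
  assumes R: "0 < R" and [measurable]: "k \<in> borel_measurable borel" and k0: "\<And>r. 0 \<le> k r"
  shows "energy k (indicator (ball (0::'a::euclidean_space) R)) = ennreal (real DIM('a) * unit_ball_vol DIM('a)) *
    (\<integral>\<^sup>+r. ennreal (chord DIM('a) R r) * (\<integral>\<^sup>+\<rho>. indicator {0<..} \<rho> * (indicator {..<r} \<rho> * ennreal (\<rho> ^ (DIM('a) - 1) * k \<rho>)) \<partial>lborel) \<partial>lborel)"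
proof -
  let ?h = "chord DIM('a) R" and ?c = "ennreal (real DIM('a) * unit_ball_vol DIM('a))"
  have [measurable]: "ball (0::'a) R \<in> sets borel" by simp
  have "energy k (indicator (ball (0::'a) R)) = (\<integral>\<^sup>+z. ennreal (k (norm z)) * emeasure lborel {x \<in> ball (0::'a) R. x + z \<in> ball 0 R} \<partial>lborel)"
    unfolding energy_def by (rule nn_integral_diff_swap) (auto simp: k0)
  also have "\<dots> = (\<integral>\<^sup>+z. ennreal (k (norm (z::'a))) * (\<integral>\<^sup>+r. indicator {norm z<..} r * ennreal (?h r) \<partial>lborel) \<partial>lborel)"
  proof (rule nn_integral_cong_AE)
    have "AE z in lborel. z \<noteq> (0::'a)" by (rule AE_lborel_singleton)
    then show "AE z in lborel. ennreal (k (norm z)) * emeasure lborel {x \<in> ball (0::'a) R. x + z \<in> ball 0 R} =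
      ennreal (k (norm z)) * (\<integral>\<^sup>+r. indicator {norm z<..} r * ennreal (?h r) \<partial>lborel)"
      by eventually_elim (simp only: emeasure_ball_Int_translate[OF R] not_False_eq_True)
  qed
  also have "\<dots> = ?c * (\<integral>\<^sup>+\<rho>. indicator {0<..} \<rho> * (ennreal (\<rho> ^ (DIM('a) - 1)) * (ennreal (k \<rho>) * (\<integral>\<^sup>+r. indicator {\<rho><..} r * ennreal (?h r) \<partial>lborel))) \<partial>lborel)"
    by (rule nn_integral_norm) (unfold greaterThan_def indicator_def mem_Collect_eq, measurable)
  also have "(\<integral>\<^sup>+\<rho>. indicator {0<..} \<rho> * (ennreal (\<rho> ^ (DIM('a) - 1)) * (ennreal (k \<rho>) * (\<integral>\<^sup>+r. indicator {\<rho><..} r * ennreal (?h r) \<partial>lborel))) \<partial>lborel)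
    = (\<integral>\<^sup>+\<rho>. \<integral>\<^sup>+r. ennreal (?h r) * (indicator {0<..} \<rho> * (indicator {..<r} \<rho> * ennreal (\<rho> ^ (DIM('a) - 1) * k \<rho>))) \<partial>lborel \<partial>lborel)"
  proof (rule nn_integral_cong)
    fix \<rho> :: real
    have "indicator {0<..} \<rho> * (ennreal (\<rho> ^ (DIM('a) - 1)) * (ennreal (k \<rho>) * (\<integral>\<^sup>+r. indicator {\<rho><..} r * ennreal (?h r) \<partial>lborel)))
      = (\<integral>\<^sup>+r. (indicator {0<..} \<rho> * (ennreal (\<rho> ^ (DIM('a) - 1)) * ennreal (k \<rho>))) * (indicator {\<rho><..} r * ennreal (?h r)) \<partial>lborel)"
      by (subst nn_integral_cmult) (auto simp: mult.assoc)
    also have "\<dots> = (\<integral>\<^sup>+r. ennreal (?h r) * (indicator {0<..} \<rho> * (indicator {..<r} \<rho> * ennreal (\<rho> ^ (DIM('a) - 1) * k \<rho>))) \<partial>lborel)"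
      by (intro nn_integral_cong) (auto simp: indicator_def k0 ennreal_mult ac_simps)
    finally show "indicator {0<..} \<rho> * (ennreal (\<rho> ^ (DIM('a) - 1)) * (ennreal (k \<rho>) * (\<integral>\<^sup>+r. indicator {\<rho><..} r * ennreal (?h r) \<partial>lborel)))
      = (\<integral>\<^sup>+r. ennreal (?h r) * (indicator {0<..} \<rho> * (indicator {..<r} \<rho> * ennreal (\<rho> ^ (DIM('a) - 1) * k \<rho>))) \<partial>lborel)" .
  qed
  also have "\<dots> = (\<integral>\<^sup>+r. \<integral>\<^sup>+\<rho>. ennreal (?h r) * (indicator {0<..} \<rho> * (indicator {..<r} \<rho> * ennreal (\<rho> ^ (DIM('a) - 1) * k \<rho>))) \<partial>lborel \<partial>lborel)"
    by (rule lborel_pair.Fubini') (unfold lessThan_def indicator_def mem_Collect_eq, measurable)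
  also have "\<dots> = (\<integral>\<^sup>+r. ennreal (?h r) * (\<integral>\<^sup>+\<rho>. indicator {0<..} \<rho> * (indicator {..<r} \<rho> * ennreal (\<rho> ^ (DIM('a) - 1) * k \<rho>)) \<partial>lborel) \<partial>lborel)"
    by (intro nn_integral_cong nn_integral_cmult) auto
  finally show ?thesis .
qed

lemma boundary_energy_ball:
  fixes k :: "real \<Rightarrow> real"
  assumes R: "0 < R" and [measurable]: "k \<in> borel_measurable borel" and k0: "\<And>r. 0 \<le> k r"
  shows "boundary_energy k (ball (0::'a::euclidean_space) R) = ennreal (real DIM('a) * unit_ball_vol DIM('a)) *
    (\<integral>\<^sup>+r. ennreal (chord DIM('a) R r) * (\<integral>\<^sup>+\<rho>. indicator {0<..} \<rho> * (indicator {r..} \<rho> * ennreal (\<rho> ^ (DIM('a) - 1) * k \<rho>)) \<partial>lborel) \<partial>lborel)"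
proof -
  let ?h = "chord DIM('a) R" and ?c = "ennreal (real DIM('a) * unit_ball_vol DIM('a))"
  have [measurable]: "ball (0::'a) R \<in> sets borel" "- ball (0::'a) R \<in> sets borel" by (auto intro: borel_comp)
  have "boundary_energy k (ball (0::'a) R) = (\<integral>\<^sup>+z. ennreal (k (norm z)) * emeasure lborel {x \<in> ball (0::'a) R. x + z \<in> - ball 0 R} \<partial>lborel)"
    unfolding boundary_energy_def by (rule nn_integral_diff_swap) (auto simp: k0)
  also have "\<dots> = (\<integral>\<^sup>+z. ennreal (k (norm (z::'a))) * (\<integral>\<^sup>+r. indicator {..norm z} r * ennreal (?h r) \<partial>lborel) \<partial>lborel)"
  proof (rule nn_integral_cong_AE)
    have "AE z in lborel. z \<noteq> (0::'a)" by (rule AE_lborel_singleton)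
    then show "AE z in lborel. ennreal (k (norm z)) * emeasure lborel {x \<in> ball (0::'a) R. x + z \<in> - ball 0 R} =
      ennreal (k (norm z)) * (\<integral>\<^sup>+r. indicator {..norm z} r * ennreal (?h r) \<partial>lborel)"
      by eventually_elim (simp only: emeasure_ball_Diff_translate[OF R] Compl_iff not_False_eq_True)
  qed
  also have "\<dots> = ?c * (\<integral>\<^sup>+\<rho>. indicator {0<..} \<rho> * (ennreal (\<rho> ^ (DIM('a) - 1)) * (ennreal (k \<rho>) * (\<integral>\<^sup>+r. indicator {..\<rho>} r * ennreal (?h r) \<partial>lborel))) \<partial>lborel)"
    by (rule nn_integral_norm) (unfold atMost_def indicator_def mem_Collect_eq, measurable)
  also have "(\<integral>\<^sup>+\<rho>. indicator {0<..} \<rho> * (ennreal (\<rho> ^ (DIM('a) - 1)) * (ennreal (k \<rho>) * (\<integral>\<^sup>+r. indicator {..\<rho>} r * ennreal (?h r) \<partial>lborel))) \<partial>lborel)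
    = (\<integral>\<^sup>+\<rho>. \<integral>\<^sup>+r. ennreal (?h r) * (indicator {0<..} \<rho> * (indicator {r..} \<rho> * ennreal (\<rho> ^ (DIM('a) - 1) * k \<rho>))) \<partial>lborel \<partial>lborel)"
  proof (rule nn_integral_cong)
    fix \<rho> :: real
    have "indicator {0<..} \<rho> * (ennreal (\<rho> ^ (DIM('a) - 1)) * (ennreal (k \<rho>) * (\<integral>\<^sup>+r. indicator {..\<rho>} r * ennreal (?h r) \<partial>lborel)))
      = (\<integral>\<^sup>+r. (indicator {0<..} \<rho> * (ennreal (\<rho> ^ (DIM('a) - 1)) * ennreal (k \<rho>))) * (indicator {..\<rho>} r * ennreal (?h r)) \<partial>lborel)"
      by (subst nn_integral_cmult) (auto simp: mult.assoc)
    also have "\<dots> = (\<integral>\<^sup>+r. ennreal (?h r) * (indicator {0<..} \<rho> * (indicator {r..} \<rho> * ennreal (\<rho> ^ (DIM('a) - 1) * k \<rho>))) \<partial>lborel)"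
      by (intro nn_integral_cong) (auto simp: indicator_def k0 ennreal_mult ac_simps)
    finally show "indicator {0<..} \<rho> * (ennreal (\<rho> ^ (DIM('a) - 1)) * (ennreal (k \<rho>) * (\<integral>\<^sup>+r. indicator {..\<rho>} r * ennreal (?h r) \<partial>lborel)))
      = (\<integral>\<^sup>+r. ennreal (?h r) * (indicator {0<..} \<rho> * (indicator {r..} \<rho> * ennreal (\<rho> ^ (DIM('a) - 1) * k \<rho>))) \<partial>lborel)" .
  qed
  also have "\<dots> = (\<integral>\<^sup>+r. \<integral>\<^sup>+\<rho>. ennreal (?h r) * (indicator {0<..} \<rho> * (indicator {r..} \<rho> * ennreal (\<rho> ^ (DIM('a) - 1) * k \<rho>))) \<partial>lborel \<partial>lborel)"
    by (rule lborel_pair.Fubini') (unfold atLeast_def indicator_def mem_Collect_eq, measurable)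
  also have "\<dots> = (\<integral>\<^sup>+r. ennreal (?h r) * (\<integral>\<^sup>+\<rho>. indicator {0<..} \<rho> * (indicator {r..} \<rho> * ennreal (\<rho> ^ (DIM('a) - 1) * k \<rho>)) \<partial>lborel) \<partial>lborel)"
    by (intro nn_integral_cong nn_integral_cmult) auto
  finally show ?thesis .
qed

section \<open>The optimal constant\<close>

text \<open>For \<open>b < a\<close> the interval is empty and \<open>ennreal\<close> sends the
  negative logarithm to 0. The positive part of the logarithm thus appears without a case
  distinction.\<close>

lemma nn_integral_reciprocal:
  assumes "0 < a" "0 < b"
  shows "(\<integral>\<^sup>+\<rho>. indicator {a..b} \<rho> * ennreal (1 / \<rho>) \<partial>lborel) = ennreal (ln (b / a))"
proof (cases "a \<le> b")
  case True
  have "(\<integral>\<^sup>+\<rho>. ennreal (1 / \<rho>) * indicator {a..b} \<rho> \<partial>lborel) = ennreal (ln b - ln a)"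
    using assms True by (intro nn_integral_FTC_Icc) (auto intro!: derivative_eq_intros)
  then show ?thesis using assms by (simp add: mult.commute ln_div)
next
  case False
  then have "ln (b / a) \<le> 0" using assms by simp
  then show ?thesis using False by (simp add: ennreal_neg)
qed

lemma nn_integral_exp_Ioo:
  assumes "0 < \<rho>"
  shows "(\<integral>\<^sup>+t. indicator {0<..<\<rho>} t * ennreal (exp (- t)) \<partial>lborel) = ennreal (1 - exp (- \<rho>))"
proof -
  have "(\<integral>\<^sup>+t. indicator {0<..<\<rho>} t * ennreal (exp (- t)) \<partial>lborel) = (\<integral>\<^sup>+t. ennreal (exp (- t)) * indicator {0..\<rho>} t \<partial>lborel)"
  proof (rule nn_integral_cong_AE)
    have "AE t in lborel. t \<noteq> (0::real)" "AE t in lborel. t \<noteq> \<rho>" by (rule AE_lborel_singleton)+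
    then show "AE t in lborel. indicator {0<..<\<rho>} t * ennreal (exp (- t)) = ennreal (exp (- t)) * indicator {0..\<rho>} t"
      by eventually_elim (auto simp: indicator_def)
  qed
  also have "\<dots> = ennreal (- exp (- \<rho>) - (- exp (- 0)))"
    using assms by (intro nn_integral_FTC_Icc) (auto intro!: derivative_eq_intros)
  finally show ?thesis by simp
qed

lemma nn_integral_exp_atLeast:
  "(\<integral>\<^sup>+t. indicator {\<rho>..} t * ennreal (exp (- t)) \<partial>lborel) = ennreal (exp (- \<rho>))"
proof -
  have "((\<lambda>t::real. - exp (- t)) \<longlongrightarrow> - 0) at_top"
    by (intro tendsto_minus filterlim_compose[OF exp_at_bot] filterlim_uminus_at_bot_at_top)
  then have "(\<integral>\<^sup>+t. ennreal (exp (- t)) * indicator {\<rho>..} t \<partial>lborel) = ennreal (- 0 - - exp (- \<rho>))"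
    by (intro nn_integral_FTC_atLeast) (auto intro!: derivative_eq_intros)
  then show ?thesis by (simp add: mult.commute)
qed

text \<open>The kernels of the two nonnegative terms into which the integrand splits:
  \<open>gain_kernel\<close> multiplies \<open>min (f x) (f y)\<close>, and
  \<open>loss_kernel\<close> multiplies \<open>max 0 (f x - f y)\<close>.\<close>

definition gain_kernel :: "nat \<Rightarrow> real \<Rightarrow> real" where
  "gain_kernel n r = (if 0 < r then (1 - exp (- r)) / r ^ n else 0)"

definition loss_kernel :: "nat \<Rightarrow> real \<Rightarrow> real" where
  "loss_kernel n r = (if 0 < r then exp (- r) / r ^ n else 0)"

lemma kernels_measurable [measurable]:
  "gain_kernel n \<in> borel_measurable borel" "loss_kernel n \<in> borel_measurable borel"
  unfolding gain_kernel_def[abs_def] loss_kernel_def[abs_def] by measurable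

lemma kernels_nonneg: "0 \<le> gain_kernel n r" "0 \<le> loss_kernel n r"
  by (auto simp: gain_kernel_def loss_kernel_def)

text \<open>The polar factor reduces the kernel to \<open>(1 - exp (- \<rho>)) / \<rho>\<close>.
  Writing the numerator as the integral of \<open>exp (- t)\<close> over \<open>t < \<rho>\<close>
  and exchanging the order leaves \<open>1 / \<rho>\<close> on the interval from \<open>t\<close> to
  \<open>r\<close>. The loss has its analogue with \<open>t > \<rho>\<close>, so the two produce the
  positive and the negative part of \<open>ln (r / t)\<close>.\<close>

lemma ln_layers_gain:
  assumes r: "0 < r" and n: "0 < n"
  shows "(\<integral>\<^sup>+\<rho>. indicator {0<..} \<rho> * (indicator {..<r} \<rho> * ennreal (\<rho> ^ (n - 1) * gain_kernel n \<rho>)) \<partial>lborel) =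
    (\<integral>\<^sup>+t. ennreal (indicator {0<..} t * exp (- t)) * ennreal (ln (r / t)) \<partial>lborel)"
proof -
  have pw: "\<rho> ^ (n - 1) * gain_kernel n \<rho> = 1 / \<rho> * (1 - exp (- \<rho>))" if "0 < \<rho>" for \<rho>
    using n that by (cases n) (auto simp: gain_kernel_def)
  have "(\<integral>\<^sup>+\<rho>. indicator {0<..} \<rho> * (indicator {..<r} \<rho> * ennreal (\<rho> ^ (n - 1) * gain_kernel n \<rho>)) \<partial>lborel)
    = (\<integral>\<^sup>+\<rho>. \<integral>\<^sup>+t. (if 0 < \<rho> \<and> \<rho> < r \<and> 0 < t \<and> t < \<rho> then ennreal (1 / \<rho>) * ennreal (exp (- t)) else 0) \<partial>lborel \<partial>lborel)"
  proof (rule nn_integral_cong)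
    fix \<rho> :: real
    show "indicator {0<..} \<rho> * (indicator {..<r} \<rho> * ennreal (\<rho> ^ (n - 1) * gain_kernel n \<rho>))
      = (\<integral>\<^sup>+t. (if 0 < \<rho> \<and> \<rho> < r \<and> 0 < t \<and> t < \<rho> then ennreal (1 / \<rho>) * ennreal (exp (- t)) else 0) \<partial>lborel)"
    proof (cases "0 < \<rho> \<and> \<rho> < r")
      case True
      have "(\<integral>\<^sup>+t. (if 0 < \<rho> \<and> \<rho> < r \<and> 0 < t \<and> t < \<rho> then ennreal (1 / \<rho>) * ennreal (exp (- t)) else 0) \<partial>lborel)
        = (\<integral>\<^sup>+t. ennreal (1 / \<rho>) * (indicator {0<..<\<rho>} t * ennreal (exp (- t))) \<partial>lborel)"
        using True by (intro nn_integral_cong) (auto simp: indicator_def)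
      also have "\<dots> = ennreal (1 / \<rho>) * ennreal (1 - exp (- \<rho>))"
        using True by (subst nn_integral_cmult) (auto simp: nn_integral_exp_Ioo)
      also have "\<dots> = ennreal (\<rho> ^ (n - 1) * gain_kernel n \<rho>)"
        using True by (simp only: pw) (rule ennreal_mult[symmetric], auto)
      finally show ?thesis using True by simp
    next
      case False
      then have "\<not> (0 < \<rho> \<and> \<rho> < r \<and> 0 < t \<and> t < \<rho>)" for t by auto
      then show ?thesis using False by (simp only: if_False nn_integral_const) (auto simp: indicator_def)
    qed
  qed
  also have "\<dots> = (\<integral>\<^sup>+t. \<integral>\<^sup>+\<rho>. (if 0 < \<rho> \<and> \<rho> < r \<and> 0 < t \<and> t < \<rho> then ennreal (1 / \<rho>) * ennreal (exp (- t)) else 0) \<partial>lborel \<partial>lborel)"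
    by (rule lborel_pair.Fubini') measurable
  also have "\<dots> = (\<integral>\<^sup>+t. ennreal (indicator {0<..} t * exp (- t)) * ennreal (ln (r / t)) \<partial>lborel)"
  proof (rule nn_integral_cong)
    fix t :: real
    show "(\<integral>\<^sup>+\<rho>. (if 0 < \<rho> \<and> \<rho> < r \<and> 0 < t \<and> t < \<rho> then ennreal (1 / \<rho>) * ennreal (exp (- t)) else 0) \<partial>lborel)
      = ennreal (indicator {0<..} t * exp (- t)) * ennreal (ln (r / t))"
    proof (cases "0 < t")
      case True
      have "(\<integral>\<^sup>+\<rho>. (if 0 < \<rho> \<and> \<rho> < r \<and> 0 < t \<and> t < \<rho> then ennreal (1 / \<rho>) * ennreal (exp (- t)) else 0) \<partial>lborel)
        = (\<integral>\<^sup>+\<rho>. ennreal (exp (- t)) * (indicator {t..r} \<rho> * ennreal (1 / \<rho>)) \<partial>lborel)"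
      proof (rule nn_integral_cong_AE)
        have "AE \<rho> in lborel. \<rho> \<noteq> t" "AE \<rho> in lborel. \<rho> \<noteq> r" by (rule AE_lborel_singleton)+
        then show "AE \<rho> in lborel. (if 0 < \<rho> \<and> \<rho> < r \<and> 0 < t \<and> t < \<rho> then ennreal (1 / \<rho>) * ennreal (exp (- t)) else 0)
            = ennreal (exp (- t)) * (indicator {t..r} \<rho> * ennreal (1 / \<rho>))"
          by eventually_elim (use True in \<open>auto simp: indicator_def mult.commute\<close>)
      qed
      also have "\<dots> = ennreal (exp (- t)) * ennreal (ln (r / t))"
        using True r by (subst nn_integral_cmult) (auto simp: nn_integral_reciprocal)
      finally show ?thesis using True by simp
    next
      case False
      then show ?thesis by simp
    qed
  qed
  finally show ?thesis .
qed

lemma ln_layers_loss: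
  assumes r: "0 < r" and n: "0 < n"
  shows "(\<integral>\<^sup>+\<rho>. indicator {0<..} \<rho> * (indicator {r..} \<rho> * ennreal (\<rho> ^ (n - 1) * loss_kernel n \<rho>)) \<partial>lborel) =
    (\<integral>\<^sup>+t. ennreal (indicator {0<..} t * exp (- t)) * ennreal (ln (t / r)) \<partial>lborel)"
proof -
  have pw: "\<rho> ^ (n - 1) * loss_kernel n \<rho> = 1 / \<rho> * exp (- \<rho>)" if "0 < \<rho>" for \<rho>
    using n that by (cases n) (auto simp: loss_kernel_def)
  have "(\<integral>\<^sup>+\<rho>. indicator {0<..} \<rho> * (indicator {r..} \<rho> * ennreal (\<rho> ^ (n - 1) * loss_kernel n \<rho>)) \<partial>lborel)
    = (\<integral>\<^sup>+\<rho>. \<integral>\<^sup>+t. (if r \<le> \<rho> \<and> \<rho> \<le> t then ennreal (1 / \<rho>) * ennreal (exp (- t)) else 0) \<partial>lborel \<partial>lborel)"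
  proof (rule nn_integral_cong)
    fix \<rho> :: real
    show "indicator {0<..} \<rho> * (indicator {r..} \<rho> * ennreal (\<rho> ^ (n - 1) * loss_kernel n \<rho>))
      = (\<integral>\<^sup>+t. (if r \<le> \<rho> \<and> \<rho> \<le> t then ennreal (1 / \<rho>) * ennreal (exp (- t)) else 0) \<partial>lborel)"
    proof (cases "r \<le> \<rho>")
      case True
      have "(\<integral>\<^sup>+t. (if r \<le> \<rho> \<and> \<rho> \<le> t then ennreal (1 / \<rho>) * ennreal (exp (- t)) else 0) \<partial>lborel)
        = (\<integral>\<^sup>+t. ennreal (1 / \<rho>) * (indicator {\<rho>..} t * ennreal (exp (- t))) \<partial>lborel)"
        using True by (intro nn_integral_cong) (auto simp: indicator_def)
      also have "\<dots> = ennreal (1 / \<rho>) * ennreal (exp (- \<rho>))"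
        by (subst nn_integral_cmult) (auto simp: nn_integral_exp_atLeast)
      also have "\<dots> = ennreal (\<rho> ^ (n - 1) * loss_kernel n \<rho>)"
      proof -
        have "0 < \<rho>" using True r by simp
        then show ?thesis by (simp only: pw) (rule ennreal_mult[symmetric], auto)
      qed
      finally show ?thesis using True r by simp
    qed simp
  qed
  also have "\<dots> = (\<integral>\<^sup>+t. \<integral>\<^sup>+\<rho>. (if r \<le> \<rho> \<and> \<rho> \<le> t then ennreal (1 / \<rho>) * ennreal (exp (- t)) else 0) \<partial>lborel \<partial>lborel)"
    by (rule lborel_pair.Fubini') measurable
  also have "\<dots> = (\<integral>\<^sup>+t. ennreal (indicator {0<..} t * exp (- t)) * ennreal (ln (t / r)) \<partial>lborel)"
  proof (rule nn_integral_cong)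
    fix t :: real
    show "(\<integral>\<^sup>+\<rho>. (if r \<le> \<rho> \<and> \<rho> \<le> t then ennreal (1 / \<rho>) * ennreal (exp (- t)) else 0) \<partial>lborel)
      = ennreal (indicator {0<..} t * exp (- t)) * ennreal (ln (t / r))"
    proof (cases "0 < t")
      case True
      have "(\<integral>\<^sup>+\<rho>. (if r \<le> \<rho> \<and> \<rho> \<le> t then ennreal (1 / \<rho>) * ennreal (exp (- t)) else 0) \<partial>lborel)
        = (\<integral>\<^sup>+\<rho>. ennreal (exp (- t)) * (indicator {r..t} \<rho> * ennreal (1 / \<rho>)) \<partial>lborel)"
        by (intro nn_integral_cong) (auto simp: indicator_def mult.commute)
      also have "\<dots> = ennreal (exp (- t)) * ennreal (ln (t / r))"
        using True r by (subst nn_integral_cmult) (auto simp: nn_integral_reciprocal)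
      finally show ?thesis using True by simp
    next
      case False
      then have "\<not> (r \<le> \<rho> \<and> \<rho> \<le> t)" for \<rho> using r by auto
      then show ?thesis using False by (simp only: if_False nn_integral_const) simp
    qed
  qed
  finally show ?thesis .
qed

lemma abs_exp_minus_one_le: "\<bar>exp y - 1\<bar> \<le> \<bar>y\<bar> * exp \<bar>y\<bar>" for y :: real
proof (cases "0 \<le> y")
  case True
  have "1 - y \<le> exp (- y)" using exp_ge_add_one_self[of "- y"] by simp
  then have "exp y * (1 - y) \<le> exp y * exp (- y)" by (intro mult_left_mono) auto
  then show ?thesis using True by (simp add: exp_minus algebra_simps)
next
  case False
  have "1 + y \<le> exp y" by (rule exp_ge_add_one_self)
  moreover have "(- y) * 1 \<le> (- y) * exp (- y)" using False by (intro mult_left_mono) auto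
  moreover have "exp y \<le> 1" using False by simp
  ultimately have "1 - exp y \<le> (- y) * exp (- y)" "exp y \<le> 1" by linarith+
  then show ?thesis using False by simp
qed

section \<open>Logarithmic moments as derivatives of power moments\<close>

text \<open>Differentiation under the integral at \<open>\<alpha> = 0\<close>, where
  \<open>r powr \<alpha>\<close> has derivative \<open>ln r\<close>. The difference quotients are
  dominated by the moments of orders 1/2 and -1/2.\<close>

lemma has_bochner_integral_mult_ln:
  fixes w \<Phi> :: "real \<Rightarrow> real"
  assumes [measurable]: "w \<in> borel_measurable borel" and w0: "\<And>r. 0 \<le> w r" and wneg: "\<And>r. r \<le> 0 \<Longrightarrow> w r = 0"
    and \<Phi>: "\<And>\<alpha>. \<bar>\<alpha>\<bar> \<le> 1 / 2 \<Longrightarrow> has_bochner_integral lborel (\<lambda>r. w r * r powr \<alpha>) (\<Phi> \<alpha>)"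
    and D: "(\<Phi> has_real_derivative D) (at 0)"
  shows "has_bochner_integral lborel (\<lambda>r. w r * ln r) D"
proof -
  \<comment> \<open>Increments of at most 1/4 leave room for the logarithm: with
    \<open>x = ln r\<close>, both \<open>\<bar>x\<bar> / 4\<close> and
    \<open>exp (a j * \<bar>x\<bar>)\<close> are bounded by \<open>exp (\<bar>x\<bar> / 4)\<close>,
    and the exponents add up to 1/2.\<close>
  define a where "a j = 1 / real (j + 4)" for j
  have a: "0 < a j" "a j \<le> 1 / 4" for j by (auto simp: a_def field_simps)
  have alim: "a \<longlonglongrightarrow> 0"
    unfolding a_def using LIMSEQ_ignore_initial_segment[OF lim_1_over_n, of 4] by simp
  have alim': "filterlim a (at 0) sequentially"
    using alim a by (auto simp: filterlim_at less_imp_neq[symmetric] intro!: always_eventually)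
  define q where "q j r = w r * ((r powr a j - 1) / a j)" for j r
  have q: "has_bochner_integral lborel (q j) ((\<Phi> (a j) - \<Phi> 0) / a j)" for j
  proof -
    have "has_bochner_integral lborel (\<lambda>r. (w r * r powr a j - w r * r powr 0) / a j) ((\<Phi> (a j) - \<Phi> 0) / a j)"
      using a[of j] by (intro has_bochner_integral_divide has_bochner_integral_diff \<Phi>) auto
    moreover have "(w r * r powr a j - w r * r powr 0) / a j = q j r" for r
      using wneg[of r] by (cases "r \<le> 0") (auto simp: q_def algebra_simps diff_divide_distrib)
    ultimately show ?thesis by simp
  qed
  have pt: "(\<lambda>j. q j r) \<longlonglongrightarrow> w r * ln r" for r
  proof (cases "r \<le> 0")
    case True
    then show ?thesis by (simp add: q_def wneg)
  next
    case False
    then have "((\<lambda>\<alpha>. r powr \<alpha>) has_real_derivative ln r) (at 0)"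
      by (auto intro!: derivative_eq_intros)
    then have "((\<lambda>h. (r powr (0 + h) - r powr 0) / h) \<longlongrightarrow> ln r) (at 0)" by (simp only: DERIV_def)
    from filterlim_compose[OF this alim'] have "(\<lambda>j. (r powr a j - 1) / a j) \<longlonglongrightarrow> ln r"
      using False by simp
    then show ?thesis unfolding q_def by (rule tendsto_mult_left)
  qed
  define G where "G r = 4 * (w r * r powr (1/2) + w r * r powr (- (1/2)))" for r
  have G: "integrable lborel G" unfolding G_def
    using \<Phi>[of "1/2"] \<Phi>[of "- (1/2)"] by (auto simp: has_bochner_integral_iff)
  have dom: "norm (q j r) \<le> G r" for j r
  proof (cases "r \<le> 0")
    case True
    then show ?thesis by (simp add: q_def G_def wneg)
  next
    case False
    define x where "x = ln r"
    have rp: "r powr b = exp (b * x)" for b using False by (simp add: powr_def x_def)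
    have "\<bar>exp (a j * x) - 1\<bar> \<le> \<bar>a j * x\<bar> * exp \<bar>a j * x\<bar>" by (rule abs_exp_minus_one_le)
    also have "\<dots> = a j * (\<bar>x\<bar> * exp (a j * \<bar>x\<bar>))" using a[of j] by (simp add: abs_mult)
    finally have "\<bar>(r powr a j - 1) / a j\<bar> \<le> \<bar>x\<bar> * exp (a j * \<bar>x\<bar>)"
      using a[of j] by (simp add: rp divide_le_eq mult.commute)
    also have "\<dots> \<le> (4 * exp (\<bar>x\<bar> / 4)) * exp (\<bar>x\<bar> / 4)"
    proof (intro mult_mono)
      show "\<bar>x\<bar> \<le> 4 * exp (\<bar>x\<bar> / 4)" using exp_ge_add_one_self[of "\<bar>x\<bar> / 4"] by linarith
      have "a j * \<bar>x\<bar> \<le> 1 / 4 * \<bar>x\<bar>" using a[of j] by (intro mult_right_mono) auto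
      then show "exp (a j * \<bar>x\<bar>) \<le> exp (\<bar>x\<bar> / 4)" by simp
    qed auto
    also have "\<dots> = 4 * exp (\<bar>x\<bar> / 2)" by (simp add: exp_add[symmetric])
    also have "\<dots> \<le> 4 * (exp (x / 2) + exp (- x / 2))" by (cases "0 \<le> x") auto
    also have "\<dots> = 4 * (r powr (1/2) + r powr (- (1/2)))" by (simp add: rp)
    finally have "w r * \<bar>(r powr a j - 1) / a j\<bar> \<le> w r * (4 * (r powr (1/2) + r powr (- (1/2))))"
      by (intro mult_left_mono w0)
    moreover have "norm (q j r) = w r * \<bar>(r powr a j - 1) / a j\<bar>"
      by (simp only: q_def real_norm_def abs_mult abs_of_nonneg[OF w0])
    moreover have "G r = w r * (4 * (r powr (1/2) + r powr (- (1/2))))" by (simp add: G_def algebra_simps)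
    ultimately show ?thesis by (simp only:)
  qed
  have [measurable]: "q j \<in> borel_measurable lborel" for j unfolding q_def by measurable
  have int: "integrable lborel (\<lambda>r. w r * ln r)"
    by (rule integrable_dominated_convergence[where s=q and w=G]) (use G pt dom in auto)
  have lim: "(\<lambda>j. integral\<^sup>L lborel (q j)) \<longlonglongrightarrow> (LINT r|lborel. w r * ln r)"
    by (rule integral_dominated_convergence[where w=G]) (use G pt dom in auto)
  have "((\<lambda>h. (\<Phi> (0 + h) - \<Phi> 0) / h) \<longlongrightarrow> D) (at 0)" using D by (simp only: DERIV_def)
  from filterlim_compose[OF this alim'] have "(\<lambda>j. (\<Phi> (a j) - \<Phi> 0) / a j) \<longlonglongrightarrow> D" by simp
  then have "(\<lambda>j. integral\<^sup>L lborel (q j)) \<longlonglongrightarrow> D" using q by (simp add: has_bochner_integral_iff)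
  with lim have "(LINT r|lborel. w r * ln r) = D" by (rule LIMSEQ_unique)
  with int show ?thesis by (simp add: has_bochner_integral_iff)
qed

text \<open>Euler's integral for Gamma, differentiated at 1.\<close>

lemma has_bochner_integral_exp_ln:
  "has_bochner_integral lborel (\<lambda>t. indicator {0<..} t * exp (- t) * ln t) (deriv Gamma (1::real))"
proof (rule has_bochner_integral_mult_ln[where \<Phi>="\<lambda>\<alpha>. Gamma (1 + \<alpha>)"])
  fix \<alpha> :: real assume "\<bar>\<alpha>\<bar> \<le> 1 / 2"
  then have "0 < 1 + \<alpha>" by auto
  have "(\<integral>\<^sup>+t. ennreal (t powr (1 + \<alpha> - 1) / exp t) * indicator {0..} t \<partial>lborel) = ennreal (Gamma (1 + \<alpha>))"
    by (rule nn_integral_has_integral_lebesgue'[OF _ Gamma_integral_real]) (use \<open>0 < 1 + \<alpha>\<close> in auto)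
  also have "(\<integral>\<^sup>+t. ennreal (t powr (1 + \<alpha> - 1) / exp t) * indicator {0..} t \<partial>lborel)
    = (\<integral>\<^sup>+t. ennreal (indicator {0<..} t * exp (- t) * t powr \<alpha>) \<partial>lborel)"
    by (intro nn_integral_cong) (auto simp: indicator_def exp_minus field_simps)
  finally show "has_bochner_integral lborel (\<lambda>t. indicator {0<..} t * exp (- t) * t powr \<alpha>) (Gamma (1 + \<alpha>))"
    using \<open>0 < 1 + \<alpha>\<close> by (intro has_bochner_integral_nn_integral) (auto intro: less_imp_le Gamma_real_pos)
next
  have "Gamma field_differentiable at (1::real)"
    by (auto simp: field_differentiable_def intro!: exI has_field_derivative_Gamma)
  then have "(Gamma has_real_derivative deriv Gamma 1) (at (1 + 0::real))"
    by (simp add: DERIV_deriv_iff_field_differentiable)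
  then show "((\<lambda>\<alpha>. Gamma (1 + \<alpha>)) has_real_derivative deriv Gamma 1) (at (0::real))"
    using DERIV_shift[of "Gamma :: real \<Rightarrow> real" "deriv Gamma 1" 0 1] by (simp add: add.commute)
qed auto

lemma Beta_real_nonneg: "0 < a \<Longrightarrow> 0 < b \<Longrightarrow> 0 \<le> Beta a (b::real)"
  by (auto simp: Beta_def intro!: divide_nonneg_nonneg mult_nonneg_nonneg less_imp_le[OF Gamma_real_pos] add_pos_pos)

text \<open>The substitution \<open>t = u\<^sup>2\<close> in Euler's Beta integral; its Jacobian
  causes the final division by 2.\<close>

lemma nn_integral_Beta_square:
  fixes \<alpha> :: real
  assumes "- 1 < \<alpha>"
  shows "(\<integral>\<^sup>+u. ennreal (indicator {0<..<1} u * (u powr \<alpha> * sqrt (1 - u\<^sup>2) ^ m)) \<partial>lborel) =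
    ennreal (Beta ((\<alpha> + 1) / 2) ((real m + 2) / 2) / 2)"
proof -
  let ?a = "(\<alpha> + 1) / 2" and ?b = "(real m + 2) / 2"
  have ab: "0 < ?a" "0 < ?b" using assms by auto
  have "ennreal (Beta ?a ?b) = nn_integral lborel (\<lambda>t. ennreal (t powr (?a - 1) * (1 - t) powr (?b - 1) * indicator {0^2..1^2} t))"
    using nn_integral_has_integral_lebesgue[OF _ has_integral_Beta_real[OF ab]]
    by (simp add: mult_ac ennreal_mult' ennreal_indicator)
  also have "\<dots> = (\<integral>\<^sup>+ x. ennreal (x\<^sup>2 powr (?a - 1) * (1 - x\<^sup>2) powr (?b - 1) * (2 * x) * indicator {0..1} x) \<partial>lborel)"
    by (subst nn_integral_substitution[where g = "\<lambda>x. x ^ 2" and g' = "\<lambda>x. 2 * x"])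
       (auto intro!: derivative_eq_intros continuous_intros simp: set_borel_measurable_def)
  also have "\<dots> = (\<integral>\<^sup>+u. ennreal 2 * ennreal (indicator {0<..<1} u * (u powr \<alpha> * sqrt (1 - u\<^sup>2) ^ m)) \<partial>lborel)"
  proof (rule nn_integral_cong_AE)
    have "AE u in lborel. u \<noteq> (0::real)" "AE u in lborel. u \<noteq> (1::real)" by (rule AE_lborel_singleton)+
    then show "AE x in lborel. ennreal (x\<^sup>2 powr (?a - 1) * (1 - x\<^sup>2) powr (?b - 1) * (2 * x) * indicator {0..1} x)
      = ennreal 2 * ennreal (indicator {0<..<1} x * (x powr \<alpha> * sqrt (1 - x\<^sup>2) ^ m))"
    proof eventually_elim
      case (elim x)
      show ?case
      proof (cases "0 < x \<and> x < 1")
        case True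
        then have "x\<^sup>2 < 1" by (simp add: power_less_one_iff)
        have "x\<^sup>2 powr (?a - 1) = x powr (2 * (?a - 1))"
        proof -
          have "x\<^sup>2 = x powr 2" using True by (simp add: powr_numeral)
          then show ?thesis by (simp only: powr_powr)
        qed
        also have "2 * (?a - 1) = \<alpha> - 1" by simp
        finally have 1: "x\<^sup>2 powr (?a - 1) * x = x powr \<alpha>" using True by (simp add: powr_diff)
        have "sqrt (1 - x\<^sup>2) ^ m = (1 - x\<^sup>2) powr (real m / 2)"
          using \<open>x\<^sup>2 < 1\<close> by (simp add: powr_half_sqrt[symmetric] powr_powr powr_realpow[symmetric])
        also have "real m / 2 = ?b - 1" by (simp add: field_simps)
        finally have 2: "sqrt (1 - x\<^sup>2) ^ m = (1 - x\<^sup>2) powr (?b - 1)" .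
        have "x\<^sup>2 powr (?a - 1) * (1 - x\<^sup>2) powr (?b - 1) * (2 * x) = 2 * (x powr \<alpha> * sqrt (1 - x\<^sup>2) ^ m)"
          unfolding 1[symmetric] 2 by (simp only: ac_simps)
        then show ?thesis using True by (simp only:) (simp add: ennreal_mult')
      next
        case False
        then show ?thesis using elim by (auto simp: indicator_def)
      qed
    qed
  qed
  also have "\<dots> = ennreal 2 * (\<integral>\<^sup>+u. ennreal (indicator {0<..<1} u * (u powr \<alpha> * sqrt (1 - u\<^sup>2) ^ m)) \<partial>lborel)"
    by (rule nn_integral_cmult) auto
  finally have *: "ennreal 2 * (\<integral>\<^sup>+u. ennreal (indicator {0<..<1} u * (u powr \<alpha> * sqrt (1 - u\<^sup>2) ^ m)) \<partial>lborel) = ennreal (2 * (Beta ?a ?b / 2))"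
    by simp
  have "0 \<le> Beta ?a ?b" by (rule Beta_real_nonneg[OF ab])
  then have "ennreal (2 * (Beta ?a ?b / 2)) = ennreal 2 * ennreal (Beta ?a ?b / 2)"
    by (intro ennreal_mult) auto
  with * show ?thesis by (simp add: ennreal_mult_cancel_left del: ennreal_numeral)
qed

text \<open>The origin of \<open>alpha_sigma\<close>: up to normalization it is the moment of order
  \<open>\<alpha>\<close> of \<open>chord\<close>. Scaling by \<open>r = 2 * R * u\<close> leads to
  a Beta integral, whose second Gamma factor cancels against the volume of the lower-dimensional
  unit ball. The power of Gamma in \<open>alpha_sigma\<close> compensates for expressing the scale
  through the volume of the ball instead of its radius.\<close>

lemma has_bochner_integral_chord_powr:
  assumes R: "0 < R" and n: "0 < n" and \<alpha>: "- 1 < \<alpha>"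
  shows "has_bochner_integral lborel (\<lambda>r. chord n R r * r powr \<alpha>)
    (R ^ n / real n * alpha_sigma n \<alpha> * (unit_ball_vol (real n) * R ^ n) powr (\<alpha> / real n))"
proof -
  let ?a = "(\<alpha> + 1) / 2" and ?b = "(real (n - 1) + 2) / 2" and ?w = "unit_ball_vol (real (n - 1))"
  have b: "?b = real (n - 1) / 2 + 1" by simp
  have ab: "0 < ?a" "0 < ?b" using \<alpha> by auto
  have sumab: "?a + ?b = (real n + \<alpha>) / 2 + 1" using n by (simp add: of_nat_diff field_simps)
  have "(\<integral>\<^sup>+r. ennreal (chord n R r * r powr \<alpha>) \<partial>lborel)
    = ennreal \<bar>2 * R\<bar> * (\<integral>\<^sup>+u. ennreal (chord n R (0 + 2 * R * u) * (0 + 2 * R * u) powr \<alpha>) \<partial>lborel)"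
    using R by (intro nn_integral_real_affine) auto
  also have "(\<integral>\<^sup>+u. ennreal (chord n R (0 + 2 * R * u) * (0 + 2 * R * u) powr \<alpha>) \<partial>lborel)
    = (\<integral>\<^sup>+u. ennreal (?w * R ^ (n - 1) * (2 * R) powr \<alpha>) * ennreal (indicator {0<..<1} u * (u powr \<alpha> * sqrt (1 - u\<^sup>2) ^ (n - 1))) \<partial>lborel)"
  proof (rule nn_integral_cong)
    fix u :: real
    show "ennreal (chord n R (0 + 2 * R * u) * (0 + 2 * R * u) powr \<alpha>)
      = ennreal (?w * R ^ (n - 1) * (2 * R) powr \<alpha>) * ennreal (indicator {0<..<1} u * (u powr \<alpha> * sqrt (1 - u\<^sup>2) ^ (n - 1)))"
    proof (cases "0 < u \<and> u < 1")
      case True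
      have "sqrt (R\<^sup>2 - (2 * R * u / 2)\<^sup>2) = sqrt (R\<^sup>2 * (1 - u\<^sup>2))" by (simp add: power_mult_distrib right_diff_distrib)
      also have "\<dots> = R * sqrt (1 - u\<^sup>2)" using R by (simp add: real_sqrt_mult)
      finally have "chord n R (2 * R * u) = ?w * (R ^ (n - 1) * sqrt (1 - u\<^sup>2) ^ (n - 1))"
        using True R by (simp add: chord_def power_mult_distrib)
      moreover have "(2 * R * u) powr \<alpha> = (2 * R) powr \<alpha> * u powr \<alpha>" using True R by (simp add: powr_mult)
      ultimately have "chord n R (0 + 2 * R * u) * (0 + 2 * R * u) powr \<alpha> =
          (?w * R ^ (n - 1) * (2 * R) powr \<alpha>) * (u powr \<alpha> * sqrt (1 - u\<^sup>2) ^ (n - 1))" by (simp only: add_0 ac_simps)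
      then show ?thesis using True R by (simp only:) (subst ennreal_mult', auto)
    next
      case False
      then have "\<not> (0 < 2 * R * u \<and> 2 * R * u < 2 * R)" using R by (auto simp: zero_less_mult_iff)
      then have "chord n R (0 + 2 * R * u) = 0" by (auto simp: chord_def indicator_def)
      then show ?thesis using False by (auto simp: indicator_def)
    qed
  qed
  also have "\<dots> = ennreal (?w * R ^ (n - 1) * (2 * R) powr \<alpha>) * ennreal (Beta ?a ?b / 2)"
    unfolding nn_integral_Beta_square[OF \<alpha>, symmetric] by (rule nn_integral_cmult) auto
  finally have I: "(\<integral>\<^sup>+r. ennreal (chord n R r * r powr \<alpha>) \<partial>lborel) = ennreal (2 * R * (?w * R ^ (n - 1) * (2 * R) powr \<alpha> * (Beta ?a ?b / 2)))"
    using R Beta_real_nonneg[OF ab] by (simp add: ennreal_mult'[symmetric])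
  have G: "0 < Gamma ?a" "0 < Gamma ?b" "0 < Gamma ((real n + \<alpha>) / 2 + 1)" "0 < Gamma (real n / 2 + 1)"
  proof -
    have "1 \<le> real n" using n by simp
    then have "0 < real n + \<alpha>" using \<alpha> by simp
    then have "0 < (real n + \<alpha>) / 2 + 1" by (intro add_pos_pos) auto
    moreover have "0 < real n / 2 + 1" by (intro add_nonneg_pos) auto
    ultimately show "0 < Gamma ?a" "0 < Gamma ?b" "0 < Gamma ((real n + \<alpha>) / 2 + 1)" "0 < Gamma (real n / 2 + 1)"
      using ab by (auto simp only: intro!: Gamma_real_pos)
  qed
  have RR: "R * R ^ (n - 1) = R ^ n" using n by (simp add: power_eq_if)
  have "2 * R * (?w * R ^ (n - 1) * (2 * R) powr \<alpha> * (Beta ?a ?b / 2)) = (R * R ^ (n - 1)) * (2 * R) powr \<alpha> * (?w * Beta ?a ?b)"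
    by simp
  also have "?w * Beta ?a ?b = pi powr (real (n - 1) / 2) * Gamma ?a / Gamma ((real n + \<alpha>) / 2 + 1)"
  proof -
    have w: "?w = pi powr (real (n - 1) / 2) / Gamma ?b" unfolding unit_ball_vol_def b ..
    have B: "Beta ?a ?b = Gamma ?a * Gamma ?b / Gamma ((real n + \<alpha>) / 2 + 1)" unfolding Beta_def sumab ..
    have "(P / gb) * (ga * gb / gc) = P * ga / gc" if "gb \<noteq> 0" for P ga gb gc :: real using that by simp
    from this[OF less_imp_neq[OF G(2), symmetric]] show ?thesis unfolding w B .
  qed
  also have "R * R ^ (n - 1) * (2 * R) powr \<alpha> * (pi powr (real (n - 1) / 2) * Gamma ?a / Gamma ((real n + \<alpha>) / 2 + 1))
    = R ^ n / real n * alpha_sigma n \<alpha> * (unit_ball_vol (real n) * R ^ n) powr (\<alpha> / real n)"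
  proof -
    have e1: "(unit_ball_vol (real n) * R ^ n) powr (\<alpha> / real n) = pi powr (\<alpha> / 2) / Gamma (real n / 2 + 1) powr (\<alpha> / real n) * R powr \<alpha>"
    proof -
      have "(unit_ball_vol (real n) * R ^ n) powr (\<alpha> / real n) = unit_ball_vol (real n) powr (\<alpha> / real n) * (R powr real n) powr (\<alpha> / real n)"
        using R by (simp add: powr_mult powr_realpow)
      also have "(R powr real n) powr (\<alpha> / real n) = R powr \<alpha>" using n by (simp add: powr_powr)
      also have "unit_ball_vol (real n) powr (\<alpha> / real n) = pi powr (\<alpha> / 2) / Gamma (real n / 2 + 1) powr (\<alpha> / real n)"
        using G n by (simp add: unit_ball_vol_def powr_divide powr_powr)
      finally show ?thesis .
    qed
    have e2: "pi powr (real (n - 1) / 2) = pi powr ((real n - \<alpha> - 1) / 2) * pi powr (\<alpha> / 2)"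
      using n by (simp add: powr_add[symmetric] of_nat_diff field_simps)
    have e3: "(2 * R) powr \<alpha> = 2 powr \<alpha> * R powr \<alpha>" using R by (simp add: powr_mult)
    have g: "Gamma (real n / 2 + 1) powr (\<alpha> / real n) \<noteq> 0"
      unfolding powr_eq_0_iff by (rule less_imp_neq[OF G(4), symmetric])
    have "Rn * (x2 * xR) * (P1 * P2 * ga / gc) = Rn / k * (k * x2 * P1 * ga * gn / gc) * (P2 / gn * xR)"
      if "k \<noteq> 0" "gn \<noteq> 0" for Rn x2 xR P1 P2 ga gc gn k :: real
      using that by simp
    from this[OF _ g, of "real n"] n show ?thesis unfolding alpha_sigma_def e1 e2 e3 RR by simp
  qed
  finally have eq: "2 * R * (?w * R ^ (n - 1) * (2 * R) powr \<alpha> * (Beta ?a ?b / 2))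
    = R ^ n / real n * alpha_sigma n \<alpha> * (unit_ball_vol (real n) * R ^ n) powr (\<alpha> / real n)" .
  show ?thesis
  proof (rule has_bochner_integral_nn_integral)
    show "(\<integral>\<^sup>+r. ennreal (chord n R r * r powr \<alpha>) \<partial>lborel) =
      ennreal (R ^ n / real n * alpha_sigma n \<alpha> * (unit_ball_vol (real n) * R ^ n) powr (\<alpha> / real n))"
      unfolding I eq ..
    show "0 \<le> R ^ n / real n * alpha_sigma n \<alpha> * (unit_ball_vol (real n) * R ^ n) powr (\<alpha> / real n)"
      unfolding eq[symmetric] using R Beta_real_nonneg[OF ab] by auto
  qed (auto simp: chord_nonneg)
qed

text \<open>\<open>sigma0\<close> is stated with \<open>deriv\<close>, which carries information
  once differentiability is known; at 0 no Gamma argument is a pole and the denominator is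
  nonzero.\<close>

lemma alpha_sigma_deriv:
  assumes "0 < n"
  shows "(alpha_sigma n has_real_derivative deriv (alpha_sigma n) 0) (at 0)"
proof -
  have "Gamma ((real n + 0) / 2 + 1) > 0" by (intro Gamma_real_pos) auto
  then have nz: "Gamma ((real n + 0) / 2 + 1) \<noteq> 0" by (rule less_imp_neq[symmetric])
  have nz': "Gamma (real n / 2 + 1) > 0" "((real n + 0) / 2 + 1) \<notin> \<int>\<^sub>\<le>\<^sub>0" "((0::real) + 1) / 2 \<notin> \<int>\<^sub>\<le>\<^sub>0"
    by (auto elim!: nonpos_Ints_cases)
  have "\<exists>D. (alpha_sigma n has_real_derivative D) (at 0)"
    unfolding alpha_sigma_def[abs_def]
    by (rule exI, (rule derivative_eq_intros refl nz nz' | use nz' assms in \<open>simp; fail\<close>)+)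
  then show ?thesis by (metis DERIV_imp_deriv)
qed

lemma has_bochner_integral_chord_ln:
  assumes R: "0 < R" and n: "0 < n"
  shows "has_bochner_integral lborel (\<lambda>r. chord n R r * ln r)
    (R ^ n / real n * (deriv (alpha_sigma n) 0 + alpha_sigma n 0 * (ln (unit_ball_vol (real n) * R ^ n) / real n)))"
proof (rule has_bochner_integral_mult_ln)
  let ?m = "unit_ball_vol (real n) * R ^ n"
  show "has_bochner_integral lborel (\<lambda>r. chord n R r * r powr \<alpha>) (R ^ n / real n * alpha_sigma n \<alpha> * ?m powr (\<alpha> / real n))"
    if "\<bar>\<alpha>\<bar> \<le> 1 / 2" for \<alpha>
    using that by (intro has_bochner_integral_chord_powr R n) auto
  have m: "0 < ?m" using R by simp
  have "((\<lambda>\<alpha>. c * A \<alpha> * M powr (\<alpha> / real n)) has_real_derivative c * (A' + A 0 * (ln M / real n))) (at 0)"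
    if "0 < M" "(A has_real_derivative A') (at 0)" for A and A' M c :: real
    using that n by (auto intro!: derivative_eq_intros simp: algebra_simps)
  from this[OF m alpha_sigma_deriv[OF n]]
  show "((\<lambda>\<alpha>. R ^ n / real n * alpha_sigma n \<alpha> * ?m powr (\<alpha> / real n)) has_real_derivative
      R ^ n / real n * (deriv (alpha_sigma n) 0 + alpha_sigma n 0 * (ln ?m / real n))) (at 0)" .
qed (auto simp: chord_nonneg, simp add: chord_def)

section \<open>Gain minus loss of a ball\<close>

text \<open>The decomposition of \<open>x - y\<close> into positive and negative parts, arranged so
  that only sums occur. It can be integrated before any finiteness is known.\<close>

lemma ennreal_ln_balance:
  fixes x y :: real
  shows "ennreal (x - y) + ennreal (- x) + ennreal y = ennreal (y - x) + ennreal x + ennreal (- y)"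
proof -
  have *: "ennreal z = ennreal (max 0 z)" for z by (simp add: max_def ennreal_neg)
  have "max 0 (x - y) + max 0 (- x) + max 0 y = max 0 (y - x) + max 0 x + max 0 (- y)" by (simp add: max_def)
  then have "ennreal (max 0 (x - y) + max 0 (- x) + max 0 y) = ennreal (max 0 (y - x) + max 0 x + max 0 (- y))" by simp
  then show ?thesis
    by (subst (1 2 3 4 5 6) *) (simp add: ennreal_plus)
qed

lemma has_bochner_integral_parts:
  assumes "has_bochner_integral M f (I::real)"
  obtains a b where "0 \<le> a" "0 \<le> b" "(\<integral>\<^sup>+x. ennreal (f x) \<partial>M) = ennreal a" "(\<integral>\<^sup>+x. ennreal (- f x) \<partial>M) = ennreal b" "I = a - b"
proof -
  have "integrable M f" "integral\<^sup>L M f = I" using assms by (auto simp: has_bochner_integral_iff)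
  then show thesis
    using real_lebesgue_integral_def[of M f] real_integrable_def[of M f]
    by (intro that[of "enn2real (\<integral>\<^sup>+x. ennreal (f x) \<partial>M)" "enn2real (\<integral>\<^sup>+x. ennreal (- f x) \<partial>M)"])
       (auto simp: less_top)
qed

text \<open>Up to the factor \<open>n * unit_ball_vol n\<close>, the difference is the double
  integral of \<open>chord n R r * exp (- t) * (ln r - ln t)\<close>. As \<open>exp (- t)\<close>
  has mass 1 and \<open>chord\<close> has mass \<open>m\<close>, it separates: the mean of
  \<open>ln r\<close> contributes the derivative of \<open>alpha_sigma\<close> and the term in
  \<open>ln m\<close>, and the mean of \<open>ln t\<close> contributes
  \<open>deriv Gamma 1\<close>.\<close>

lemma ball_gain_minus_loss:
  fixes R :: real
  assumes R: "0 < R"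
  defines "n \<equiv> DIM('a::euclidean_space)"
  defines "m \<equiv> unit_ball_vol n * R ^ n"
  obtains P N where "0 \<le> P" "0 \<le> N"
    "energy (gain_kernel n) (indicator (ball (0::'a) R)) = ennreal P"
    "boundary_energy (loss_kernel n) (ball (0::'a) R) = ennreal N"
    "P - N = m * (sigma0 n + unit_ball_vol n * ln m)"
proof -
  have n: "0 < n" by (simp add: n_def)
  let ?h = "chord n R" and ?c = "real n * unit_ball_vol n"
  have c0: "0 \<le> ?c" by simp
  have m0: "0 < m" using R by (simp add: m_def)
  define E where "E t = indicator {0<..} t * exp (- t)" for t :: real
  have [measurable]: "E \<in> borel_measurable borel" unfolding E_def[abs_def] by measurable
  have E0: "0 \<le> E t" for t by (simp add: E_def)
  define P' where "P' = (\<integral>\<^sup>+r. ennreal (?h r) * (\<integral>\<^sup>+t. ennreal (E t) * ennreal (ln (r / t)) \<partial>lborel) \<partial>lborel)"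
  define N' where "N' = (\<integral>\<^sup>+r. ennreal (?h r) * (\<integral>\<^sup>+t. ennreal (E t) * ennreal (ln (t / r)) \<partial>lborel) \<partial>lborel)"
  have hz: "?h r = 0" if "r \<le> 0" for r using that by (simp add: chord_def)
  have P: "energy (gain_kernel n) (indicator (ball (0::'a) R)) = ennreal ?c * P'"
  proof -
    have "ennreal (?h r) * (\<integral>\<^sup>+\<rho>. indicator {0<..} \<rho> * (indicator {..<r} \<rho> * ennreal (\<rho> ^ (n - 1) * gain_kernel n \<rho>)) \<partial>lborel)
      = ennreal (?h r) * (\<integral>\<^sup>+t. ennreal (E t) * ennreal (ln (r / t)) \<partial>lborel)" for r
    proof (cases "r \<le> 0")
      case False
      then show ?thesis unfolding E_def by (subst ln_layers_gain[OF _ n]) auto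
    qed (simp add: hz)
    then show ?thesis
      unfolding P'_def using energy_ball[OF R, of "gain_kernel n", where ?'a='a] by (simp add: kernels_nonneg n_def)
  qed
  have N: "boundary_energy (loss_kernel n) (ball (0::'a) R) = ennreal ?c * N'"
  proof -
    have "ennreal (?h r) * (\<integral>\<^sup>+\<rho>. indicator {0<..} \<rho> * (indicator {r..} \<rho> * ennreal (\<rho> ^ (n - 1) * loss_kernel n \<rho>)) \<partial>lborel)
      = ennreal (?h r) * (\<integral>\<^sup>+t. ennreal (E t) * ennreal (ln (t / r)) \<partial>lborel)" for r
    proof (cases "r \<le> 0")
      case False
      then show ?thesis unfolding E_def by (subst ln_layers_loss[OF _ n]) auto
    qed (simp add: hz)
    then show ?thesis
      unfolding N'_def using boundary_energy_ball[OF R, of "loss_kernel n", where ?'a='a] by (simp add: kernels_nonneg n_def)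
  qed
  obtain Hp Hm where H: "0 \<le> Hp" "0 \<le> Hm" "(\<integral>\<^sup>+r. ennreal (?h r * ln r) \<partial>lborel) = ennreal Hp"
      "(\<integral>\<^sup>+r. ennreal (- (?h r * ln r)) \<partial>lborel) = ennreal Hm"
      and Hd: "R ^ n / real n * (deriv (alpha_sigma n) 0 + alpha_sigma n 0 * (ln m / real n)) = Hp - Hm"
    using has_bochner_integral_parts[OF has_bochner_integral_chord_ln[OF R n]] unfolding m_def by blast
  obtain Ep Em where Ee: "0 \<le> Ep" "0 \<le> Em" "(\<integral>\<^sup>+t. ennreal (E t * ln t) \<partial>lborel) = ennreal Ep"
      "(\<integral>\<^sup>+t. ennreal (- (E t * ln t)) \<partial>lborel) = ennreal Em" and Ed: "deriv Gamma 1 = Ep - Em"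
    using has_bochner_integral_parts[OF has_bochner_integral_exp_ln] unfolding E_def by blast
  have h1: "(\<integral>\<^sup>+r. ennreal (?h r) \<partial>lborel) = ennreal m"
    using nn_integral_chord[OF R, where ?'a='a] by (simp add: n_def m_def)
  have E1: "(\<integral>\<^sup>+t. ennreal (E t) \<partial>lborel) = 1"
  proof -
    have "(\<integral>\<^sup>+t. ennreal (E t) \<partial>lborel) = (\<integral>\<^sup>+t. indicator {0..} t * ennreal (exp (- t)) \<partial>lborel)"
    proof (rule nn_integral_cong_AE)
      have "AE t in lborel. t \<noteq> (0::real)" by (rule AE_lborel_singleton)
      then show "AE t in lborel. ennreal (E t) = indicator {0..} t * ennreal (exp (- t))"
        by eventually_elim (auto simp: E_def indicator_def)
    qed
    then show ?thesis by (simp add: nn_integral_exp_atLeast)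
  qed
  have lhs: "P' + ennreal Hm + ennreal m * ennreal Ep =
    (\<integral>\<^sup>+r. \<integral>\<^sup>+t. ennreal (?h r) * (ennreal (E t) * (ennreal (ln (r / t)))) + ennreal (- (?h r * ln r)) * ennreal (E t) + ennreal (?h r) * ennreal (E t * ln t) \<partial>lborel \<partial>lborel)"
    by (simp add: P'_def nn_integral_add nn_integral_cmult nn_integral_multc E1 H Ee h1)
  have rhs: "N' + ennreal Hp + ennreal m * ennreal Em =
    (\<integral>\<^sup>+r. \<integral>\<^sup>+t. ennreal (?h r) * (ennreal (E t) * (ennreal (ln (t / r)))) + ennreal (?h r * ln r) * ennreal (E t) + ennreal (?h r) * ennreal (- (E t * ln t)) \<partial>lborel \<partial>lborel)"
    by (simp add: N'_def nn_integral_add nn_integral_cmult nn_integral_multc E1 H Ee h1)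
  have "ennreal (?h r) * (ennreal (E t) * (ennreal (ln (r / t)))) + ennreal (- (?h r * ln r)) * ennreal (E t) + ennreal (?h r) * ennreal (E t * ln t)
     = ennreal (?h r) * (ennreal (E t) * (ennreal (ln (t / r)))) + ennreal (?h r * ln r) * ennreal (E t) + ennreal (?h r) * ennreal (- (E t * ln t))" for r t
  proof (cases "0 < r \<and> 0 < t")
    case True
    have 1: "ennreal (- (?h r * ln r)) = ennreal (?h r) * ennreal (- ln r)" "ennreal (?h r * ln r) = ennreal (?h r) * ennreal (ln r)"
      "ennreal (E t * ln t) = ennreal (E t) * ennreal (ln t)" "ennreal (- (E t * ln t)) = ennreal (E t) * ennreal (- ln t)"
      using chord_nonneg[of n R r] E0[of t] by (simp_all only: ennreal_mult'[symmetric] mult_minus_right)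
    have "ennreal (?h r) * ennreal (E t) * (ennreal (ln r - ln t) + ennreal (- ln r) + ennreal (ln t))
      = ennreal (?h r) * ennreal (E t) * (ennreal (ln t - ln r) + ennreal (ln r) + ennreal (- ln t))"
      by (simp only: ennreal_ln_balance)
    then show ?thesis using True unfolding 1 by (simp add: ln_div distrib_left ac_simps)
  next
    case False
    then show ?thesis by (auto simp: hz E_def)
  qed
  then have bal: "P' + (ennreal Hm + ennreal (m * Ep)) = N' + (ennreal Hp + ennreal (m * Em))"
    using lhs rhs m0 Ee by (simp add: ennreal_mult add.assoc)
  \<comment> \<open>Finiteness must precede subtraction: the positive part of
    \<open>ln r - ln t\<close> is at most the positive part of \<open>ln r\<close> plus the negative
    part of \<open>ln t\<close>. The balance then makes \<open>N'\<close> finite too.\<close>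
  have "P' \<le> (\<integral>\<^sup>+r. \<integral>\<^sup>+t. ennreal (?h r * ln r) * ennreal (E t) + ennreal (?h r) * ennreal (- (E t * ln t)) \<partial>lborel \<partial>lborel)"
    unfolding P'_def
  proof (intro nn_integral_mono)
    fix r
    have "ennreal (?h r) * (\<integral>\<^sup>+t. ennreal (E t) * ennreal (ln (r / t)) \<partial>lborel) = (\<integral>\<^sup>+t. ennreal (?h r) * (ennreal (E t) * ennreal (ln (r / t))) \<partial>lborel)"
      by (rule nn_integral_cmult[symmetric]) auto
    also have "\<dots> \<le> (\<integral>\<^sup>+t. ennreal (?h r * ln r) * ennreal (E t) + ennreal (?h r) * ennreal (- (E t * ln t)) \<partial>lborel)"
    proof (intro nn_integral_mono)
      fix t
      show "ennreal (?h r) * (ennreal (E t) * ennreal (ln (r / t))) \<le> ennreal (?h r * ln r) * ennreal (E t) + ennreal (?h r) * ennreal (- (E t * ln t))"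
      proof (cases "0 < r \<and> 0 < t")
        case True
        have 1: "ennreal (?h r * ln r) = ennreal (?h r) * ennreal (ln r)" "ennreal (- (E t * ln t)) = ennreal (E t) * ennreal (- ln t)"
          using chord_nonneg[of n R r] E0[of t] by (simp_all only: ennreal_mult'[symmetric] mult_minus_right)
        have "ennreal (ln r - ln t) \<le> ennreal (ln r) + ennreal (- ln t)"
          using ennreal_ln_balance[of "ln r" "ln t"]
          by (cases "0 \<le> ln r"; cases "0 \<le> ln t") (auto simp: ennreal_neg ennreal_plus[symmetric] simp del: ennreal_plus intro!: ennreal_leI)
        then have "ennreal (?h r) * ennreal (E t) * ennreal (ln r - ln t) \<le> ennreal (?h r) * ennreal (E t) * (ennreal (ln r) + ennreal (- ln t))"
          by (intro mult_left_mono) auto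
        then show ?thesis using True unfolding 1 by (simp add: ln_div distrib_left ac_simps)
      next
        case False
        then show ?thesis by (auto simp: hz E_def)
      qed
    qed
    finally show "ennreal (?h r) * (\<integral>\<^sup>+t. ennreal (E t) * ennreal (ln (r / t)) \<partial>lborel) \<le> (\<integral>\<^sup>+t. ennreal (?h r * ln r) * ennreal (E t) + ennreal (?h r) * ennreal (- (E t * ln t)) \<partial>lborel)" .
  qed
  also have "\<dots> = ennreal Hp + ennreal m * ennreal Em"
    by (simp add: nn_integral_add nn_integral_cmult nn_integral_multc E1 H Ee h1)
  also have "\<dots> < \<infinity>" by (simp add: ennreal_mult_less_top)
  finally obtain p where p: "P' = ennreal p" "0 \<le> p" by (cases P') auto
  have "N' \<le> P' + (ennreal Hm + ennreal (m * Ep))" unfolding bal by simp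
  also have "\<dots> < \<infinity>" by (simp add: p)
  finally obtain q where q: "N' = ennreal q" "0 \<le> q" by (cases N') auto
  have "p + (Hm + m * Ep) = q + (Hp + m * Em)"
    using bal p q H Ee m0 by (simp add: ennreal_plus[symmetric] del: ennreal_plus)
  then have pq: "p - q = (Hp - Hm) - m * (Ep - Em)" by (simp add: algebra_simps)
  \<comment> \<open>The moment of order 0 is the total mass of \<open>chord\<close>, namely the
    volume \<open>m\<close>. This is why \<open>ln m\<close> is finally multiplied by
    \<open>unit_ball_vol n\<close>.\<close>
  have A0: "alpha_sigma n 0 = ?c"
  proof -
    have "has_bochner_integral lborel (\<lambda>r. ?h r * r powr 0) (R ^ n / real n * alpha_sigma n 0 * m powr (0 / real n))"
      unfolding m_def by (rule has_bochner_integral_chord_powr[OF R n]) simp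
    moreover have "(\<lambda>r. ?h r * r powr 0) = ?h"
    proof (rule ext)
      show "?h r * r powr 0 = ?h r" for r by (cases "r \<le> 0") (auto simp: hz)
    qed
    moreover have "m powr (0 / real n) = 1" using m0 by simp
    ultimately have "has_bochner_integral lborel ?h (R ^ n / real n * alpha_sigma n 0)" by (simp only: mult_1_right)
    moreover have "has_bochner_integral lborel ?h m"
      by (rule has_bochner_integral_nn_integral) (use h1 m0 in \<open>auto simp: chord_nonneg\<close>)
    ultimately have "R ^ n / real n * alpha_sigma n 0 = m" by (rule has_bochner_integral_eq)
    then show ?thesis using R n by (simp add: m_def field_simps)
  qed
  have "?c * p - ?c * q = ?c * ((Hp - Hm) - m * (Ep - Em))" by (simp only: right_diff_distrib[symmetric] pq)
  also have "\<dots> = m * (sigma0 n + unit_ball_vol n * ln m)"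
    unfolding Hd[symmetric] Ed[symmetric] A0 sigma0_def using n by (simp add: m_def field_simps)
  finally have "?c * p - ?c * q = m * (sigma0 n + unit_ball_vol n * ln m)" .
  then show thesis
    using c0 p q by (intro that[of "?c * p" "?c * q"]) (auto simp: P N ennreal_mult)
qed

section \<open>Comparison of a set with the ball of equal volume\<close>

text \<open>Strictness comes from the factor \<open>(1 - exp (- r)) / r\<close>, whose derivative is
  negative because \<open>1 + x < exp x\<close>; the remaining power of \<open>1 / r\<close> does
  not increase.\<close>

lemma gain_kernel_strict_antimono:
  assumes "0 < r" "r < r'" "0 < n"
  shows "gain_kernel n r' < gain_kernel n r"
proof -
  have "(1 - exp (- r')) / r' < (1 - exp (- r)) / r"
  proof (rule DERIV_neg_imp_decreasing[OF assms(2)])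
    fix x assume x: "r \<le> x" "x \<le> r'"
    then have "0 < x" using assms by simp
    have "((\<lambda>r. (1 - exp (- r)) / r) has_real_derivative ((exp (- x) * x - (1 - exp (- x))) / (x * x))) (at x)"
      using \<open>0 < x\<close> by (auto intro!: derivative_eq_intros)
    moreover have "(exp (- x) * x - (1 - exp (- x))) / (x * x) < 0"
    proof -
      have "1 + x < exp x"
      proof -
        \<comment> \<open>Squaring the weak inequality at \<open>x / 2\<close> makes it strict at
          \<open>x\<close>.\<close>
        have "1 + x < (1 + x / 2)\<^sup>2" using \<open>0 < x\<close> by (simp add: power2_eq_square algebra_simps)
        also have "\<dots> \<le> (exp (x / 2))\<^sup>2" using \<open>0 < x\<close> by (intro power_mono exp_ge_add_one_self) auto
        also have "\<dots> = exp x" by (simp add: exp_double[symmetric])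
        finally show ?thesis .
      qed
      then have "(1 + x) * exp (- x) < exp x * exp (- x)" by (intro mult_strict_right_mono) auto
      then have "exp (- x) * x - (1 - exp (- x)) < 0" by (simp add: exp_minus algebra_simps)
      then show ?thesis using \<open>0 < x\<close> by (simp add: divide_neg_pos)
    qed
    ultimately show "\<exists>y. ((\<lambda>r. (1 - exp (- r)) / r) has_real_derivative y) (at x) \<and> y < 0" by blast
  qed
  moreover have "1 / r' ^ (n - 1) \<le> 1 / r ^ (n - 1)"
    using assms by (intro divide_left_mono power_mono) auto
  ultimately have "(1 - exp (- r')) / r' * (1 / r' ^ (n - 1)) < (1 - exp (- r)) / r * (1 / r ^ (n - 1))"
    using assms by (intro mult_less_le_imp_less) auto
  moreover have "gain_kernel n x = (1 - exp (- x)) / x * (1 / x ^ (n - 1))" if "0 < x" for x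
    using that assms(3) by (cases n) (auto simp: gain_kernel_def)
  ultimately show ?thesis using assms by simp
qed

lemma loss_kernel_antimono:
  assumes "0 < r" "r \<le> r'"
  shows "loss_kernel n r' \<le> loss_kernel n r"
  using assms by (auto simp: loss_kernel_def intro!: frac_le power_mono)

lemma nn_integral_loss_kernel_truncated:
  "(\<integral>\<^sup>+z. ennreal (min (loss_kernel DIM('a) (norm z)) (real j)) \<partial>(lborel::'a::euclidean_space measure)) < \<infinity>"
proof -
  let ?n = "DIM('a)"
  have n: "0 < ?n" by simp
  have "(\<integral>\<^sup>+r. indicator {0<..} r * (ennreal (r ^ (?n - 1)) * ennreal (min (loss_kernel ?n r) (real j))) \<partial>lborel)
    \<le> (\<integral>\<^sup>+r. ennreal (real j) * indicator {0..1} r + indicator {0..} r * ennreal (exp (- r)) \<partial>lborel)"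
  proof (intro nn_integral_mono)
    fix r :: real
    consider "r \<le> 0" | "0 < r" "r \<le> 1" | "1 < r" by linarith
    then show "indicator {0<..} r * (ennreal (r ^ (?n - 1)) * ennreal (min (loss_kernel ?n r) (real j)))
      \<le> ennreal (real j) * indicator {0..1} r + indicator {0..} r * ennreal (exp (- r))"
    proof cases
      case 2
      have "r ^ (?n - 1) * min (loss_kernel ?n r) (real j) \<le> 1 * real j"
        using 2 by (intro mult_mono power_le_one) (auto simp: kernels_nonneg)
      then have "ennreal (r ^ (?n - 1)) * ennreal (min (loss_kernel ?n r) (real j)) \<le> ennreal (real j)"
        using 2 by (simp add: ennreal_mult[symmetric] kernels_nonneg ennreal_leI)
      then show ?thesis using 2 by (simp add: add_increasing2)
    next
      case 3
      have "r ^ (?n - 1) * min (loss_kernel ?n r) (real j) \<le> r ^ (?n - 1) * loss_kernel ?n r"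
        using 3 by (intro mult_left_mono) auto
      also have "r ^ (?n - 1) * loss_kernel ?n r = exp (- r) / r"
        using 3 n by (cases ?n) (auto simp: loss_kernel_def)
      also have "\<dots> \<le> exp (- r)" using 3 by (simp add: divide_le_eq)
      finally have "ennreal (r ^ (?n - 1)) * ennreal (min (loss_kernel ?n r) (real j)) \<le> ennreal (exp (- r))"
        using 3 by (simp add: ennreal_mult[symmetric] kernels_nonneg ennreal_leI)
      then show ?thesis using 3 by simp
    qed simp
  qed
  also have "\<dots> < \<infinity>"
    by (subst nn_integral_add) (auto simp: nn_integral_cmult_indicator nn_integral_exp_atLeast ennreal_mult_less_top)
  finally show ?thesis
    by (subst nn_integral_norm) (auto simp: ennreal_mult_less_top)
qed

lemma energy_boundary_translate:
  fixes c :: "'a::euclidean_space"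
  assumes [measurable]: "k \<in> borel_measurable borel" and k0: "\<And>r. 0 \<le> k r"
  shows "energy k (indicator (ball c R)) = energy k (indicator (ball (0::'a) R))"
    and "boundary_energy k (ball c R) = boundary_energy k (ball (0::'a) R)"
proof -
  have B [measurable]: "ball d R \<in> sets borel" "- ball d R \<in> sets borel" for d :: 'a by (auto intro: borel_comp)
  have 1: "emeasure lborel {x \<in> ball c R. x + z \<in> ball c R} = emeasure lborel {x \<in> ball (0::'a) R. x + z \<in> ball 0 R}" for z
  proof -
    have "indicator {x \<in> ball c R. x + z \<in> ball c R} (x + c) = (indicator {x \<in> ball (0::'a) R. x + z \<in> ball 0 R} x :: ennreal)" for x
      by (simp add: indicator_def dist_norm algebra_simps norm_minus_commute)
    moreover have "{x \<in> ball c R. x + z \<in> ball c R} \<in> sets borel" "{x \<in> ball (0::'a) R. x + z \<in> ball 0 R} \<in> sets borel" by measurable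
    ultimately show ?thesis
      using emeasure_lborel_translate[of "{x \<in> ball c R. x + z \<in> ball c R}" c] by simp
  qed
  have 2: "emeasure lborel {x \<in> ball c R. x + z \<in> - ball c R} = emeasure lborel {x \<in> ball (0::'a) R. x + z \<in> - ball 0 R}" for z
  proof -
    have "indicator {x \<in> ball c R. x + z \<in> - ball c R} (x + c) = (indicator {x \<in> ball (0::'a) R. x + z \<in> - ball 0 R} x :: ennreal)" for x
      by (simp add: indicator_def dist_norm algebra_simps norm_minus_commute)
    moreover have "{x \<in> ball c R. x + z \<in> - ball c R} \<in> sets borel" "{x \<in> ball (0::'a) R. x + z \<in> - ball 0 R} \<in> sets borel" by measurable
    ultimately show ?thesis
      using emeasure_lborel_translate[of "{x \<in> ball c R. x + z \<in> - ball c R}" c] by simp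
  qed
  show "energy k (indicator (ball c R)) = energy k (indicator (ball (0::'a) R))"
    unfolding energy_def by (subst (1 2) nn_integral_diff_swap) (auto simp only: B assms 1)
  show "boundary_energy k (ball c R) = boundary_energy k (ball (0::'a) R)"
    unfolding boundary_energy_def by (subst (1 2) nn_integral_diff_swap) (auto simp only: B assms 2)
qed

text \<open>Rearrangement raises the gain and lowers the loss, and the finite gain of the ball makes
  the gain of \<open>E\<close> finite. In the equality case neither can have changed; unchanged gain
  identifies \<open>E\<close>, since \<open>gain_kernel\<close> is strictly decreasing.\<close>

lemma set_gain_minus_loss:
  fixes E :: "'a::euclidean_space set"
  assumes E[measurable]: "E \<in> sets borel" and m: "emeasure lborel E = ennreal m" "0 < m"
    and fin: "boundary_energy (loss_kernel DIM('a)) E < \<infinity>"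
  defines "P \<equiv> enn2real (energy (gain_kernel DIM('a)) (indicator E))"
  defines "N \<equiv> enn2real (boundary_energy (loss_kernel DIM('a)) E)"
  shows "energy (gain_kernel DIM('a)) (indicator E) < \<infinity>"
    and "P - N \<le> m * (sigma0 DIM('a) + unit_ball_vol DIM('a) * ln m)"
    and "P - N = m * (sigma0 DIM('a) + unit_ball_vol DIM('a) * ln m) \<Longrightarrow>
      \<exists>c r. 0 < r \<and> (AE x in lborel. x \<in> E \<longleftrightarrow> x \<in> ball c r)"
proof -
  let ?n = "DIM('a)"
  have w: "0 < unit_ball_vol (real ?n)" by (rule unit_ball_vol_pos) simp
  define X where "X = m / unit_ball_vol ?n"
  have X: "0 < X" unfolding X_def using m(2) w by (rule divide_pos_pos)
  define R where "R = X powr (1 / ?n)"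
  have R: "0 < R" using X by (simp add: R_def)
  have "R ^ ?n = X" using X R by (simp add: powr_realpow[symmetric]) (simp add: R_def powr_powr)
  moreover have "unit_ball_vol ?n * X = m"
    unfolding X_def times_divide_eq_right by (rule nonzero_mult_div_cancel_left, rule less_imp_neq[OF w, symmetric])
  ultimately have mR: "unit_ball_vol ?n * R ^ ?n = m" by simp
  then have B: "emeasure lborel (ball (0::'a) R) = emeasure lborel E" using R m by (simp add: emeasure_ball)
  have Efin: "emeasure lborel E < \<infinity>" by (simp add: m)
  obtain P0 N0 where PN: "0 \<le> P0" "0 \<le> N0" "energy (gain_kernel ?n) (indicator (ball (0::'a) R)) = ennreal P0"
      "boundary_energy (loss_kernel ?n) (ball (0::'a) R) = ennreal N0"
      "P0 - N0 = m * (sigma0 ?n + unit_ball_vol ?n * ln m)"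
    using ball_gain_minus_loss[OF R, where ?'a='a] unfolding mR by blast
  have gmono: "gain_kernel ?n r' < gain_kernel ?n r" if "0 < r" "r < r'" for r r'
    using that by (intro gain_kernel_strict_antimono) auto
  have gmono': "gain_kernel ?n r' \<le> gain_kernel ?n r" if "0 < r" "r \<le> r'" for r r'
    using gmono[of r r'] that by (cases "r = r'") auto
  have gain: "energy (gain_kernel ?n) (indicator E) \<le> ennreal P0"
    unfolding PN(3)[symmetric] by (rule riesz_rearrangement[OF E Efin B]) (auto simp: kernels_nonneg gmono')
  have loss: "ennreal N0 \<le> boundary_energy (loss_kernel ?n) E"
    unfolding PN(4)[symmetric] by (rule riesz_rearrangement_boundary[OF E Efin B])
      (auto simp: kernels_nonneg loss_kernel_antimono nn_integral_loss_kernel_truncated[unfolded infinity_ennreal_def])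
  show gfin: "energy (gain_kernel ?n) (indicator E) < \<infinity>" using gain by (rule le_less_trans) simp
  have PP: "energy (gain_kernel ?n) (indicator E) = ennreal P" "0 \<le> P" unfolding P_def using gfin by (auto simp: less_top)
  have NN: "boundary_energy (loss_kernel ?n) E = ennreal N" "0 \<le> N" unfolding N_def using fin by (auto simp: less_top)
  have le: "P \<le> P0" "N0 \<le> N" using gain loss PN PP NN by auto
  then show "P - N \<le> m * (sigma0 ?n + unit_ball_vol ?n * ln m)" using PN(5) by linarith
  assume "P - N = m * (sigma0 ?n + unit_ball_vol ?n * ln m)"
  then have "P = P0" using le PN(5) by linarith
  then have maximal: "energy (gain_kernel ?n) (indicator E) = energy (gain_kernel ?n) (indicator (ball (0::'a) R))"
    using PP PN by simp
  obtain c where "AE x in lborel. x \<in> E \<longleftrightarrow> x \<in> ball c R"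
    by (rule riesz_rearrangement_equality[OF E Efin B kernels_measurable(1) kernels_nonneg(1) gmono maximal gfin]) blast+
  then show "\<exists>c r. 0 < r \<and> (AE x in lborel. x \<in> E \<longleftrightarrow> x \<in> ball c r)" using R by blast
qed

section \<open>Layer cake and entropy\<close>

definition gain :: "('a::euclidean_space \<Rightarrow> real) \<Rightarrow> ennreal" where
  "gain f = (\<integral>\<^sup>+x. \<integral>\<^sup>+y. ennreal (min (f x) (f y) * gain_kernel DIM('a) (norm (x - y))) \<partial>lborel \<partial>lborel)"

text \<open>\<open>ennreal\<close> sends negative reals to 0, so \<open>f x - f y\<close> stands for
  its positive part.\<close>

definition loss :: "('a::euclidean_space \<Rightarrow> real) \<Rightarrow> ennreal" where
  "loss f = (\<integral>\<^sup>+x. \<integral>\<^sup>+y. ennreal ((f x - f y) * loss_kernel DIM('a) (norm (x - y))) \<partial>lborel \<partial>lborel)"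

lemma nn_integral_layers:
  fixes v w :: "'a::euclidean_space \<Rightarrow> 'a \<Rightarrow> ennreal" and h :: "real \<Rightarrow> 'a \<Rightarrow> 'a \<Rightarrow> ennreal"
  assumes [measurable]: "(\<lambda>(t, x, y). h t x y) \<in> borel_measurable (borel \<Otimes>\<^sub>M borel \<Otimes>\<^sub>M borel)"
    and v: "\<And>x y. (\<integral>\<^sup>+t. indicator {0<..} t * h t x y \<partial>lborel) = v x y"
  shows "(\<integral>\<^sup>+t. indicator {0<..} t * (\<integral>\<^sup>+x. \<integral>\<^sup>+y. h t x y \<partial>lborel \<partial>lborel) \<partial>lborel) = (\<integral>\<^sup>+x. \<integral>\<^sup>+y. v x y \<partial>lborel \<partial>lborel)"
    and "(\<lambda>t. \<integral>\<^sup>+x. \<integral>\<^sup>+y. h t x y \<partial>lborel \<partial>lborel) \<in> borel_measurable borel"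
proof -
  define H where "H = (\<lambda>(t, x, y). h t x y)"
  have [measurable]: "H \<in> borel_measurable (borel \<Otimes>\<^sub>M borel \<Otimes>\<^sub>M borel)"
    unfolding H_def by (rule assms(1))
  have h: "h = (\<lambda>t x y. H (t, x, y))" by (simp add: H_def)
  have [measurable]: "(\<lambda>y. h t x y) \<in> borel_measurable borel" for t x unfolding h by measurable
  have [measurable]: "(\<lambda>x. \<integral>\<^sup>+y. h t x y \<partial>lborel) \<in> borel_measurable borel" for t unfolding h by measurable
  show "(\<lambda>t. \<integral>\<^sup>+x. \<integral>\<^sup>+y. h t x y \<partial>lborel \<partial>lborel) \<in> borel_measurable borel" unfolding h by measurable
  have "(\<integral>\<^sup>+t. indicator {0<..} t * (\<integral>\<^sup>+x. \<integral>\<^sup>+y. h t x y \<partial>lborel \<partial>lborel) \<partial>lborel)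
    = (\<integral>\<^sup>+t. \<integral>\<^sup>+x. \<integral>\<^sup>+y. indicator {0<..} t * h t x y \<partial>lborel \<partial>lborel \<partial>lborel)"
    by (simp add: nn_integral_cmult)
  also have "\<dots> = (\<integral>\<^sup>+x. \<integral>\<^sup>+t. \<integral>\<^sup>+y. indicator {0<..} t * h t x y \<partial>lborel \<partial>lborel \<partial>lborel)"
    unfolding h by (rule lborel_pair.Fubini'[symmetric]) measurable
  also have "\<dots> = (\<integral>\<^sup>+x. \<integral>\<^sup>+y. \<integral>\<^sup>+t. indicator {0<..} t * h t x y \<partial>lborel \<partial>lborel \<partial>lborel)"
    unfolding h by (intro nn_integral_cong lborel_pair.Fubini'[symmetric]) measurable
  finally show "(\<integral>\<^sup>+t. indicator {0<..} t * (\<integral>\<^sup>+x. \<integral>\<^sup>+y. h t x y \<partial>lborel \<partial>lborel) \<partial>lborel) = (\<integral>\<^sup>+x. \<integral>\<^sup>+y. v x y \<partial>lborel \<partial>lborel)"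
    by (simp only: v)
qed

lemma gain_layer_cake:
  fixes f :: "'a::euclidean_space \<Rightarrow> real"
  assumes [measurable]: "f \<in> borel_measurable borel" and f0: "\<And>x. 0 \<le> f x"
  shows "gain f = (\<integral>\<^sup>+t. indicator {0<..} t * energy (gain_kernel DIM('a)) (indicator {x. t < f x} :: 'a \<Rightarrow> real) \<partial>lborel)"
    and "(\<lambda>t. energy (gain_kernel DIM('a)) (indicator {x. t < f x} :: 'a \<Rightarrow> real)) \<in> borel_measurable borel"
proof -
  let ?h = "\<lambda>t x y. ennreal (indicator {x. t < f x} x * indicator {x. t < f x} y * gain_kernel DIM('a) (norm (x - y)))"
  have m: "(\<lambda>(t, x, y). ?h t x y) \<in> borel_measurable (borel \<Otimes>\<^sub>M borel \<Otimes>\<^sub>M borel)"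
    unfolding indicator_def mem_Collect_eq by measurable
  have v: "(\<integral>\<^sup>+t. indicator {0<..} t * ?h t x y \<partial>lborel) = ennreal (min (f x) (f y) * gain_kernel DIM('a) (norm (x - y)))" for x y
  proof -
    have "(\<integral>\<^sup>+t. indicator {0<..} t * ?h t x y \<partial>lborel) = (\<integral>\<^sup>+t. ennreal (gain_kernel DIM('a) (norm (x - y))) * indicator {0<..<min (f x) (f y)} t \<partial>lborel)"
      by (intro nn_integral_cong) (auto simp: indicator_def)
    also have "\<dots> = ennreal (gain_kernel DIM('a) (norm (x - y))) * ennreal (min (f x) (f y))"
      using f0[of x] f0[of y] by (subst nn_integral_cmult_indicator) auto
    finally show ?thesis using f0[of x] f0[of y] kernels_nonneg by (simp add: ennreal_mult mult.commute)
  qed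
  show "gain f = (\<integral>\<^sup>+t. indicator {0<..} t * energy (gain_kernel DIM('a)) (indicator {x. t < f x} :: 'a \<Rightarrow> real) \<partial>lborel)"
    unfolding gain_def energy_def by (rule nn_integral_layers(1)[OF m v, symmetric])
  show "(\<lambda>t. energy (gain_kernel DIM('a)) (indicator {x. t < f x} :: 'a \<Rightarrow> real)) \<in> borel_measurable borel"
    unfolding energy_def by (rule nn_integral_layers(2)[OF m v])
qed

lemma loss_layer_cake:
  fixes f :: "'a::euclidean_space \<Rightarrow> real"
  assumes [measurable]: "f \<in> borel_measurable borel" and f0: "\<And>x. 0 \<le> f x"
  shows "loss f = (\<integral>\<^sup>+t. indicator {0<..} t * boundary_energy (loss_kernel DIM('a)) {x. t < f x} \<partial>lborel)"
    and "(\<lambda>t. boundary_energy (loss_kernel DIM('a)) {x. t < f x}) \<in> borel_measurable borel"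
proof -
  let ?h = "\<lambda>t x y. ennreal (indicator {x. t < f x} x * indicator (- {x. t < f x}) y * loss_kernel DIM('a) (norm (x - y)))"
  have m: "(\<lambda>(t, x, y). ?h t x y) \<in> borel_measurable (borel \<Otimes>\<^sub>M borel \<Otimes>\<^sub>M borel)"
    unfolding indicator_def mem_Collect_eq Compl_iff by measurable
  have v: "(\<integral>\<^sup>+t. indicator {0<..} t * ?h t x y \<partial>lborel) = ennreal ((f x - f y) * loss_kernel DIM('a) (norm (x - y)))" for x y
  proof -
    have "(\<integral>\<^sup>+t. indicator {0<..} t * ?h t x y \<partial>lborel) = (\<integral>\<^sup>+t. ennreal (loss_kernel DIM('a) (norm (x - y))) * indicator {f y..<f x} t \<partial>lborel)"
    \<comment> \<open>If \<open>f y = 0 < f x\<close>, the two indicators disagree at the point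
      \<open>t = 0\<close>.\<close>
    proof (rule nn_integral_cong_AE)
      have "AE t in lborel. t \<noteq> (0::real)" by (rule AE_lborel_singleton)
      then show "AE t in lborel. indicator {0<..} t * ?h t x y = ennreal (loss_kernel DIM('a) (norm (x - y))) * indicator {f y..<f x} t"
        by eventually_elim (use f0[of y] in \<open>auto simp: indicator_def\<close>)
    qed
    also have "\<dots> = ennreal (loss_kernel DIM('a) (norm (x - y))) * ennreal (f x - f y)"
    proof -
      have "emeasure lborel {f y..<f x} = ennreal (f x - f y)"
        by (cases "f y \<le> f x") (auto simp: ennreal_neg)
      then show ?thesis by (subst nn_integral_cmult_indicator) auto
    qed
    finally show ?thesis unfolding ennreal_mult''[OF kernels_nonneg(2)] by (subst (2) mult.commute)
  qed
  show "loss f = (\<integral>\<^sup>+t. indicator {0<..} t * boundary_energy (loss_kernel DIM('a)) {x. t < f x} \<partial>lborel)"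
    unfolding loss_def boundary_energy_def by (rule nn_integral_layers(1)[OF m v, symmetric])
  show "(\<lambda>t. boundary_energy (loss_kernel DIM('a)) {x. t < f x}) \<in> borel_measurable borel"
    unfolding boundary_energy_def by (rule nn_integral_layers(2)[OF m v])
qed

lemma energy_cong_AE:
  assumes "AE x in lborel. x \<in> A \<longleftrightarrow> x \<in> B"
  shows "energy k (indicator A) = energy k (indicator B)" "boundary_energy k A = boundary_energy k B"
proof -
  have 1: "AE x in lborel. indicator A x = (indicator B x :: real)" using assms by eventually_elim (auto simp: indicator_def)
  have 2: "AE x in lborel. indicator (- A) x = (indicator (- B) x :: real)" using assms by eventually_elim (auto simp: indicator_def)
  have i1: "(\<integral>\<^sup>+y. ennreal (indicator A x * indicator A y * k (norm (x - y))) \<partial>lborel) = (\<integral>\<^sup>+y. ennreal (indicator B x * indicator B y * k (norm (x - y))) \<partial>lborel)"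
    if "indicator A x = (indicator B x :: real)" for x
    using 1 that by (intro nn_integral_cong_AE) (auto elim!: eventually_mono)
  show "energy k (indicator A) = energy k (indicator B)"
    unfolding energy_def using 1 by (intro nn_integral_cong_AE) (auto elim!: eventually_mono intro: i1)
  have i2: "(\<integral>\<^sup>+y. ennreal (indicator A x * indicator (- A) y * k (norm (x - y))) \<partial>lborel) = (\<integral>\<^sup>+y. ennreal (indicator B x * indicator (- B) y * k (norm (x - y))) \<partial>lborel)"
    if "indicator A x = (indicator B x :: real)" for x
    using 2 that by (intro nn_integral_cong_AE) (auto elim!: eventually_mono)
  show "boundary_energy k A = boundary_energy k B"
    unfolding boundary_energy_def using 1 by (intro nn_integral_cong_AE) (auto elim!: eventually_mono intro: i2)
qed

lemma energy_empty: "energy k (indicator {} :: 'a::euclidean_space \<Rightarrow> real) = 0" "boundary_energy k ({} :: 'a set) = 0"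
  by (simp_all add: energy_def boundary_energy_def)

text \<open>Conditioning reduces entropy: integrate \<open>ln (m f) \<le> m f - 1\<close> over \<open>E\<close>.\<close>
lemma entropy_level_set:
  fixes f :: "'b \<Rightarrow> real"
  assumes f: "integrable M f" "\<And>x. 0 \<le> f x" "(LINT x|M. f x) = 1"
    and E: "E \<in> sets M" "emeasure M E = ennreal m" "0 < m" and pos: "\<And>x. x \<in> E \<Longrightarrow> 0 < f x"
    and int: "integrable M (\<lambda>x. indicator E x * ln (f x))"
  shows "m * ln m \<le> - (LINT x|M. indicator E x * ln (f x))"
    and "m * ln m = - (LINT x|M. indicator E x * ln (f x)) \<Longrightarrow> AE x in M. f x = indicator E x / m"
proof -
  \<comment> \<open>On \<open>E\<close> this is \<open>m * f x - 1 - ln (m * f x)\<close>, and off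
    \<open>E\<close> it is \<open>m * f x\<close>. Both are nonnegative, vanishing exactly for
    \<open>m * f x = 1\<close> and \<open>f x = 0\<close> respectively, and the integral of
    \<open>D\<close> is the slack in the inequality.\<close>
  define D where "D x = m * f x - (1 + ln m) * indicator E x - indicator E x * ln (f x)" for x
  have iE: "integrable M (indicator E :: 'b \<Rightarrow> real)" "(LINT x|M. indicator E x) = m"
    using E by (auto simp: measure_def)
  have D: "integrable M D" "(LINT x|M. D x) = - (m * ln m) - (LINT x|M. indicator E x * ln (f x))"
    unfolding D_def using f iE int by (auto simp: algebra_simps)
  have D0: "0 \<le> D x" for x
  proof (cases "x \<in> E")
    case True
    have "ln (m * f x) \<le> m * f x - 1" using E pos[OF True] by (intro ln_le_minus_one) auto
    then show ?thesis using True E pos[OF True] by (simp add: D_def ln_mult)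
  qed (use f E in \<open>simp add: D_def\<close>)
  have "0 \<le> (LINT x|M. D x)" using D0 by (intro integral_nonneg_AE) auto
  then show "m * ln m \<le> - (LINT x|M. indicator E x * ln (f x))" using D by simp
  assume "m * ln m = - (LINT x|M. indicator E x * ln (f x))"
  then have "(LINT x|M. D x) = 0" using D by simp
  then have "AE x in M. D x = 0" using integral_nonneg_eq_0_iff_AE[OF D(1)] D0 by simp
  then show "AE x in M. f x = indicator E x / m"
  proof eventually_elim
    case (elim x)
    show ?case
    proof (cases "x \<in> E")
      case True
      then have "ln (m * f x) = m * f x - 1" using elim E pos[OF True] by (simp add: D_def ln_mult)
      then have "m * f x = 1" using E pos[OF True] by (intro ln_eq_minus_one) auto
      then show ?thesis using True E by (simp add: field_simps)
    qed (use elim E in \<open>simp add: D_def\<close>)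
  qed
qed

section \<open>Integration over the levels\<close>

lemma nn_integral_enn2real:
  assumes [measurable]: "F \<in> borel_measurable M" and fin: "(\<integral>\<^sup>+x. F x \<partial>M) < \<infinity>"
  shows "integrable M (\<lambda>x. enn2real (F x))" and "(\<integral>\<^sup>+x. F x \<partial>M) = ennreal (LINT x|M. enn2real (F x))"
    and "AE x in M. F x < \<infinity>"
proof -
  show ae: "AE x in M. F x < \<infinity>" using nn_integral_PInf_AE[OF assms(1)] fin by (auto simp: less_top)
  have eq: "(\<integral>\<^sup>+x. ennreal (enn2real (F x)) \<partial>M) = (\<integral>\<^sup>+x. F x \<partial>M)"
    using ae by (intro nn_integral_cong_AE) (auto elim!: eventually_mono simp: less_top)
  then show int: "integrable M (\<lambda>x. enn2real (F x))"
    using fin by (intro integrableI_nonneg) auto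
  show "(\<integral>\<^sup>+x. F x \<partial>M) = ennreal (LINT x|M. enn2real (F x))"
    unfolding eq[symmetric] by (rule nn_integral_eq_integral[OF int]) auto
qed

lemma level_measure_finite:
  fixes f :: "'a::euclidean_space \<Rightarrow> real"
  assumes f: "integrable lborel f" "\<And>x. 0 \<le> f x" and t: "0 < t"
  shows "emeasure lborel {x. t < f x} < \<infinity>"
proof -
  have [measurable]: "f \<in> borel_measurable borel" using f by (simp add: borel_measurable_integrable measurable_lborel1)
  have [measurable]: "{x. t < f x} \<in> sets borel" by measurable
  have "ennreal t * emeasure lborel {x. t < f x} = (\<integral>\<^sup>+x. ennreal t * indicator {x. t < f x} x \<partial>lborel)"
    by (subst nn_integral_cmult_indicator) auto
  also have "\<dots> \<le> (\<integral>\<^sup>+x. ennreal (f x) \<partial>lborel)"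
    by (intro nn_integral_mono) (auto simp: indicator_def intro!: ennreal_leI)
  also have "\<dots> < \<infinity>" using f by (simp add: nn_integral_eq_integral)
  finally show ?thesis using t by (auto simp: ennreal_mult_less_top)
qed

text \<open>Fubini on the region below the graph: for fixed \<open>x\<close> the levels fill an
  interval of length \<open>f x\<close>, which restores the weight \<open>f x\<close> in front of
  the logarithm. The last claim makes \<open>ln (f x)\<close> integrable over almost every level
  set, although it need not be integrable on the support of \<open>f\<close>.\<close>

lemma level_integrals:
  fixes f :: "'a::euclidean_space \<Rightarrow> real" and a b :: real
  assumes f: "integrable lborel f" "\<And>x. 0 \<le> f x" "(LINT x|lborel. f x) = 1"
    and ent: "integrable lborel (\<lambda>x. f x * ln (f x))"
  defines "G \<equiv> \<lambda>t. LINT x|lborel. (if 0 < t \<and> t < f x then a - b * ln (f x) else 0)"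
  shows "integrable lborel G" "(LINT t|lborel. G t) = a - b * (LINT x|lborel. f x * ln (f x))"
    "AE t in lborel. integrable lborel (\<lambda>x. (if 0 < t \<and> t < f x then a - b * ln (f x) else 0))"
proof -
  have [measurable]: "f \<in> borel_measurable borel" using f by (simp add: borel_measurable_integrable measurable_lborel1)
  let ?F = "\<lambda>x t. (if 0 < t \<and> t < f x then a - b * ln (f x) else (0::real))"
  have F: "?F x = (\<lambda>t. (a - b * ln (f x)) * indicator {0<..<f x} t)" for x by (auto simp: indicator_def fun_eq_iff)
  have sec: "integrable lborel (?F x)" for x
    unfolding F using f(2)[of x] by (intro integrable_mult_right) auto
  have i: "(LINT t|lborel. ?F x t) = a * f x - b * (f x * ln (f x))" for x
    unfolding F using f(2)[of x] by (simp add: algebra_simps)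
  have "norm (?F x t) = \<bar>a - b * ln (f x)\<bar> * indicator {0<..<f x} t" for x t by (auto simp: indicator_def)
  then have n: "(LINT t|lborel. norm (?F x t)) = \<bar>a * f x - b * (f x * ln (f x))\<bar>" for x
  proof -
    have "(LINT t|lborel. norm (?F x t)) = \<bar>a - b * ln (f x)\<bar> * \<bar>f x\<bar>"
      using f(2)[of x] by (simp only: \<open>\<And>x t. norm (?F x t) = \<bar>a - b * ln (f x)\<bar> * indicator {0<..<f x} t\<close>) simp
    also have "\<dots> = \<bar>(a - b * ln (f x)) * f x\<bar>" by (rule abs_mult[symmetric])
    also have "(a - b * ln (f x)) * f x = a * f x - b * (f x * ln (f x))" by (simp add: algebra_simps)
    finally show ?thesis .
  qed
  have int: "integrable (lborel \<Otimes>\<^sub>M lborel) (case_prod ?F)"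
  proof (rule lborel_pair.Fubini_integrable)
    show "case_prod ?F \<in> borel_measurable (lborel \<Otimes>\<^sub>M lborel)" by measurable
    show "integrable lborel (\<lambda>x. LINT t|lborel. norm (case_prod ?F (x, t)))"
      unfolding split n using f(1) ent by (intro integrable_abs integrable_diff integrable_mult_right) auto
    show "AE x in lborel. integrable lborel (\<lambda>t. case_prod ?F (x, t))" using sec by simp
  qed
  show "integrable lborel G" unfolding G_def by (rule lborel_pair.integrable_snd[OF int])
  show "(LINT t|lborel. G t) = a - b * (LINT x|lborel. f x * ln (f x))"
    unfolding G_def lborel_pair.Fubini_integral[OF int] i using f ent by simp
  show "AE t in lborel. integrable lborel (\<lambda>x. ?F x t)" by (rule lborel_pair.AE_integrable_snd[OF int])
qed

text \<open>Let \<open>p t\<close>, \<open>q t\<close> and \<open>G t\<close> be the contributions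
  of level \<open>t\<close> to the gain, the loss and \<open>S\<close>. A level set of measure
  \<open>m > 0\<close> satisfies \<open>p t - q t \<le> m * (sigma0 n + unit_ball_vol n * ln m)
  \<le> G t\<close>, by rearrangement and by entropy. Total equality means equality at almost every
  level, and one such level with positive measure already determines \<open>f\<close>.\<close>

lemma gain_minus_loss:
  fixes f :: "'a::euclidean_space \<Rightarrow> real"
  assumes f: "integrable lborel f" and f0: "\<And>x. 0 \<le> f x" and f1: "(LINT x|lborel. f x) = 1"
    and ent: "integrable lborel (\<lambda>x. f x * ln (f x))" and lf: "loss f < \<infinity>"
  defines "S \<equiv> sigma0 DIM('a) - unit_ball_vol DIM('a) * (LINT x|lborel. f x * ln (f x))"
  shows "gain f < \<infinity>" and "enn2real (gain f) - enn2real (loss f) \<le> S"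
    and "enn2real (gain f) - enn2real (loss f) = S \<longleftrightarrow>
      (\<exists>c z r. 0 < r \<and> (AE x in lborel. f x = c * indicator (ball z r) x))"
proof -
  let ?n = "DIM('a)" and ?w = "unit_ball_vol (real DIM('a))" and ?\<sigma> = "sigma0 DIM('a)"
  have fm [measurable]: "f \<in> borel_measurable borel" using f by (simp add: borel_measurable_integrable measurable_lborel1)
  have w: "0 < ?w" by (rule unit_ball_vol_pos) simp
  define L where "L t = {x. t < f x}" for t
  have L [measurable]: "L t \<in> sets borel" for t unfolding L_def by measurable
  have Lfin: "emeasure lborel (L t) < \<infinity>" if "0 < t" for t
    unfolding L_def by (rule level_measure_finite[OF f f0 that])
  define P where "P t = indicator {0<..} t * energy (gain_kernel ?n) (indicator (L t) :: 'a \<Rightarrow> real)" for t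
  define N where "N t = indicator {0<..} t * boundary_energy (loss_kernel ?n) (L t)" for t
  have [measurable]: "P \<in> borel_measurable borel" "N \<in> borel_measurable borel"
    using gain_layer_cake(2)[OF fm f0] loss_layer_cake(2)[OF fm f0] unfolding P_def[abs_def] N_def[abs_def] L_def by measurable
  have gP: "gain f = (\<integral>\<^sup>+t. P t \<partial>lborel)" unfolding P_def L_def by (rule gain_layer_cake(1)[OF fm f0])
  have lN: "loss f = (\<integral>\<^sup>+t. N t \<partial>lborel)" unfolding N_def L_def by (rule loss_layer_cake(1)[OF fm f0])
  define p where "p t = enn2real (P t)" for t
  define q where "q t = enn2real (N t)" for t
  have q: "integrable lborel q" "loss f = ennreal (LINT t|lborel. q t)" "AE t in lborel. N t < \<infinity>"
    unfolding q_def using nn_integral_enn2real[of N lborel] lf unfolding lN by auto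
  define H where "H t x = (if 0 < t \<and> t < f x then ?\<sigma> - ?w * ln (f x) else 0)" for t x
  define G where "G t = (LINT x|lborel. H t x)" for t
  have G: "integrable lborel G" "(LINT t|lborel. G t) = S" "AE t in lborel. integrable lborel (H t)"
    using level_integrals[OF f f0 f1 ent, of ?\<sigma> ?w] unfolding G_def[abs_def] H_def[abs_def] S_def by auto
  have level: "integrable lborel (\<lambda>x. indicator (L t) x * ln (f x))"
      "G t = ?\<sigma> * m - ?w * (LINT x|lborel. indicator (L t) x * ln (f x))"
    if t: "0 < t" and H: "integrable lborel (H t)" and m: "emeasure lborel (L t) = ennreal m" "0 \<le> m" for t m
  proof -
    have iE: "integrable lborel (indicator (L t) :: 'a \<Rightarrow> real)" "(LINT x|lborel. indicator (L t) x) = m"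
      using m by (auto simp: measure_def)
    have Ht: "H t = (\<lambda>x. ?\<sigma> * indicator (L t) x - ?w * (indicator (L t) x * ln (f x)))"
      using t by (auto simp: H_def L_def indicator_def fun_eq_iff)
    have eq: "indicator (L t) x * ln (f x) = (?\<sigma> * indicator (L t) x - H t x) / ?w" for x
    proof -
      have "(?\<sigma> * indicator (L t) x - H t x) / ?w = ?w * (indicator (L t) x * ln (f x)) / ?w" by (simp add: Ht)
      also have "\<dots> = indicator (L t) x * ln (f x)"
        by (rule nonzero_mult_div_cancel_left[OF less_imp_neq[OF w, symmetric]])
      finally show ?thesis ..
    qed
    show int: "integrable lborel (\<lambda>x. indicator (L t) x * ln (f x))"
      unfolding eq using iE H by (intro integrable_divide integrable_diff integrable_mult_right) auto
    from Ht show "G t = ?\<sigma> * m - ?w * (LINT x|lborel. indicator (L t) x * ln (f x))"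
      unfolding G_def using iE int by simp
  qed
  have bound: "p t \<le> q t + G t \<and> P t < \<infinity>" and
    eq_case: "p t - q t = G t \<Longrightarrow> 0 < t \<Longrightarrow> emeasure lborel (L t) \<noteq> 0 \<Longrightarrow>
      (\<exists>c z r. 0 < r \<and> (AE x in lborel. f x = c * indicator (ball z r) x))"
    if H: "integrable lborel (H t)" and Nt: "N t < \<infinity>" for t
  proof -
    show "p t \<le> q t + G t \<and> P t < \<infinity>"
    proof (cases "0 < t")
      case False
      then show ?thesis by (simp add: p_def q_def P_def N_def G_def H_def)
    next
      case t: True
      obtain m where m: "emeasure lborel (L t) = ennreal m" "0 \<le> m" using Lfin[OF t] by (cases "emeasure lborel (L t)") auto
      show ?thesis
      proof (cases "m = 0")
        case True
        then have "AE x in lborel. x \<notin> L t" using m by (subst AE_iff_measurable[OF _ refl]) auto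
        then have AE: "AE x in lborel. x \<in> L t \<longleftrightarrow> x \<in> {}" by simp
        have "P t = 0" "N t = 0" unfolding P_def N_def energy_cong_AE[OF AE] energy_empty by simp_all
        moreover have "G t = 0"
        proof -
          have "AE x in lborel. H t x = 0" using \<open>AE x in lborel. x \<notin> L t\<close> by eventually_elim (auto simp: H_def L_def)
          then show ?thesis unfolding G_def by (rule integral_eq_zero_AE)
        qed
        ultimately show ?thesis by (simp add: p_def q_def)
      next
        case False
        then have m0: "0 < m" using m by simp
        have bfin: "boundary_energy (loss_kernel ?n) (L t) < \<infinity>" using Nt t by (simp add: N_def)
        have pq: "p t - q t \<le> m * (?\<sigma> + ?w * ln m)"
          using set_gain_minus_loss(2)[OF L m(1) m0 bfin] t by (simp add: p_def q_def P_def N_def)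
        have "m * ln m \<le> - (LINT x|lborel. indicator (L t) x * ln (f x))"
          using level(1)[OF t H m] m m0 t
          by (intro entropy_level_set(1)[OF f f0 f1]) (auto simp: L_def)
        then have "?w * (m * ln m) \<le> ?w * - (LINT x|lborel. indicator (L t) x * ln (f x))" using w by (intro mult_left_mono) auto
        then have "p t - q t \<le> G t" using pq unfolding level(2)[OF t H m] by (simp add: algebra_simps)
        moreover have "P t < \<infinity>" using set_gain_minus_loss(1)[OF L m(1) m0 bfin] t by (simp add: P_def)
        ultimately show ?thesis by simp
      qed
    qed
    assume eq: "p t - q t = G t" and t: "0 < t" and "emeasure lborel (L t) \<noteq> 0"
    then obtain m where m: "emeasure lborel (L t) = ennreal m" "0 \<le> m" "0 < m" using Lfin[OF t]
      by (cases "emeasure lborel (L t)") (auto simp: less_le)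
    have bfin: "boundary_energy (loss_kernel ?n) (L t) < \<infinity>" using Nt t by (simp add: N_def)
    have pq: "p t - q t \<le> m * (?\<sigma> + ?w * ln m)"
      using set_gain_minus_loss(2)[OF L m(1) m(3) bfin] t by (simp add: p_def q_def P_def N_def)
    let ?I = "LINT x|lborel. indicator (L t) x * ln (f x)"
    have le: "m * ln m \<le> - ?I"
      using level(1)[OF t H m(1,2)] m t by (intro entropy_level_set(1)[OF f f0 f1]) (auto simp: L_def)
    \<comment> \<open>Equality at this level closes the gap between the ends of the chain, hence
      forces equality in the entropy bound and then in the rearrangement bound.\<close>
    have "?\<sigma> * m - ?w * ?I \<le> m * (?\<sigma> + ?w * ln m)" using eq pq unfolding level(2)[OF t H m(1,2)] by simp
    then have "?w * - ?I \<le> ?w * (m * ln m)" by (simp add: algebra_simps)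
    then have "- ?I \<le> m * ln m" using w by (simp only: mult_le_cancel_left_pos)
    then have I: "m * ln m = - ?I" using le by simp
    then have AEf: "AE x in lborel. f x = indicator (L t) x / m"
      using level(1)[OF t H m(1,2)] m t by (intro entropy_level_set(2)[OF f f0 f1]) (auto simp: L_def)
    have wI: "?w * ?I = - (?w * (m * ln m))" by (simp only: I mult_minus_right minus_minus)
    have "p t - q t = ?\<sigma> * m - ?w * ?I" unfolding eq by (rule level(2)[OF t H m(1,2)])
    also have "\<dots> = ?\<sigma> * m + ?w * (m * ln m)" by (simp only: wI diff_minus_eq_add)
    also have "\<dots> = m * (?\<sigma> + ?w * ln m)" by (simp add: algebra_simps)
    finally obtain z r where r: "0 < r" "AE x in lborel. x \<in> L t \<longleftrightarrow> x \<in> ball z r"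
      using set_gain_minus_loss(3)[OF L m(1) m(3) bfin] t by (auto simp: p_def q_def P_def N_def)
    from AEf r(2) have "AE x in lborel. f x = (1 / m) * indicator (ball z r) x"
      by eventually_elim (auto simp: indicator_def)
    then show "\<exists>c z r. 0 < r \<and> (AE x in lborel. f x = c * indicator (ball z r) x)" using r by blast
  qed
  have bAE: "AE t in lborel. p t \<le> q t + G t \<and> P t < \<infinity>"
    using G(3) q(3) by eventually_elim (rule bound)
  \<comment> \<open>Finiteness of the gain comes from the level-wise inequality: \<open>p\<close>
    lies below the integrable function \<open>q + G\<close>.\<close>
  have p: "integrable lborel p"
  proof (rule Bochner_Integration.integrable_bound)
    show "integrable lborel (\<lambda>t. q t + G t)" using q G by simp
    show "p \<in> borel_measurable lborel" unfolding p_def by measurable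
    show "AE t in lborel. norm (p t) \<le> norm (q t + G t)"
      using bAE by eventually_elim (auto simp: p_def)
  qed
  have gp: "gain f = ennreal (LINT t|lborel. p t)"
  proof -
    have "gain f = (\<integral>\<^sup>+t. ennreal (p t) \<partial>lborel)" unfolding gP
    proof (rule nn_integral_cong_AE)
      from bAE show "AE t in lborel. P t = ennreal (p t)" by eventually_elim (simp add: p_def)
    qed
    also have "\<dots> = ennreal (LINT t|lborel. p t)"
      by (rule nn_integral_eq_integral[OF p]) (simp add: p_def)
    finally show ?thesis .
  qed
  then show "gain f < \<infinity>" by simp
  have p0: "0 \<le> (LINT t|lborel. p t)" "0 \<le> (LINT t|lborel. q t)" unfolding p_def q_def by simp_all
  \<comment> \<open>The slack at level \<open>t\<close>; it is nonnegative almost everywhere, and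
    its integral is the slack of the whole inequality.\<close>
  define d where "d t = q t + G t - p t" for t
  have d: "integrable lborel d" "(LINT t|lborel. d t) = S - ((LINT t|lborel. p t) - (LINT t|lborel. q t))"
    unfolding d_def using p q G by auto
  have d0: "AE t in lborel. 0 \<le> d t" using bAE by eventually_elim (simp add: d_def)
  have gl: "enn2real (gain f) - enn2real (loss f) = S - (LINT t|lborel. d t)"
    using p0 unfolding d(2) gp q(2) by simp
  show "enn2real (gain f) - enn2real (loss f) \<le> S"
    unfolding gl using integral_nonneg_AE[OF d0] by simp
  have iff: "enn2real (gain f) - enn2real (loss f) = S \<longleftrightarrow> (AE t in lborel. p t - q t = G t)"
  proof -
    have "enn2real (gain f) - enn2real (loss f) = S \<longleftrightarrow> (LINT t|lborel. d t) = 0" unfolding gl by auto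
    also have "\<dots> \<longleftrightarrow> (AE t in lborel. d t = 0)" by (rule integral_nonneg_eq_0_iff_AE[OF d(1) d0])
    also have "\<dots> \<longleftrightarrow> (AE t in lborel. p t - q t = G t)" by (intro AE_cong) (auto simp: d_def)
    finally show ?thesis .
  qed
  show "enn2real (gain f) - enn2real (loss f) = S \<longleftrightarrow> (\<exists>c z r. 0 < r \<and> (AE x in lborel. f x = c * indicator (ball z r) x))"
    unfolding iff
  proof
    assume AE: "AE t in lborel. p t - q t = G t"
    have "\<exists>t0>0. emeasure lborel (L t0) \<noteq> 0"
    proof (rule ccontr)
      assume "\<not> (\<exists>t0>0. emeasure lborel (L t0) \<noteq> 0)"
      then have "emeasure lborel (L (1 / Suc n)) = 0" for n by auto
      then have "AE x in lborel. x \<notin> L (1 / Suc n)" for n by (subst AE_iff_measurable[OF _ refl]) auto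
      then have "AE x in lborel. \<forall>n. x \<notin> L (1 / Suc n)" by (simp only: AE_all_countable) simp
      then have "AE x in lborel. f x = 0"
      proof eventually_elim
        case (elim x)
        show ?case
        proof (rule ccontr)
          assume "f x \<noteq> 0"
          then have "0 < f x" using f0[of x] by simp
          then obtain n where "inverse (real (Suc n)) < f x" using reals_Archimedean by blast
          then show False using elim by (auto simp: L_def inverse_eq_divide)
        qed
      qed
      then have "(LINT x|lborel. f x) = 0" by (rule integral_eq_zero_AE)
      then show False using f1 by simp
    qed
    then obtain t0 where t0: "0 < t0" "emeasure lborel (L t0) \<noteq> 0" by blast
    \<comment> \<open>The almost-everywhere statements hold together at some level below
      \<open>t0\<close>. Level sets grow as the level drops, so this one still has positive
      measure.\<close>
    have "\<exists>t. t \<in> {0<..<t0} \<and> p t - q t = G t \<and> integrable lborel (H t) \<and> N t < \<infinity>"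
    proof (rule ccontr)
      assume no: "\<not> ?thesis"
      from AE G(3) q(3) have "AE t in lborel. t \<notin> {0<..<t0}" by eventually_elim (use no in blast)
      then have "{0<..<t0} = {}" by (intro open_AE_not_in_imp_empty) auto
      then show False using t0 by simp
    qed
    then obtain t where t: "0 < t" "t < t0" "p t - q t = G t" "integrable lborel (H t)" "N t < \<infinity>" by auto
    have "emeasure lborel (L t0) \<le> emeasure lborel (L t)" using t by (intro emeasure_mono) (auto simp: L_def)
    then have "emeasure lborel (L t) \<noteq> 0" using t0 by auto
    then show "\<exists>c z r. 0 < r \<and> (AE x in lborel. f x = c * indicator (ball z r) x)"
      using eq_case[OF t(4,5,3,1)] by blast
  next
    assume "\<exists>c z r. 0 < r \<and> (AE x in lborel. f x = c * indicator (ball z r) x)"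
    then obtain c z r where r: "0 < r" and fc: "AE x in lborel. f x = c * indicator (ball z r) x" by blast
    define m where "m = ?w * r ^ ?n"
    have m0: "0 < m" using r w by (simp add: m_def)
    have mB: "emeasure lborel (ball z r) = ennreal m" using r by (simp add: emeasure_ball m_def)
    have iB: "integrable lborel (indicator (ball z r) :: 'a \<Rightarrow> real)" "(LINT x|lborel. indicator (ball z r) x) = m"
      using mB m0 by (auto simp: measure_def)
    have "1 = (LINT x|lborel. c * indicator (ball z r) x)"
      unfolding f1[symmetric] using fc iB(1) by (intro integral_cong_AE) auto
    then have cm: "c * m = 1" using iB by simp
    then have c: "0 < c" using m0 by (metis zero_less_mult_pos2 zero_less_one)
    obtain P0 N0 where PN: "0 \<le> P0" "0 \<le> N0" "energy (gain_kernel ?n) (indicator (ball (0::'a) r)) = ennreal P0"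
      "boundary_energy (loss_kernel ?n) (ball (0::'a) r) = ennreal N0" "P0 - N0 = m * (?\<sigma> + ?w * ln m)"
      using ball_gain_minus_loss[OF r, where ?'a='a] unfolding m_def by blast
    \<comment> \<open>The level set is the ball for \<open>t\<close> below \<open>c\<close> and null
      from \<open>c\<close> on. Normalization gives \<open>c = 1 / m\<close>, so that
      \<open>- ln c\<close> is \<open>ln m\<close>.\<close>
    have "p t - q t = G t" if H: "integrable lborel (H t)" for t
    proof (cases "0 < t \<and> t < c")
      case True
      from fc have AE: "AE x in lborel. x \<in> L t \<longleftrightarrow> x \<in> ball z r"
        by eventually_elim (use True in \<open>auto simp: L_def indicator_def split: if_splits\<close>)
      have "energy (gain_kernel ?n) (indicator (L t)) = ennreal P0" "boundary_energy (loss_kernel ?n) (L t) = ennreal N0"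
        unfolding energy_cong_AE[OF AE] PN(3,4)[symmetric]
        by (rule energy_boundary_translate; simp add: kernels_nonneg)+
      then have pq: "p t - q t = m * (?\<sigma> + ?w * ln m)"
        using True PN by (simp add: p_def q_def P_def N_def)
      have "G t = (LINT x|lborel. (?\<sigma> - ?w * ln c) * indicator (ball z r) x)"
        unfolding G_def
      proof (rule integral_cong_AE)
        show "H t \<in> borel_measurable lborel" using H by simp
        show "(\<lambda>x. (?\<sigma> - ?w * ln c) * indicator (ball z r) x) \<in> borel_measurable lborel"
          using borel_measurable_integrable[OF iB(1)] by (rule borel_measurable_times[OF borel_measurable_const])
        from fc show "AE x in lborel. H t x = (?\<sigma> - ?w * ln c) * indicator (ball z r) x"
          by eventually_elim (use True in \<open>auto simp: H_def indicator_def\<close>)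
      qed
      also have "\<dots> = (?\<sigma> - ?w * ln c) * m" using iB by simp
      also have "c = 1 / m" using cm m0 by (simp add: field_simps)
      finally show ?thesis using m0 unfolding pq by (simp add: ln_div algebra_simps)
    next
      case False
      show ?thesis
      proof (cases "0 < t")
        case True
        from fc have nL: "AE x in lborel. x \<notin> L t"
          by eventually_elim (use False True in \<open>auto simp: L_def indicator_def split: if_splits\<close>)
        then have AE: "AE x in lborel. x \<in> L t \<longleftrightarrow> x \<in> {}" by simp
        have "P t = 0" "N t = 0" unfolding P_def N_def energy_cong_AE[OF AE] energy_empty by simp_all
        moreover have "AE x in lborel. H t x = 0" using nL by eventually_elim (auto simp: H_def L_def)
        then have "G t = 0" unfolding G_def by (rule integral_eq_zero_AE)
        ultimately show ?thesis by (simp add: p_def q_def)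
      next
        case False
        then show ?thesis by (simp add: p_def q_def P_def N_def G_def H_def)
      qed
    qed
    with G(3) show "AE t in lborel. p t - q t = G t" by (auto elim!: eventually_mono)
  qed
qed

section \<open>The inequality for admissible functions\<close>

lemma min_integrand_eq:
  fixes g :: "'a::euclidean_space \<Rightarrow> real"
  shows "min_integrand g (x, y) = min (g x) (g y) * gain_kernel DIM('a) (norm (x - y)) - max 0 (g x - g y) * loss_kernel DIM('a) (norm (x - y))"
\<comment> \<open>On the diagonal the left side is a division by 0, hence 0, and both kernels vanish
  at 0.\<close>
proof (cases "x = y")
  case True
  then show ?thesis by (simp add: min_integrand_def gain_kernel_def loss_kernel_def)
next
  case False
  have mm: "max 0 (g x - g y) = g x - min (g x) (g y)" by (simp add: min_def)
  show ?thesis using False unfolding mm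
    by (simp add: min_integrand_def gain_kernel_def loss_kernel_def diff_divide_distrib[symmetric] algebra_simps)
qed

text \<open>For the two nonnegative terms \<open>?A\<close> and \<open>?B\<close>, the positive part
  of their difference plus \<open>?B\<close> equals the negative part plus \<open>?A\<close>.
  Integrating this sum identity and then using finiteness permits subtraction.\<close>

lemma ext_integral_min_integrand:
  fixes g :: "'a::euclidean_space \<Rightarrow> real"
  assumes [measurable]: "g \<in> borel_measurable borel" and g0: "\<And>x. 0 \<le> g x" and gfin: "gain g < \<infinity>" and lfin: "loss g < \<infinity>"
  shows "(\<integral>\<^sup>+z. ennreal (- min_integrand g z) \<partial>lebesgue) < \<infinity>"
    and "ext_integral lebesgue (min_integrand g) = ereal (enn2real (gain g) - enn2real (loss g))"
proof -
  let ?A = "\<lambda>x y. min (g x) (g y) * gain_kernel DIM('a) (norm (x - y))"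
  let ?B = "\<lambda>x y. max 0 (g x - g y) * loss_kernel DIM('a) (norm (x - y))"
  have A0: "0 \<le> ?A x y" and B0: "0 \<le> ?B x y" for x y
    using g0 by (auto intro!: mult_nonneg_nonneg kernels_nonneg)
  have eB: "ennreal (?B x y) = ennreal ((g x - g y) * loss_kernel DIM('a) (norm (x - y)))" for x y
    by (cases "g y \<le> g x") (auto simp: max_def ennreal_neg mult_nonpos_nonneg kernels_nonneg)
  define pos where "pos = (\<integral>\<^sup>+z. ennreal (min_integrand g z) \<partial>lebesgue)"
  define neg where "neg = (\<integral>\<^sup>+z. ennreal (- min_integrand g z) \<partial>lebesgue)"
  have pos: "pos = (\<integral>\<^sup>+x. \<integral>\<^sup>+y. ennreal (?A x y - ?B x y) \<partial>lborel \<partial>lborel)"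
    unfolding pos_def nn_integral_completion
    by (subst nn_integral_pair_lborel) (auto simp: min_integrand_eq intro!: nn_integral_cong)
  have neg: "neg = (\<integral>\<^sup>+x. \<integral>\<^sup>+y. ennreal (?B x y - ?A x y) \<partial>lborel \<partial>lborel)"
    unfolding neg_def nn_integral_completion
    by (subst nn_integral_pair_lborel) (auto simp: min_integrand_eq intro!: nn_integral_cong)
  have pw: "ennreal (?A x y - ?B x y) + ennreal (?B x y) = ennreal (?B x y - ?A x y) + ennreal (?A x y)" for x y
    using A0[of x y] B0[of x y] by (cases "?A x y \<le> ?B x y") (auto simp: ennreal_neg ennreal_plus[symmetric] simp del: ennreal_plus)
  have bal: "pos + loss g = neg + gain g"
  proof -
    have "pos + loss g = (\<integral>\<^sup>+x. \<integral>\<^sup>+y. ennreal (?A x y - ?B x y) + ennreal (?B x y) \<partial>lborel \<partial>lborel)"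
      unfolding pos loss_def eB[symmetric] by (subst nn_integral_add[symmetric], measurable)+
    also have "\<dots> = neg + gain g"
      unfolding pw neg gain_def by (subst nn_integral_add, measurable)+
    finally show ?thesis .
  qed
  have "neg \<le> loss g" unfolding neg loss_def eB[symmetric]
    using A0 by (intro nn_integral_mono ennreal_leI) simp
  then have nfin: "neg < \<infinity>" using lfin by (rule le_less_trans)
  then show "(\<integral>\<^sup>+z. ennreal (- min_integrand g z) \<partial>lebesgue) < \<infinity>" by (simp add: neg_def)
  have "pos \<le> pos + loss g" by simp
  also have "\<dots> < \<infinity>" unfolding bal using nfin gfin by simp
  finally have pfin: "pos < \<infinity>" .
  obtain P N G L where r: "pos = ennreal P" "neg = ennreal N" "gain g = ennreal G" "loss g = ennreal L" "0 \<le> P" "0 \<le> N" "0 \<le> G" "0 \<le> L"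
    using pfin nfin gfin lfin by (cases pos; cases neg; cases "gain g"; cases "loss g") auto
  have "P + L = N + G" using bal r by (simp add: ennreal_plus[symmetric] del: ennreal_plus)
  then show "ext_integral lebesgue (min_integrand g) = ereal (enn2real (gain g) - enn2real (loss g))"
    unfolding ext_integral_def pos_def[symmetric] neg_def[symmetric] using r by simp
qed

lemma AE_pair_lborel:
  fixes P :: "'a::euclidean_space \<Rightarrow> bool"
  assumes "AE x in lborel. P x"
  shows "AE (x, y) in lborel. P x \<and> P y"
proof -
  obtain N where N: "{x. \<not> P x} \<subseteq> N" "emeasure lborel N = 0" "N \<in> sets lborel"
    using assms by (auto elim: AE_E)
  have [measurable]: "N \<in> sets borel" using N by simp
  have "AE x in lborel. x \<notin> N" using N by (intro AE_not_in) auto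
  then have "AE x in lborel. AE y in lborel. x \<notin> N \<and> y \<notin> N"
    by (auto elim!: eventually_mono)
  then have "AE z in lborel \<Otimes>\<^sub>M lborel. fst z \<notin> N \<and> snd z \<notin> N"
  proof (intro lborel_pair.AE_pair_measure)
    show "{z \<in> space (lborel \<Otimes>\<^sub>M lborel). fst z \<notin> N \<and> snd z \<notin> N} \<in> sets (lborel \<Otimes>\<^sub>M lborel)" by measurable
  qed simp
  then have "AE z in (lborel :: ('a \<times> 'a) measure). fst z \<notin> N \<and> snd z \<notin> N" by (simp only: lborel_prod)
  then show ?thesis by eventually_elim (use N in auto)
qed

text \<open>This places \<open>loss_kernel\<close> below the kernel of the fractional Sobolev
  seminorm.\<close>

lemma powr_le_exp:
  fixes r \<beta> :: real
  assumes "0 < r" "0 < \<beta>" "\<beta> < 1"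
  shows "r powr \<beta> \<le> exp r"
proof -
  have "\<beta> * ln r \<le> r"
  proof (cases "0 \<le> ln r")
    case True
    then have "\<beta> * ln r \<le> 1 * ln r" using assms by (intro mult_right_mono) auto
    also have "\<dots> \<le> r" using ln_le_minus_one[OF assms(1)] by simp
    finally show ?thesis .
  next
    case False
    then have "\<beta> * ln r \<le> 0" using assms by (intro mult_nonneg_nonpos) auto
    then show ?thesis using assms by simp
  qed
  then show ?thesis using assms by (simp add: powr_def)
qed

text \<open>The layer-cake results are stated for Borel functions that are nonnegative everywhere,
  while admissible functions are Lebesgue measurable and nonnegative almost everywhere. The Sobolev
  condition is turned into finiteness of \<open>loss\<close>.\<close>

lemma admissible_borel_representative:
  fixes f :: "'a::euclidean_space \<Rightarrow> real"
  assumes \<beta>: "0 < \<beta>" "\<beta> < 1" and f: "f \<in> admissible \<beta>"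
  obtains g where "AE x in lborel. f x = g x" "\<And>x. 0 \<le> g x" "integrable lborel g" "(LINT x|lborel. g x) = 1"
    "integrable lborel (\<lambda>x. g x * ln (g x))" "(LINT x|lborel. g x * ln (g x)) = (LINT x|lebesgue. f x * ln (f x))" "loss g < \<infinity>"
proof -
  have fi: "integrable lebesgue f" and
    fr: "(\<integral>\<^sup>+ (x, y). ennreal (\<bar>f x - f y\<bar> / norm (x - y) powr (real DIM('a) + \<beta>)) \<partial>(lebesgue :: ('a \<times> 'a) measure)) < \<infinity>" and
    f0: "AE x in lebesgue. 0 \<le> f x" and f1: "(LINT x|lebesgue. \<bar>f x\<bar>) = 1" and ent: "integrable lebesgue (\<lambda>x. f x * ln (f x))"
    using f by (auto simp: admissible_def frac_sobolev_1_def)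
  have fm [measurable]: "f \<in> borel_measurable lebesgue" using fi by (rule borel_measurable_integrable)
  obtain g' where g' [measurable]: "g' \<in> borel_measurable lborel" "AE x in lborel. f x = g' x"
    using completion_ex_borel_measurable_real[OF fm] by auto
  define g where "g x = max 0 (g' x)" for x
  have gm [measurable]: "g \<in> borel_measurable lborel" unfolding g_def by measurable
  have fg: "AE x in lborel. f x = g x"
    using g'(2) f0[unfolded AE_completion_iff] by eventually_elim (auto simp: g_def)
  then have fg': "AE x in lebesgue. f x = g x" by (simp add: AE_completion_iff)
  have g0: "0 \<le> g x" for x by (simp add: g_def)
  have gml: "g \<in> borel_measurable lebesgue" using gm by (rule measurable_completion)
  have 1: "integrable lborel g"
  proof -
    have "integrable lebesgue g" using fi fg' gml by (subst integrable_cong_AE[of g lebesgue f]) (auto elim!: eventually_mono)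
    then show ?thesis using gm by (simp add: integrable_completion)
  qed
  have 2: "(LINT x|lborel. g x) = 1"
  proof -
    have "(LINT x|lborel. g x) = (LINT x|lebesgue. g x)" using gm by (simp add: integral_completion)
    also have "\<dots> = (LINT x|lebesgue. \<bar>f x\<bar>)"
    proof (rule integral_cong_AE)
      from fg' show "AE x in lebesgue. g x = \<bar>f x\<bar>" by eventually_elim (use g0 in auto)
    qed (use gml in auto)
    finally show ?thesis using f1 by simp
  qed
  have em: "(\<lambda>x. g x * ln (g x)) \<in> borel_measurable lborel" by measurable
  then have eml: "(\<lambda>x. g x * ln (g x)) \<in> borel_measurable lebesgue" by (rule measurable_completion)
  have efm: "(\<lambda>x. f x * ln (f x)) \<in> borel_measurable lebesgue" using ent by (rule borel_measurable_integrable)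
  have eAE: "AE x in lebesgue. g x * ln (g x) = f x * ln (f x)" using fg' by eventually_elim simp
  have 3: "integrable lborel (\<lambda>x. g x * ln (g x))"
  proof -
    have "integrable lebesgue (\<lambda>x. g x * ln (g x))" using integrable_cong_AE[OF eml efm eAE] ent by simp
    then show ?thesis using integrable_completion[OF em] by simp
  qed
  have 4: "(LINT x|lborel. g x * ln (g x)) = (LINT x|lebesgue. f x * ln (f x))"
    using integral_completion[OF em] integral_cong_AE[OF eml efm eAE] by simp
  have "loss g \<le> (\<integral>\<^sup>+x. \<integral>\<^sup>+y. ennreal (\<bar>g x - g y\<bar> / norm (x - y) powr (real DIM('a) + \<beta>)) \<partial>lborel \<partial>lborel)"
    unfolding loss_def
  proof (intro nn_integral_mono ennreal_leI)
    fix x y :: 'a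
    define r where "r = norm (x - y)"
    show "(g x - g y) * loss_kernel DIM('a) (norm (x - y)) \<le> \<bar>g x - g y\<bar> / norm (x - y) powr (real DIM('a) + \<beta>)"
    proof (cases "0 < r")
      case True
      have "r powr (real DIM('a) + \<beta>) = r ^ DIM('a) * r powr \<beta>" using True by (simp add: powr_add powr_realpow)
      also have "\<dots> \<le> r ^ DIM('a) * exp r" using True powr_le_exp[OF True \<beta>] by (intro mult_left_mono) auto
      finally have "1 / (r ^ DIM('a) * exp r) \<le> 1 / r powr (real DIM('a) + \<beta>)"
        using True by (intro divide_left_mono) auto
      moreover have "loss_kernel DIM('a) r = 1 / (r ^ DIM('a) * exp r)" using True by (simp add: loss_kernel_def exp_minus field_simps)
      ultimately have "loss_kernel DIM('a) r \<le> 1 / r powr (real DIM('a) + \<beta>)" by simp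
      then have "\<bar>g x - g y\<bar> * loss_kernel DIM('a) r \<le> \<bar>g x - g y\<bar> * (1 / r powr (real DIM('a) + \<beta>))" by (intro mult_left_mono) auto
      moreover have "(g x - g y) * loss_kernel DIM('a) r \<le> \<bar>g x - g y\<bar> * loss_kernel DIM('a) r"
        by (intro mult_right_mono) (auto simp: kernels_nonneg)
      ultimately show ?thesis by (simp add: r_def)
    next
      case False
      then show ?thesis by (simp add: r_def)
    qed
  qed
  also have "\<dots> = (\<integral>\<^sup>+(x, y). ennreal (\<bar>g x - g y\<bar> / norm (x - y) powr (real DIM('a) + \<beta>)) \<partial>lborel)"
    by (rule nn_integral_pair_lborel) (use gm in measurable)
  also have "\<dots> = (\<integral>\<^sup>+(x, y). ennreal (\<bar>f x - f y\<bar> / norm (x - y) powr (real DIM('a) + \<beta>)) \<partial>lborel)"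
    using AE_pair_lborel[OF fg] by (intro nn_integral_cong_AE) (auto elim!: eventually_mono)
  also have "\<dots> < \<infinity>" using fr by (simp only: nn_integral_completion)
  finally have "loss g < \<infinity>" .
  with fg g0 1 2 3 4 show thesis by (rule that)
qed

lemma admissible_inequality:
  fixes f :: "'a::euclidean_space \<Rightarrow> real"
  assumes \<beta>: "0 < \<beta>" "\<beta> < 1" and f: "f \<in> admissible \<beta>"
  defines "S \<equiv> ereal (sigma0 DIM('a) - unit_ball_vol (real DIM('a)) * (LINT x|lebesgue. f x * ln (f x)))"
  shows "(\<integral>\<^sup>+ z. ennreal (- min_integrand f z) \<partial>lebesgue) < \<infinity>"
    and "ext_integral lebesgue (min_integrand f) \<le> S"
    and "S = ext_integral lebesgue (min_integrand f) \<longleftrightarrow>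
      (\<exists>c z r. 0 < r \<and> (AE x in lebesgue. f x = c * indicator (ball z r) x))"
proof -
  obtain g where fg: "AE x in lborel. f x = g x" and g0: "\<And>x. 0 \<le> g x" and g: "integrable lborel g" "(LINT x|lborel. g x) = 1"
    "integrable lborel (\<lambda>x. g x * ln (g x))" and ent: "(LINT x|lborel. g x * ln (g x)) = (LINT x|lebesgue. f x * ln (f x))" and lg: "loss g < \<infinity>"
    using admissible_borel_representative[OF \<beta> f] by blast
  have gm: "g \<in> borel_measurable borel" using g(1) by (simp add: borel_measurable_integrable measurable_lborel1)
  note main = gain_minus_loss[OF g(1) g0 g(2,3) lg]
  note ext = ext_integral_min_integrand[OF gm g0 main(1) lg]
  have AE: "AE z in lebesgue. min_integrand f z = min_integrand g z"
    unfolding AE_completion_iff using AE_pair_lborel[OF fg]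
    by eventually_elim (auto simp: min_integrand_def)
  have neg: "(\<integral>\<^sup>+ z. ennreal (- min_integrand f z) \<partial>lebesgue) = (\<integral>\<^sup>+ z. ennreal (- min_integrand g z) \<partial>lebesgue)"
    and pos: "(\<integral>\<^sup>+ z. ennreal (min_integrand f z) \<partial>lebesgue) = (\<integral>\<^sup>+ z. ennreal (min_integrand g z) \<partial>lebesgue)"
    using AE by (auto intro!: nn_integral_cong_AE elim!: eventually_mono)
  show "(\<integral>\<^sup>+ z. ennreal (- min_integrand f z) \<partial>lebesgue) < \<infinity>" using ext(1) neg by simp
  have E: "ext_integral lebesgue (min_integrand f) = ereal (enn2real (gain g) - enn2real (loss g))"
    using ext(2) unfolding ext_integral_def pos neg .
  show "ext_integral lebesgue (min_integrand f) \<le> S"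
    unfolding E S_def ent[symmetric] using main(2) by simp
  have iff: "(AE x in lborel. g x = c * indicator (ball z r) x) \<longleftrightarrow> (AE x in lebesgue. f x = c * indicator (ball z r) x)" for c z r
    unfolding AE_completion_iff
  proof
    assume "AE x in lborel. g x = c * indicator (ball z r) x"
    with fg show "AE x in lborel. f x = c * indicator (ball z r) x" by eventually_elim simp
  next
    assume "AE x in lborel. f x = c * indicator (ball z r) x"
    with fg show "AE x in lborel. g x = c * indicator (ball z r) x" by eventually_elim simp
  qed
  show "S = ext_integral lebesgue (min_integrand f) \<longleftrightarrow>
      (\<exists>c z r. 0 < r \<and> (AE x in lebesgue. f x = c * indicator (ball z r) x))"
    unfolding E S_def ent[symmetric] iff[symmetric] main(3)[symmetric] by auto
qed

section \<open>Admissibility of the normalized ball\<close>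

lemma nn_integral_powr_tail:
  assumes "0 < \<beta>" "0 < r"
  shows "(\<integral>\<^sup>+\<rho>. indicator {r..} \<rho> * ennreal (\<rho> powr (- 1 - \<beta>)) \<partial>lborel) = ennreal (r powr (- \<beta>) / \<beta>)"
proof -
  have "((\<lambda>\<rho>. - (\<rho> powr (- \<beta>) / \<beta>)) \<longlongrightarrow> - (0 / \<beta>)) at_top"
    using assms by (intro tendsto_minus tendsto_divide tendsto_const tendsto_neg_powr filterlim_ident) auto
  then have "(\<integral>\<^sup>+\<rho>. ennreal (\<rho> powr (- 1 - \<beta>)) * indicator {r..} \<rho> \<partial>lborel) = ennreal (- (0 / \<beta>) - - (r powr (- \<beta>) / \<beta>))"
  proof (rule nn_integral_FTC_atLeast[rotated 3])
    fix \<rho> assume "r \<le> \<rho>"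
    then have "0 < \<rho>" using assms by simp
    then show "((\<lambda>\<rho>. - (\<rho> powr (- \<beta>) / \<beta>)) has_real_derivative \<rho> powr (- 1 - \<beta>)) (at \<rho>)"
      using assms by (auto intro!: derivative_eq_intros simp: powr_diff powr_minus field_simps)
  qed auto
  then show ?thesis by (simp add: mult.commute)
qed

text \<open>The fractional perimeter of the ball. The radial tail beyond \<open>r\<close> equals
  \<open>r powr (- \<beta>) / \<beta>\<close>, which leaves the moment of \<open>chord\<close> of
  order \<open>- \<beta>\<close>; it is finite because \<open>\<beta> < 1\<close>.\<close>

lemma boundary_energy_ball_powr_finite:
  assumes \<beta>: "0 < \<beta>" "\<beta> < 1" and R: "0 < R"
  shows "boundary_energy (\<lambda>r. if 0 < r then r powr (- (real DIM('a) + \<beta>)) else 0) (ball (0::'a::euclidean_space) R) < \<infinity>"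
proof -
  let ?n = "DIM('a)" and ?k = "\<lambda>r. if 0 < r then r powr (- (real DIM('a) + \<beta>)) else (0::real)"
  have n: "0 < ?n" by simp
  have inner: "ennreal (chord ?n R r) * (\<integral>\<^sup>+\<rho>. indicator {0<..} \<rho> * (indicator {r..} \<rho> * ennreal (\<rho> ^ (?n - 1) * ?k \<rho>)) \<partial>lborel)
      = ennreal (1 / \<beta>) * ennreal (chord ?n R r * r powr (- \<beta>))" for r
  proof (cases "0 < r")
    case True
    have "indicator {0<..} \<rho> * (indicator {r..} \<rho> * ennreal (\<rho> ^ (?n - 1) * ?k \<rho>)) = indicator {r..} \<rho> * ennreal (\<rho> powr (- 1 - \<beta>))" for \<rho>
    proof (cases "r \<le> \<rho>")
      case le: True
      then have "0 < \<rho>" using True by simp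
      then have "\<rho> ^ (?n - 1) * ?k \<rho> = \<rho> powr (real (?n - 1) + - (real ?n + \<beta>))"
        unfolding powr_add powr_realpow[OF \<open>0 < \<rho>\<close>] using \<open>0 < \<rho>\<close> by (simp only: if_True)
      also have "real (?n - 1) + - (real ?n + \<beta>) = - 1 - \<beta>" using n by (simp add: of_nat_diff)
      finally show ?thesis using le \<open>0 < \<rho>\<close> by simp
    qed simp
    then have "(\<integral>\<^sup>+\<rho>. indicator {0<..} \<rho> * (indicator {r..} \<rho> * ennreal (\<rho> ^ (?n - 1) * ?k \<rho>)) \<partial>lborel) = ennreal (r powr (- \<beta>) / \<beta>)"
      by (simp only: nn_integral_powr_tail[OF \<beta>(1) True])
    then show ?thesis using \<beta> chord_nonneg[of ?n R r] by (simp only: ennreal_mult'[symmetric]) (simp add: ennreal_mult'[symmetric])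
  qed (simp add: chord_def)
  have "has_bochner_integral lborel (\<lambda>r. chord ?n R r * r powr (- \<beta>))
    (R ^ ?n / real ?n * alpha_sigma ?n (- \<beta>) * (unit_ball_vol (real ?n) * R ^ ?n) powr (- \<beta> / real ?n))"
    using \<beta> by (intro has_bochner_integral_chord_powr R n) auto
  then have "integrable lborel (\<lambda>r. chord ?n R r * r powr (- \<beta>))" by (auto simp: has_bochner_integral_iff)
  then have "(\<integral>\<^sup>+r. ennreal (chord ?n R r * r powr (- \<beta>)) \<partial>lborel) < \<infinity>"
    by (subst nn_integral_eq_integral) (auto simp: chord_nonneg)
  then have "(\<integral>\<^sup>+r. ennreal (1 / \<beta>) * ennreal (chord ?n R r * r powr (- \<beta>)) \<partial>lborel) < \<infinity>"
    by (subst nn_integral_cmult) (auto simp: ennreal_mult_less_top)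
  then show ?thesis
    by (subst boundary_energy_ball[OF R]) (auto simp only: inner ennreal_mult_less_top infinity_ennreal_def, auto)
qed

text \<open>Supplies the extremal that shows optimality of the constant. Its seminorm is its height
  times twice the fractional perimeter, one copy for each order of an inner and an outer
  point.\<close>

lemma normalized_ball_admissible:
  assumes \<beta>: "0 < \<beta>" "\<beta> < 1"
  shows "(\<lambda>x. (1 / unit_ball_vol DIM('a)) * indicator (ball (0::'a::euclidean_space) 1) x) \<in> admissible \<beta>"
proof -
  let ?n = "DIM('a)" and ?B = "ball (0::'a) 1" and ?k = "\<lambda>r. if 0 < r then r powr (- (real DIM('a) + \<beta>)) else (0::real)"
  define c where "c = 1 / unit_ball_vol (real ?n)"
  have w: "0 < unit_ball_vol (real ?n)" by (rule unit_ball_vol_pos) simp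
  have c: "0 < c" unfolding c_def using w by (rule divide_pos_pos[OF zero_less_one])
  define f where "f x = c * indicator ?B x" for x
  have Bm [measurable]: "?B \<in> sets borel" "- ?B \<in> sets borel" by (auto intro: borel_comp)
  have mB: "emeasure lborel ?B = ennreal (unit_ball_vol (real ?n))" by (simp add: emeasure_ball)
  have iB: "integrable lebesgue (indicator ?B :: 'a \<Rightarrow> real)" "(LINT x|lebesgue. indicator ?B x) = unit_ball_vol (real ?n)"
  proof -
    have "integrable lborel (indicator ?B :: 'a \<Rightarrow> real)" using mB by (intro integrable_real_indicator) auto
    then show "integrable lebesgue (indicator ?B :: 'a \<Rightarrow> real)" by (subst integrable_completion) auto
    have "(LINT x|lborel. indicator ?B x) = unit_ball_vol (real ?n)" using mB w by (simp add: measure_def)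
    then show "(LINT x|lebesgue. indicator ?B x) = unit_ball_vol (real ?n)" by (subst integral_completion) auto
  qed
  have km [measurable]: "?k \<in> borel_measurable borel" by measurable
  have k0: "0 \<le> ?k r" for r by simp
  have sym: "(\<integral>\<^sup>+x. \<integral>\<^sup>+y. ennreal (indicator (- ?B) x * indicator ?B y * ?k (norm (x - y))) \<partial>lborel \<partial>lborel) = boundary_energy ?k ?B"
  proof -
    have "(\<integral>\<^sup>+x. \<integral>\<^sup>+y. ennreal (indicator (- ?B) x * indicator ?B y * ?k (norm (x - y))) \<partial>lborel \<partial>lborel)
      = (\<integral>\<^sup>+y. \<integral>\<^sup>+x. ennreal (indicator (- ?B) x * indicator ?B y * ?k (norm (x - y))) \<partial>lborel \<partial>lborel)"
      by (rule lborel_pair.Fubini'[symmetric]) measurable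
    also have "\<dots> = boundary_energy ?k ?B"
      unfolding boundary_energy_def by (intro nn_integral_cong) (simp add: norm_minus_commute mult.commute)
    finally show ?thesis .
  qed
  have fin: "boundary_energy ?k ?B < \<infinity>" by (rule boundary_energy_ball_powr_finite[OF \<beta>]) simp
  have fm [measurable]: "f \<in> borel_measurable borel" unfolding f_def by measurable
  have "(\<integral>\<^sup>+ (x, y). ennreal (\<bar>f x - f y\<bar> / norm (x - y) powr (real ?n + \<beta>)) \<partial>(lebesgue :: ('a \<times> 'a) measure))
    = (\<integral>\<^sup>+x. \<integral>\<^sup>+y. ennreal (\<bar>f x - f y\<bar> / norm (x - y) powr (real ?n + \<beta>)) \<partial>lborel \<partial>lborel)"
    unfolding nn_integral_completion by (rule nn_integral_pair_lborel[symmetric]) measurable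
  also have "\<dots> = (\<integral>\<^sup>+x. \<integral>\<^sup>+y. ennreal c * (ennreal (indicator ?B x * indicator (- ?B) y * ?k (norm (x - y)))
      + ennreal (indicator (- ?B) x * indicator ?B y * ?k (norm (x - y)))) \<partial>lborel \<partial>lborel)"
  proof (intro nn_integral_cong)
    fix x y :: 'a
    show "ennreal (\<bar>f x - f y\<bar> / norm (x - y) powr (real ?n + \<beta>)) = ennreal c * (ennreal (indicator ?B x * indicator (- ?B) y * ?k (norm (x - y)))
      + ennreal (indicator (- ?B) x * indicator ?B y * ?k (norm (x - y))))"
    proof (cases "x \<in> ?B \<longleftrightarrow> y \<in> ?B")
      case True
      then show ?thesis by (auto simp: f_def indicator_def)
    next
      case False
      then have "x \<noteq> y" by auto
      then have "0 < norm (x - y)" by simp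
      then have kk: "?k (norm (x - y)) = 1 / norm (x - y) powr (real ?n + \<beta>)" by (simp only: if_True powr_minus_divide)
      have "\<bar>f x - f y\<bar> = c" using False c by (auto simp: f_def indicator_def)
      then have "ennreal (\<bar>f x - f y\<bar> / norm (x - y) powr (real ?n + \<beta>)) = ennreal c * ennreal (?k (norm (x - y)))"
        using c by (simp only: kk ennreal_mult'[OF less_imp_le[OF c], symmetric] times_divide_eq_right mult_1_right)
      moreover have "indicator ?B x * indicator (- ?B) y * ?k (norm (x - y)) = (if x \<in> ?B then ?k (norm (x - y)) else 0)"
        "indicator (- ?B) x * indicator ?B y * ?k (norm (x - y)) = (if x \<in> ?B then 0 else ?k (norm (x - y)))"
        using False by (auto simp: indicator_def)
      ultimately show ?thesis by (simp only:) (cases "x \<in> ?B"; simp)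
    qed
  qed
  also have "\<dots> = ennreal c * (boundary_energy ?k ?B + boundary_energy ?k ?B)"
    unfolding sym[symmetric] by (subst (2) sym) (simp add: boundary_energy_def nn_integral_cmult nn_integral_add add.commute)
  also have "\<dots> < \<infinity>" using fin by (simp add: ennreal_mult_less_top)
  finally have frac: "(\<integral>\<^sup>+ (x, y). ennreal (\<bar>f x - f y\<bar> / norm (x - y) powr (real ?n + \<beta>)) \<partial>(lebesgue :: ('a \<times> 'a) measure)) < \<infinity>" .
  have fi: "integrable lebesgue f" unfolding f_def using iB by simp
  have f0: "0 \<le> f x" for x using c by (simp add: f_def)
  have "(LINT x|lebesgue. \<bar>f x\<bar>) = c * (LINT x|lebesgue. indicator ?B x)"
    using f0 by (simp add: f_def c less_imp_le)
  also have "\<dots> = 1" unfolding iB(2) c_def times_divide_eq_left mult_1_left by (rule divide_self[OF less_imp_neq[OF w, symmetric]])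
  finally have f1: "(LINT x|lebesgue. \<bar>f x\<bar>) = 1" .
  have "(\<lambda>x. f x * ln (f x)) = (\<lambda>x. (c * ln c) * indicator ?B x)"
    by (auto simp: f_def indicator_def fun_eq_iff)
  then have ent: "integrable lebesgue (\<lambda>x. f x * ln (f x))" using iB by simp
  have "f \<in> admissible \<beta>"
    using fi frac f0 f1 ent by (simp add: admissible_def frac_sobolev_1_def)
  then show ?thesis unfolding f_def[abs_def] c_def .
qed

theorem theoremC:
  fixes \<beta> :: real
  assumes "0 < \<beta>" and "\<beta> < 1"
  shows
    "(\<forall>f \<in> (admissible \<beta> :: ('a::euclidean_space \<Rightarrow> real) set).
        (\<integral>\<^sup>+ z. ennreal (- min_integrand f z) \<partial>lebesgue) < \<infinity> \<and>
        ereal (sigma0 DIM('a) - unit_ball_vol (real DIM('a)) * (LINT x|lebesgue. f x * ln (f x)))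
          \<ge> ext_integral lebesgue (min_integrand f) \<and>
        (ereal (sigma0 DIM('a) - unit_ball_vol (real DIM('a)) * (LINT x|lebesgue. f x * ln (f x)))
            = ext_integral lebesgue (min_integrand f)
          \<longleftrightarrow> (\<exists>c z r. 0 < r \<and> (AE x in lebesgue. f x = c * indicator (ball z r) x)))) \<and>
     (\<forall>C::real.
        (\<forall>f \<in> (admissible \<beta> :: ('a \<Rightarrow> real) set).
           ereal (C - unit_ball_vol (real DIM('a)) * (LINT x|lebesgue. f x * ln (f x)))
             \<ge> ext_integral lebesgue (min_integrand f))
        \<longrightarrow> sigma0 DIM('a) \<le> C)"
proof (intro conjI ballI allI impI)
  fix f :: "'a \<Rightarrow> real" assume f: "f \<in> admissible \<beta>"
  note * = admissible_inequality[OF assms f]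
  show "(\<integral>\<^sup>+ z. ennreal (- min_integrand f z) \<partial>lebesgue) < \<infinity>" by (rule *(1))
  show "ereal (sigma0 DIM('a) - unit_ball_vol (real DIM('a)) * (LINT x|lebesgue. f x * ln (f x)))
      \<ge> ext_integral lebesgue (min_integrand f)" by (rule *(2))
  show "ereal (sigma0 DIM('a) - unit_ball_vol (real DIM('a)) * (LINT x|lebesgue. f x * ln (f x)))
      = ext_integral lebesgue (min_integrand f)
    \<longleftrightarrow> (\<exists>c z r. 0 < r \<and> (AE x in lebesgue. f x = c * indicator (ball z r) x))" by (rule *(3))
next
  fix C :: real
  assume C: "\<forall>f \<in> (admissible \<beta> :: ('a \<Rightarrow> real) set).
    ereal (C - unit_ball_vol (real DIM('a)) * (LINT x|lebesgue. f x * ln (f x))) \<ge> ext_integral lebesgue (min_integrand f)"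
  \<comment> \<open>The normalized ball attains equality with \<open>sigma0\<close>; comparing this
    value with the bound for \<open>C\<close> cancels the common finite entropy term.\<close>
  define f :: "'a \<Rightarrow> real" where "f = (\<lambda>x. (1 / unit_ball_vol DIM('a)) * indicator (ball 0 1) x)"
  have f: "f \<in> admissible \<beta>" unfolding f_def by (rule normalized_ball_admissible[OF assms])
  have "\<exists>c z r. 0 < r \<and> (AE x in lebesgue. f x = c * indicator (ball z r) x)"
    by (intro exI[of _ "1 / unit_ball_vol DIM('a)"] exI[of _ 0] exI[of _ 1]) (simp add: f_def)
  then have "ereal (sigma0 DIM('a) - unit_ball_vol (real DIM('a)) * (LINT x|lebesgue. f x * ln (f x)))
      = ext_integral lebesgue (min_integrand f)"
    using admissible_inequality(3)[OF assms f] by blast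
  also have "\<dots> \<le> ereal (C - unit_ball_vol (real DIM('a)) * (LINT x|lebesgue. f x * ln (f x)))"
    using C f by blast
  finally show "sigma0 DIM('a) \<le> C" by simp
qed

end
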